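(* Let $p\in\{2,3\}$ and $f\in L^2(\Omega)$. For $\sigma_u$ sufficiently large and $\sigma_F>0$, the discrete problem: find $u_h\in S_h^p(\Omega)$ such that $$a_h(u_h,v_h)=\int_\Omega f\,v_h\,dX\qquad\text{for all }v_h\in S_h^p(\Omega),$$ is well-posed, i.e. it has a unique solution $u_h$.
   Context: Setting. $\Omega\subset\mathbb R^2$ is a bounded open polygonal domain, separated by a closed, regular, simple $C^2$ interface curve $\Gamma$ into $\Omega^+,\Omega^-$, with $\overline\Omega=\overline{\Omega^+\cup\Omega^-\cup\Gamma}$. $\beta=\beta^\pm>0$ (constants) on $\Omega^\pm$. $\mathcal T_h$ is a shape-regular triangular mesh of $\Omega$, $h=\max_Th_T$, $h_T=\operatorname{diam}T$. Assumptions: for every edge $e$, $\Gamma\cap e$ is at most one isolated point unless $e\subset\Gamma$; for every element $K$, $\Gamma$ meets $\partial K$ on at most two distinct edges (vertex intersections allowed; two vertex intersections are regarded as lying on two distinct edges); $h<r/2$, where $r>0$ is such that the segments of length $2r$ centered at $X\in\Gamma$ and perpendicular to $\Gamma$ are pairwise disjoint for distinct $X\in\Gamma$. $\mathcal T_h^i=\{T:T\cap\Gamma\neq\emptyset\}$ (interface elements), $\mathcal T_h^n=\mathcal T_h\setminus\mathcal T_h^i$; $T^\pm=T\cap\Omega^\pm$, $\Gamma_T=\Gamma\cap T$. $\mathcal E_h$: all edges; $\mathcal E_h^i$: interface edges (those cut by $\Gamma$), $\mathcal E_h^n=\mathcal E_h\setminus\mathcal E_h^i$; a ring ($\mathring{\mathcal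 E}_h,\mathring{\mathcal E}_h^i,\mathring{\mathcal E}_h^n$) denotes restriction to interior edges; $\mathcal F_h^i$: edges of interface elements. For $e\in\mathcal E_h^i$, $e^\pm=e\cap\Omega^\pm$. On an interior edge $e$ shared by $T_e^1,T_e^2$: $[\![w]\!]=w|_{T_e^1}-w|_{T_e^2}$, $\{\!\{w\}\!\}=\frac12(w|_{T_e^1}+w|_{T_e^2})$, and $n$ is the unit normal pointing from $T_e^1$ to $T_e^2$; on $\Gamma_T$, $[\![w]\!]=w^+-w^-$ and $n$ is the unit normal to $\Gamma$. $\partial_nv=\sum_in_i\partial_iv$, $\partial_{nn}v=\sum_{i,j}n_in_j\partial_{ij}v$. In penalty terms, $\{\!\{\beta\}\!\}=(\beta^++\beta^-)/2$. All derivatives are taken piecewise (on each $T\in\mathcal T_h^n$ and each $T^\pm$, $T\in\mathcal T_h^i$). IFE space. $\{A_i\}_{i\in\mathcal I_p}$ are the degree-$p$ Lagrange nodes of $T$, $\psi^p_{i,T}\in\mathcal P_p(T)$ the Lagrange shape functions. For $T\in\mathcal T_h^n$, $S_h^p(T)=\mathcal P_p(T)$. For $T\in\mathcal T_h^i$, split $\mathcal I_p=\mathcal I_p^+\sqcup\mathcal I_p^-$ according to $A_i\in T^\pm$ (nodes on $\Gamma$ assigned to one side), and in $\mathcal P_p(T)\times\mathcal P_p(T)$ set $\xi_i=(\psi^p_{i,T},0),\ \eta_i=(0,\psi^p_{i,T})$ if $i\in\mathcal I_p^+$, and $\xi_i=(0,\psi^p_{i,T}),\ \eta_i=(\psi^p_{i,T},0)$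 if $i\in\mathcal I_p^-$. With $\lambda>1$, $T_\lambda$ the dilation of $T$ by $\lambda$ about its barycenter, $\Gamma_T^\lambda=T_\lambda\cap\Gamma$, weights $\omega_j>0$, polynomials extended to $\mathbb R^2$, $[\![Du]\!]=Du_1-Du_2$, $[\![\beta Du]\!]=\beta^+Du_1-\beta^-Du_2$ for $u=(u_1,u_2)$, and $\partial_{ntt}v=\sum n_it_jt_k\partial_{ijk}v$ ($n,t$ unit normal and tangent to $\Gamma$), let $$\mathcal J(u,v)=\int_{\Gamma_T^\lambda}\big(\omega_0[\![u]\!][\![v]\!]+\omega_1h^2[\![\partial_nu]\!][\![\partial_nv]\!]+\omega_2h^4[\![\beta\partial_{nn}u]\!][\![\beta\partial_{nn}v]\!]+\omega_3h^6[\![\beta(\partial_n\Delta u+\partial_{ntt}u)]\!][\![\beta(\partial_n\Delta v+\partial_{ntt}v)]\!]\big)ds.$$ For $p\in\{2,3\}$ and each $j\in\mathcal I_p$ there is a unique $\varphi_j=\xi_j+\sum_ic_i\eta_i$ with $\mathcal J(\varphi_j,\eta_i)=0$ for all $i$; $\phi^p_{j,T}$ is the function equal to the first component of $\varphi_j$ on $T^+$ and the second on $T^-$, and $S_h^p(T)=\operatorname{span}\{\phi^p_{j,T}:j\in\mathcal I_p\}$. The global space $S_h^p(\Omega)$ consists of all $u\in L^2(\Omega)$ such that $u|_T\in S_h^p(T)$ for all $T$, $u$ is continuous on every $e\in\mathcal E_h^n$, $u$ is continuous at all Lagrange nodes, and $u|_{\partial\Omega}=0$. Bilinear form. With penalty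 parameters $\sigma_u,\sigma_F,\sigma_n>0$, $a_h=A_h+J_{h,u}+J_{h,n}$, where $A_h(u,v)=\sum_{T\in\mathcal T_h}\int_T\beta\nabla^2u:\nabla^2v\,dX$, $$J_{h,u}(u,v)=-\sum_{e\in\mathring{\mathcal E}_h}\int_e\{\!\{\beta\partial_{nn}u\}\!\}[\![\partial_nv]\!]ds-\sum_{e\in\mathring{\mathcal E}_h}\int_e\{\!\{\beta\partial_{nn}v\}\!\}[\![\partial_nu]\!]ds+\sum_{e\in\mathring{\mathcal E}_h^n}\frac{\sigma_u\beta}{|e|}\int_e[\![\partial_nu]\!][\![\partial_nv]\!]ds$$ $$+\sum_{e\in\mathring{\mathcal E}_h^i}\sum_{s=\pm}\frac{\sigma_u\beta^s}{|e^s|}\int_{e^s}[\![\partial_nu]\!][\![\partial_nv]\!]ds+\sum_{T\in\mathcal T_h^i}\frac{\sigma_u\{\!\{\beta\}\!\}}{h_T}\int_{\Gamma_T}[\![\partial_nu]\!][\![\partial_nv]\!]ds,$$ $$J_{h,n}(u,v)=\sum_{e\in\mathring{\mathcal E}_h^i}\sum_{s=\pm}\sigma_F|e^s|\beta^s\int_{e^s}[\![\partial_{nn}u]\!][\![\partial_{nn}v]\!]ds+\sum_{e\in\mathring{\mathcal E}_h^n\cap\mathcal F_h^i}\sigma_F|e|\beta\int_e[\![\partial_{nn}u]\!][\![\partial_{nn}v]\!]ds$$ $$+\sum_{e\in\mathring{\mathcal E}_h^i}\frac{\sigma_n\{\!\{\beta\}\!\}}{|e|^3}\int_e[\![u]\!][\![v]\!]ds+\sum_{T\in\mathcal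 T_h^i}\frac{\sigma_n\{\!\{\beta\}\!\}}{h_T^3}\int_{\Gamma_T}[\![u]\!][\![v]\!]ds.$$ *)

theory Defs
  imports "HOL-Analysis.Analysis"
begin

type_synonym pt = "real^2"

section \<open>Data of the problem\<close>

text \<open>
  Mesh elements are \<^emph>\<open>open\<close> triangles and edges are \<^emph>\<open>open\<close> segments, so that for an
  element \<open>T\<close> and an edge \<open>e\<close> the sets \<open>T \<inter> \<Gamma>\<close>, \<open>T \<inter> \<Omega>\<^sup>\<plusminus>\<close>, \<open>e \<inter> \<Gamma>\<close>, \<open>e \<inter> \<Omega>\<^sup>\<plusminus>\<close> do not see
  the boundary of \<open>T\<close> and the end points of \<open>e\<close>: an element is not an interface element merely because
  the interface passes through one of its vertices or along one of its edges.

  The interface is given by a 1-periodic parametrization \<open>curve\<close>; \<open>wt j\<close> are the weights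
  \<open>\<omega>\<^sub>j\<close>, \<open>dil\<close> is the dilation factor \<open>\<lambda>\<close>, and \<open>assign T A\<close> tells whether a Lagrange node
  \<open>A \<in> \<Gamma>\<close> of the interface element \<open>T\<close> is assigned to the side \<open>\<Omega>\<^sup>+\<close>.
\<close>

record ife_data =
  Om :: "pt set"
  OmP :: "pt set"
  OmM :: "pt set"
  curve :: "real \<Rightarrow> pt"
  betaP :: real
  betaM :: real
  mesh :: "pt set set"
  dil :: real
  wt :: "nat \<Rightarrow> real"
  assign :: "pt set \<Rightarrow> pt \<Rightarrow> bool"

definition Gam :: "ife_data \<Rightarrow> pt set" where
  "Gam D = path_image (curve D)"

section \<open>Interface curve and curve integrals\<close>

definition closed_regular_simple_C2 :: "(real \<Rightarrow> pt) \<Rightarrow> bool" where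
  "closed_regular_simple_C2 g \<longleftrightarrow>
     simple_path g \<and> (\<forall>t. g (t + 1) = g t) \<and>
     g C1_differentiable_on UNIV \<and>
     (\<lambda>t. vector_derivative g (at t)) C1_differentiable_on UNIV \<and>
     (\<forall>t. vector_derivative g (at t) \<noteq> 0)"

definition rot90 :: "pt \<Rightarrow> pt" where
  "rot90 v = vector [- (v $ 2), v $ 1]"

definition tangent :: "ife_data \<Rightarrow> pt \<Rightarrow> pt" where
  "tangent D x =
     sgn (vector_derivative (curve D) (at (THE t. t \<in> {0..<1} \<and> curve D t = x)))"

definition normal :: "ife_data \<Rightarrow> pt \<Rightarrow> pt" where
  "normal D x = rot90 (tangent D x)"

text \<open>Integral with respect to arc length over the part of the curve \<open>g\<close> lying in \<open>S\<close>.\<close>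

definition curve_integral :: "(real \<Rightarrow> pt) \<Rightarrow> pt set \<Rightarrow> (pt \<Rightarrow> real) \<Rightarrow> real" where
  "curve_integral g S F =
     integral\<^sup>L (lebesgue_on {t \<in> {0..1}. g t \<in> S})
       (\<lambda>t. F (g t) * norm (vector_derivative g (at t)))"

text \<open>Integral over \<open>S \<inter> e\<close>; it does not depend on the orientation that is chosen for \<open>e\<close>.\<close>

definition edge_integral :: "pt set \<Rightarrow> pt set \<Rightarrow> (pt \<Rightarrow> real) \<Rightarrow> real" where
  "edge_integral e S F =
     curve_integral (SOME g. \<exists>a b. a \<noteq> b \<and> e = open_segment a b \<and> g = linepath a b) (S \<inter> e) F"

section \<open>The mesh\<close>

definition polygonal_domain :: "pt set \<Rightarrow> bool" where
  "polygonal_domain \<Omega> \<longleftrightarrow>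
     open \<Omega> \<and> connected \<Omega> \<and> \<Omega> \<noteq> {} \<and> bounded \<Omega> \<and> interior (closure \<Omega>) = \<Omega> \<and>
     (\<exists>L. finite L \<and> (\<forall>s\<in>L. \<exists>a b. s = closed_segment a b) \<and> frontier \<Omega> = \<Union>L)"

definition triangular_mesh :: "pt set \<Rightarrow> pt set set \<Rightarrow> bool" where
  "triangular_mesh \<Omega> M \<longleftrightarrow>
     (\<forall>T\<in>M. 2 simplex closure T \<and> T = interior (closure T)) \<and>
     triangulation (closure ` M) \<and> \<Union>(closure ` M) = closure \<Omega>"

definition shape_regular :: "real \<Rightarrow> pt set set \<Rightarrow> bool" where
  "shape_regular \<kappa> M \<longleftrightarrow> (\<forall>T\<in>M. diameter T \<le> \<kappa> * Sup {\<rho>. \<exists>x. ball x \<rho> \<subseteq> T})"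

definition mesh_size :: "ife_data \<Rightarrow> real" where
  "mesh_size D = Max (diameter ` mesh D)"

definition vertices :: "pt set \<Rightarrow> pt set" where
  "vertices T = {v. v extreme_point_of closure T}"

definition edges_of :: "pt set \<Rightarrow> pt set set" where
  "edges_of T = {rel_interior f |f. f edge_of closure T}"

definition barycenter :: "pt set \<Rightarrow> pt" where
  "barycenter T = (1/3) *\<^sub>R (\<Sum>v\<in>vertices T. v)"

definition edges :: "ife_data \<Rightarrow> pt set set" where
  "edges D = (\<Union>T\<in>mesh D. edges_of T)"

definition interior_edges :: "ife_data \<Rightarrow> pt set set" where
  "interior_edges D =
     {e. \<exists>T1\<in>mesh D. \<exists>T2\<in>mesh D. T1 \<noteq> T2 \<and> e \<in> edges_of T1 \<and> e \<in> edges_of T2}"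

definition interface_elements :: "ife_data \<Rightarrow> pt set set" where
  "interface_elements D = {T \<in> mesh D. T \<inter> Gam D \<noteq> {}}"

definition noninterface_elements :: "ife_data \<Rightarrow> pt set set" where
  "noninterface_elements D = mesh D - interface_elements D"

text \<open>An edge contained in the interface is not cut by it.\<close>

definition interface_edges :: "ife_data \<Rightarrow> pt set set" where
  "interface_edges D = {e \<in> edges D. e \<inter> Gam D \<noteq> {} \<and> \<not> e \<subseteq> Gam D}"

definition noninterface_edges :: "ife_data \<Rightarrow> pt set set" where
  "noninterface_edges D = edges D - interface_edges D"

definition edges_of_interface_elements :: "ife_data \<Rightarrow> pt set set" where
  "edges_of_interface_elements D = (\<Union>T\<in>interface_elements D. edges_of T)"

text \<open>
  Each point of \<open>\<Gamma> \<inter> \<partial>K\<close> is attributed to an edge whose closure contains it: two edges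
  suffice, and unless an edge lies in the interface it receives at most one point.  In
  particular two vertices on the interface count as intersections with two distinct edges.
\<close>

definition meets_at_most_two_edges :: "pt set \<Rightarrow> pt set \<Rightarrow> bool" where
  "meets_at_most_two_edges \<Gamma> K \<longleftrightarrow>
     (\<exists>e1\<in>edges_of K. \<exists>e2\<in>edges_of K. \<exists>S1 S2.
        e1 \<noteq> e2 \<and> \<Gamma> \<inter> frontier K = S1 \<union> S2 \<and>
        S1 \<subseteq> closure e1 \<and> (S1 = closure e1 \<or> (\<exists>x. S1 \<subseteq> {x})) \<and>
        S2 \<subseteq> closure e2 \<and> (S2 = closure e2 \<or> (\<exists>x. S2 \<subseteq> {x})))"

section \<open>Standing assumptions\<close>

definition ife_setting :: "ife_data \<Rightarrow> real \<Rightarrow> real \<Rightarrow> bool" where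
  "ife_setting D r \<kappa> \<longleftrightarrow>
     polygonal_domain (Om D) \<and>
     closed_regular_simple_C2 (curve D) \<and> Gam D \<subseteq> Om D \<and>
     (OmP D = Om D \<inter> inside (Gam D) \<and> OmM D = Om D \<inter> outside (Gam D) \<or>
      OmP D = Om D \<inter> outside (Gam D) \<and> OmM D = Om D \<inter> inside (Gam D)) \<and>
     0 < betaP D \<and> 0 < betaM D \<and>
     triangular_mesh (Om D) (mesh D) \<and> shape_regular \<kappa> (mesh D) \<and>
     (\<forall>e\<in>edges D. e \<subseteq> Gam D \<or> (\<exists>x. Gam D \<inter> e \<subseteq> {x})) \<and>
     (\<forall>K\<in>mesh D. meets_at_most_two_edges (Gam D) K) \<and>
     0 < r \<and>
     (\<forall>X\<in>Gam D. \<forall>Y\<in>Gam D. X \<noteq> Y \<longrightarrow>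
        closed_segment (X - r *\<^sub>R normal D X) (X + r *\<^sub>R normal D X) \<inter>
        closed_segment (Y - r *\<^sub>R normal D Y) (Y + r *\<^sub>R normal D Y) = {}) \<and>
     mesh_size D < r / 2 \<and>
     1 < dil D \<and> (\<forall>j\<in>{0..3}. 0 < wt D j)"

section \<open>Derivatives\<close>

definition pd :: "2 \<Rightarrow> (pt \<Rightarrow> real) \<Rightarrow> pt \<Rightarrow> real" where
  "pd i f x = frechet_derivative f (at x) (axis i 1)"

definition dn :: "pt \<Rightarrow> (pt \<Rightarrow> real) \<Rightarrow> pt \<Rightarrow> real" where
  "dn n f x = (\<Sum>i\<in>UNIV. n $ i * pd i f x)"

definition dnn :: "pt \<Rightarrow> (pt \<Rightarrow> real) \<Rightarrow> pt \<Rightarrow> real" where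
  "dnn n f x = (\<Sum>i\<in>UNIV. \<Sum>j\<in>UNIV. n $ i * n $ j * pd i (pd j f) x)"

definition dntt :: "pt \<Rightarrow> pt \<Rightarrow> (pt \<Rightarrow> real) \<Rightarrow> pt \<Rightarrow> real" where
  "dntt n t f x =
     (\<Sum>i\<in>UNIV. \<Sum>j\<in>UNIV. \<Sum>k\<in>UNIV. n $ i * t $ j * t $ k * pd i (pd j (pd k f)) x)"

definition laplacian :: "(pt \<Rightarrow> real) \<Rightarrow> pt \<Rightarrow> real" where
  "laplacian f x = (\<Sum>i\<in>UNIV. pd i (pd i f) x)"

definition hess_prod :: "(pt \<Rightarrow> real) \<Rightarrow> (pt \<Rightarrow> real) \<Rightarrow> pt \<Rightarrow> real" where
  "hess_prod u v x = (\<Sum>i\<in>UNIV. \<Sum>j\<in>UNIV. pd i (pd j u) x * pd i (pd j v) x)"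

section \<open>Local immersed finite element space\<close>

definition polys :: "nat \<Rightarrow> (pt \<Rightarrow> real) set" where
  "polys p = {f. \<exists>c. \<forall>x. f x = (\<Sum>i\<le>p. \<Sum>j\<le>p - i. c i j * (x $ 1) ^ i * (x $ 2) ^ j)}"

definition nodes :: "nat \<Rightarrow> pt set \<Rightarrow> pt set" where
  "nodes p T =
     {x. \<exists>k :: pt \<Rightarrow> nat. (\<Sum>v\<in>vertices T. k v) = p \<and>
           x = (\<Sum>v\<in>vertices T. (real (k v) / real p) *\<^sub>R v)}"

definition shape_fun :: "nat \<Rightarrow> pt set \<Rightarrow> pt \<Rightarrow> pt \<Rightarrow> real" where
  "shape_fun p T A =
     (THE f. f \<in> polys p \<and> (\<forall>B\<in>nodes p T. f B = (if B = A then 1 else 0)))"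

text \<open>
  The index set \<open>I\<^sub>p\<^sup>+\<close>, a node being its own index.  The closure is needed because the nodes
  may lie on the boundary of the open triangle \<open>T\<close> and of \<open>\<Omega>\<close>.
\<close>

definition plus_nodes :: "ife_data \<Rightarrow> nat \<Rightarrow> pt set \<Rightarrow> pt set" where
  "plus_nodes D p T =
     {A \<in> nodes p T. if A \<in> Gam D then assign D T A else A \<in> closure (T \<inter> OmP D)}"

type_synonym pair_fun = "(pt \<Rightarrow> real) \<times> (pt \<Rightarrow> real)"

definition xi :: "ife_data \<Rightarrow> nat \<Rightarrow> pt set \<Rightarrow> pt \<Rightarrow> pair_fun" where
  "xi D p T A =
     (if A \<in> plus_nodes D p T then (shape_fun p T A, \<lambda>x. 0) else (\<lambda>x. 0, shape_fun p T A))"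

definition eta :: "ife_data \<Rightarrow> nat \<Rightarrow> pt set \<Rightarrow> pt \<Rightarrow> pair_fun" where
  "eta D p T A =
     (if A \<in> plus_nodes D p T then (\<lambda>x. 0, shape_fun p T A) else (shape_fun p T A, \<lambda>x. 0))"

definition dilated :: "ife_data \<Rightarrow> pt set \<Rightarrow> pt set" where
  "dilated D T = (\<lambda>x. barycenter T + dil D *\<^sub>R (x - barycenter T)) ` T"

definition jump0 :: "pair_fun \<Rightarrow> pt \<Rightarrow> real" where
  "jump0 u x = fst u x - snd u x"

definition jump1 :: "ife_data \<Rightarrow> pair_fun \<Rightarrow> pt \<Rightarrow> real" where
  "jump1 D u x = dn (normal D x) (fst u) x - dn (normal D x) (snd u) x"

definition jump2 :: "ife_data \<Rightarrow> pair_fun \<Rightarrow> pt \<Rightarrow> real" where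
  "jump2 D u x =
     betaP D * dnn (normal D x) (fst u) x - betaM D * dnn (normal D x) (snd u) x"

definition jump3 :: "ife_data \<Rightarrow> pair_fun \<Rightarrow> pt \<Rightarrow> real" where
  "jump3 D u x =
     betaP D * (dn (normal D x) (laplacian (fst u)) x
                + dntt (normal D x) (tangent D x) (fst u) x)
     - betaM D * (dn (normal D x) (laplacian (snd u)) x
                + dntt (normal D x) (tangent D x) (snd u) x)"

definition ife_J :: "ife_data \<Rightarrow> pt set \<Rightarrow> pair_fun \<Rightarrow> pair_fun \<Rightarrow> real" where
  "ife_J D T u v =
     curve_integral (curve D) (dilated D T)
       (\<lambda>x. wt D 0 * jump0 u x * jump0 v x
          + wt D 1 * mesh_size D ^ 2 * jump1 D u x * jump1 D v x
          + wt D 2 * mesh_size D ^ 4 * jump2 D u x * jump2 D v x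
          + wt D 3 * mesh_size D ^ 6 * jump3 D u x * jump3 D v x)"

definition ife_comb :: "ife_data \<Rightarrow> nat \<Rightarrow> pt set \<Rightarrow> pt \<Rightarrow> (pt \<Rightarrow> real) \<Rightarrow> pair_fun" where
  "ife_comb D p T A c =
     (\<lambda>x. fst (xi D p T A) x + (\<Sum>B\<in>nodes p T. c B * fst (eta D p T B) x),
      \<lambda>x. snd (xi D p T A) x + (\<Sum>B\<in>nodes p T. c B * snd (eta D p T B) x))"

text \<open>The pair \<open>\<phi>\<^sub>A\<close>; only the values of \<open>c\<close> at the nodes matter.\<close>

definition ife_shape :: "ife_data \<Rightarrow> nat \<Rightarrow> pt set \<Rightarrow> pt \<Rightarrow> pair_fun" where
  "ife_shape D p T A =
     ife_comb D p T A
       (SOME c. \<forall>B\<in>nodes p T. ife_J D T (ife_comb D p T A c) (eta D p T B) = 0)"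

text \<open>
  \<open>in_local_space D p T u\<close> says that the restriction of \<open>u\<close> to \<open>T\<close> belongs to the local
  space.  For an interface element nothing is said about the null set \<open>T \<inter> \<Gamma>\<close>.
\<close>

definition in_local_space :: "ife_data \<Rightarrow> nat \<Rightarrow> pt set \<Rightarrow> (pt \<Rightarrow> real) \<Rightarrow> bool" where
  "in_local_space D p T u \<longleftrightarrow>
     (if T \<in> interface_elements D then
        (\<exists>c. (\<forall>x\<in>T \<inter> OmP D. u x = (\<Sum>A\<in>nodes p T. c A * fst (ife_shape D p T A) x)) \<and>
             (\<forall>x\<in>T \<inter> OmM D. u x = (\<Sum>A\<in>nodes p T. c A * snd (ife_shape D p T A) x)))
      else (\<exists>q\<in>polys p. \<forall>x\<in>T. u x = q x))"

section \<open>Global space\<close>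

definition L2 :: "pt set \<Rightarrow> (pt \<Rightarrow> real) set" where
  "L2 \<Omega> = {f. f \<in> borel_measurable (lebesgue_on \<Omega>) \<and> integrable (lebesgue_on \<Omega>) (\<lambda>x. (f x)\<^sup>2)}"

text \<open>
  The elements of \<open>S\<^sub>h\<^sup>p(\<Omega>)\<close> are classes of functions modulo null sets.  They are represented
  by functions that are piecewise polynomial at every point of each piece and satisfy the
  continuity and boundary conditions pointwise; the values at the remaining points of
  interface edges and of the interface are immaterial.
\<close>

definition S_h :: "ife_data \<Rightarrow> nat \<Rightarrow> (pt \<Rightarrow> real) set" where
  "S_h D p =
     {u \<in> L2 (Om D).
        (\<forall>T\<in>mesh D. in_local_space D p T u) \<and>
        (\<forall>e\<in>noninterface_edges D. \<forall>x\<in>e. continuous (at x within closure (Om D)) u) \<and>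
        (\<forall>T\<in>mesh D. \<forall>A\<in>nodes p T. continuous (at A within closure (Om D)) u) \<and>
        (\<forall>x\<in>frontier (Om D). u x = 0)}"

section \<open>Bilinear form\<close>

text \<open>
  On the interface itself the coefficient is the average of its two traces.  This is used
  only for the penalty terms on an edge contained in the interface.
\<close>

definition beta_avg :: "ife_data \<Rightarrow> real" where
  "beta_avg D = (betaP D + betaM D) / 2"

definition beta :: "ife_data \<Rightarrow> pt \<Rightarrow> real" where
  "beta D x = (if x \<in> OmP D then betaP D else if x \<in> OmM D then betaM D else beta_avg D)"

text \<open>Trace at \<open>x \<in> \<partial>S\<close> of the restriction of \<open>w\<close> to the open set \<open>S\<close>.\<close>

definition trace_from :: "pt set \<Rightarrow> (pt \<Rightarrow> real) \<Rightarrow> pt \<Rightarrow> real" where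
  "trace_from S w x = Lim (at x within S) w"

text \<open>
  The numbering \<open>T\<^sub>e\<^sup>1, T\<^sub>e\<^sup>2\<close> of the two elements sharing an interior edge is arbitrary; the
  bilinear form does not depend on it.
\<close>

definition adjacent :: "ife_data \<Rightarrow> pt set \<Rightarrow> pt set \<times> pt set" where
  "adjacent D e =
     (SOME (T1, T2). T1 \<in> mesh D \<and> T2 \<in> mesh D \<and> T1 \<noteq> T2 \<and> e \<in> edges_of T1 \<and> e \<in> edges_of T2)"

definition edge_jump :: "ife_data \<Rightarrow> pt set \<Rightarrow> (pt \<Rightarrow> real) \<Rightarrow> pt \<Rightarrow> real" where
  "edge_jump D e w x =
     trace_from (fst (adjacent D e)) w x - trace_from (snd (adjacent D e)) w x"

definition edge_avg :: "ife_data \<Rightarrow> pt set \<Rightarrow> (pt \<Rightarrow> real) \<Rightarrow> pt \<Rightarrow> real" where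
  "edge_avg D e w x =
     (trace_from (fst (adjacent D e)) w x + trace_from (snd (adjacent D e)) w x) / 2"

definition edge_normal :: "ife_data \<Rightarrow> pt set \<Rightarrow> pt" where
  "edge_normal D e =
     (THE n. norm n = 1 \<and> (\<forall>x\<in>e. \<forall>y\<in>e. n \<bullet> (x - y) = 0) \<and>
        0 < n \<bullet> (barycenter (snd (adjacent D e)) - barycenter (fst (adjacent D e))))"

definition interface_jump :: "ife_data \<Rightarrow> pt set \<Rightarrow> (pt \<Rightarrow> real) \<Rightarrow> pt \<Rightarrow> real" where
  "interface_jump D T w x = trace_from (T \<inter> OmP D) w x - trace_from (T \<inter> OmM D) w x"

definition side :: "ife_data \<Rightarrow> bool \<Rightarrow> pt set" where
  "side D s = (if s then OmP D else OmM D)"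

definition beta_side :: "ife_data \<Rightarrow> bool \<Rightarrow> real" where
  "beta_side D s = (if s then betaP D else betaM D)"

text \<open>\<open>|e\<^sup>s|\<close>; if it is zero then so are the integrals over \<open>e\<^sup>s\<close>.\<close>

definition len_side :: "ife_data \<Rightarrow> pt set \<Rightarrow> bool \<Rightarrow> real" where
  "len_side D e s = edge_integral e (side D s) (\<lambda>x. 1)"

definition A_h :: "ife_data \<Rightarrow> (pt \<Rightarrow> real) \<Rightarrow> (pt \<Rightarrow> real) \<Rightarrow> real" where
  "A_h D u v = (\<Sum>T\<in>mesh D. integral\<^sup>L (lebesgue_on T) (\<lambda>x. beta D x * hess_prod u v x))"

definition J_hu :: "ife_data \<Rightarrow> real \<Rightarrow> (pt \<Rightarrow> real) \<Rightarrow> (pt \<Rightarrow> real) \<Rightarrow> real" where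
  "J_hu D \<sigma>u u v =
     - (\<Sum>e\<in>interior_edges D. edge_integral e UNIV
          (\<lambda>x. edge_avg D e (\<lambda>y. beta D y * dnn (edge_normal D e) u y) x
               * edge_jump D e (dn (edge_normal D e) v) x))
     - (\<Sum>e\<in>interior_edges D. edge_integral e UNIV
          (\<lambda>x. edge_avg D e (\<lambda>y. beta D y * dnn (edge_normal D e) v y) x
               * edge_jump D e (dn (edge_normal D e) u) x))
     + (\<Sum>e\<in>interior_edges D \<inter> noninterface_edges D. edge_integral e UNIV
          (\<lambda>x. \<sigma>u * beta D x / diameter e
               * (edge_jump D e (dn (edge_normal D e) u) x
                  * edge_jump D e (dn (edge_normal D e) v) x)))
     + (\<Sum>e\<in>interior_edges D \<inter> interface_edges D. \<Sum>s\<in>UNIV.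
          \<sigma>u * beta_side D s / len_side D e s * edge_integral e (side D s)
            (\<lambda>x. edge_jump D e (dn (edge_normal D e) u) x
                 * edge_jump D e (dn (edge_normal D e) v) x))
     + (\<Sum>T\<in>interface_elements D.
          \<sigma>u * beta_avg D / diameter T * curve_integral (curve D) T
            (\<lambda>x. interface_jump D T (dn (normal D x) u) x
                 * interface_jump D T (dn (normal D x) v) x))"

definition J_hn :: "ife_data \<Rightarrow> real \<Rightarrow> real \<Rightarrow> (pt \<Rightarrow> real) \<Rightarrow> (pt \<Rightarrow> real) \<Rightarrow> real" where
  "J_hn D \<sigma>F \<sigma>n u v =
     (\<Sum>e\<in>interior_edges D \<inter> interface_edges D. \<Sum>s\<in>UNIV.
        \<sigma>F * len_side D e s * beta_side D s * edge_integral e (side D s)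
          (\<lambda>x. edge_jump D e (dnn (edge_normal D e) u) x
               * edge_jump D e (dnn (edge_normal D e) v) x))
     + (\<Sum>e\<in>interior_edges D \<inter> noninterface_edges D \<inter> edges_of_interface_elements D.
          edge_integral e UNIV
            (\<lambda>x. \<sigma>F * diameter e * beta D x
                 * (edge_jump D e (dnn (edge_normal D e) u) x
                    * edge_jump D e (dnn (edge_normal D e) v) x)))
     + (\<Sum>e\<in>interior_edges D \<inter> interface_edges D.
          \<sigma>n * beta_avg D / diameter e ^ 3 * edge_integral e UNIV
            (\<lambda>x. edge_jump D e u x * edge_jump D e v x))
     + (\<Sum>T\<in>interface_elements D.
          \<sigma>n * beta_avg D / diameter T ^ 3 * curve_integral (curve D) T
            (\<lambda>x. interface_jump D T u x * interface_jump D T v x))"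

definition a_h ::
  "ife_data \<Rightarrow> real \<Rightarrow> real \<Rightarrow> real \<Rightarrow> (pt \<Rightarrow> real) \<Rightarrow> (pt \<Rightarrow> real) \<Rightarrow> real" where
  "a_h D \<sigma>u \<sigma>F \<sigma>n u v = A_h D u v + J_hu D \<sigma>u u v + J_hn D \<sigma>F \<sigma>n u v"

definition discrete_solution ::
  "ife_data \<Rightarrow> nat \<Rightarrow> real \<Rightarrow> real \<Rightarrow> real \<Rightarrow> (pt \<Rightarrow> real) \<Rightarrow> (pt \<Rightarrow> real) \<Rightarrow> bool" where
  "discrete_solution D p \<sigma>u \<sigma>F \<sigma>n f u \<longleftrightarrow>
     u \<in> S_h D p \<and>
     (\<forall>v\<in>S_h D p. a_h D \<sigma>u \<sigma>F \<sigma>n u v = integral\<^sup>L (lebesgue_on (Om D)) (\<lambda>x. f x * v x))"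

end

theory Submission
  imports Defs
begin

text \<open>
  A function of the space is a polynomial of degree at most \<open>p\<close> on each piece \<open>T \<inter> \<Omega>\<^sup>\<plusminus>\<close>, so
  everything takes place in finite dimension, and the special form of the immersed shape
  functions plays no role.  The only indefinite terms are the consistency terms.  By Young's
  inequality they are controlled by the averages of \<open>\<beta> \<partial>\<^sub>n\<^sub>n u\<close>, which vanish where \<open>A_h D u u\<close> does,
  and by the jumps of \<open>\<partial>\<^sub>n u\<close>, which vanish where the penalty does; in finite dimension a semidefinite
  form is bounded by any other one with a smaller kernel, whence coercivity for large \<open>\<sigma>u\<close>.
  If \<open>a_h\<close> vanishes at \<open>u\<close>, the pieces of \<open>u\<close> are affine, and the jump terms make neighbouring
  pieces coincide: along an edge and along the interface both the difference of the two affine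
  functions and its normal derivative vanish.  As \<open>\<Omega>\<close> minus a finite set is connected, \<open>u\<close> is one
  affine function.  It vanishes at the mesh vertices on \<open>\<partial>\<Omega>\<close>, among which are the extreme points of the
  convex hull of \<open>\<Omega>\<close>, hence identically.
\<close>

section \<open>Semidefinite forms of finite rank\<close>

text \<open>Elements of \<open>S_h\<close> have arbitrary values on parts of the interface and of
  the interface edges. As a space of functions \<open>S_h\<close> therefore need not be
  finite-dimensional, and \<open>a_h\<close> vanishes on functions that are zero almost everywhere.
  This is why there is neither a basis nor definiteness: finite dimension is expressed by finitely
  many sample points that determine a form, solvability is proved for semidefinite forms whose null
  vectors are annihilated by the load, and uniqueness holds up to null sets. The second obstacle is
  that traces are limits, computable only where the element lies, near the point, on one side of the
  interface. Jumps and averages are thus known to be linear in \<open>u\<close> only almost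
  everywhere on an edge. On an edge contained in the interface this one-sidedness comes from the
  disjointness of the normal segments, which keeps the rest of the interface away.\<close>

definition fadd :: "('i \<Rightarrow> real) \<Rightarrow> real \<Rightarrow> ('i \<Rightarrow> real) \<Rightarrow> 'i \<Rightarrow> real" where
  "fadd u c v = (\<lambda>x. u x + c * v x)"

text \<open>Closure under the single operation \<open>fadd\<close> gives sums with
  \<open>c = 1\<close> and multiples with \<open>u = 0\<close>.\<close>

definition lin_space :: "('i \<Rightarrow> real) set \<Rightarrow> bool" where
  "lin_space V \<longleftrightarrow> (\<lambda>_. 0) \<in> V \<and> (\<forall>u\<in>V. \<forall>v\<in>V. \<forall>c. fadd u c v \<in> V)"

text \<open>\<open>I\<close> is a finite set of points such that the values of \<open>u\<close> on \<open>I\<close> determine \<open>B u v\<close>; it replaces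
  a choice of a basis of \<open>V\<close>.\<close>

definition bilin ::
  "('i \<Rightarrow> real) set \<Rightarrow> 'i set \<Rightarrow> (('i \<Rightarrow> real) \<Rightarrow> ('i \<Rightarrow> real) \<Rightarrow> real) \<Rightarrow> bool" where
  "bilin V I B \<longleftrightarrow>
     (\<forall>u\<in>V. \<forall>v\<in>V. \<forall>w\<in>V. \<forall>c. B (fadd u c v) w = B u w + c * B v w \<and>
        B w (fadd u c v) = B w u + c * B w v) \<and>
     (\<forall>u\<in>V. \<forall>v\<in>V. (\<forall>i\<in>I. u i = 0) \<longrightarrow> B u v = 0 \<and> B v u = 0)"

definition psd_form ::
  "('i \<Rightarrow> real) set \<Rightarrow> 'i set \<Rightarrow> (('i \<Rightarrow> real) \<Rightarrow> ('i \<Rightarrow> real) \<Rightarrow> real) \<Rightarrow> bool" where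
  "psd_form V I B \<longleftrightarrow>
     bilin V I B \<and> (\<forall>u\<in>V. \<forall>v\<in>V. B u v = B v u) \<and> (\<forall>u\<in>V. 0 \<le> B u u)"

lemma bilinD:
  assumes "bilin V I B" "u \<in> V" "v \<in> V" "w \<in> V"
  shows "B (fadd u c v) w = B u w + c * B v w" "B w (fadd u c v) = B w u + c * B w v"
  using assms by (auto simp: bilin_def)

lemma bilin_zero:
  assumes "bilin V I B" "u \<in> V" "v \<in> V" "\<And>i. i \<in> I \<Longrightarrow> u i = 0"
  shows "B u v = 0" "B v u = 0"
  using assms by (auto simp: bilin_def)

lemma bilinI:
  assumes "\<And>u v w c. u \<in> V \<Longrightarrow> v \<in> V \<Longrightarrow> w \<in> V \<Longrightarrow> B (fadd u c v) w = B u w + c * B v w"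
    "\<And>u v w c. u \<in> V \<Longrightarrow> v \<in> V \<Longrightarrow> w \<in> V \<Longrightarrow> B w (fadd u c v) = B w u + c * B w v"
    "\<And>u v. u \<in> V \<Longrightarrow> v \<in> V \<Longrightarrow> (\<And>i. i \<in> I \<Longrightarrow> u i = 0) \<Longrightarrow> B u v = 0"
    "\<And>u v. u \<in> V \<Longrightarrow> v \<in> V \<Longrightarrow> (\<And>i. i \<in> I \<Longrightarrow> u i = 0) \<Longrightarrow> B v u = 0"
  shows "bilin V I B"
  unfolding bilin_def using assms by simp

lemma bilin_zero_form: "bilin V I (\<lambda>u v. 0)"
  by (simp add: bilin_def)

lemma bilin_add: "bilin V I B \<Longrightarrow> bilin V I C \<Longrightarrow> bilin V I (\<lambda>u v. B u v + C u v)"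
  by (rule bilinI) (simp_all add: bilinD bilin_zero algebra_simps)

lemma bilin_cmult: "bilin V I B \<Longrightarrow> bilin V I (\<lambda>u v. k * B u v)"
  by (rule bilinI) (simp_all add: bilinD bilin_zero algebra_simps)

lemma bilin_swap: "bilin V I B \<Longrightarrow> bilin V I (\<lambda>u v. B v u)"
  by (rule bilinI) (simp_all add: bilinD bilin_zero)

lemma bilin_sum: "(\<And>a. a \<in> A \<Longrightarrow> bilin V I (B a)) \<Longrightarrow> bilin V I (\<lambda>u v. \<Sum>a\<in>A. B a u v)"
  by (induction A rule: infinite_finite_induct) (simp_all add: bilin_zero_form bilin_add)

section \<open>Positive semidefinite forms and their null vectors\<close>

lemma psd_formI:
  assumes "bilin V I B" "\<And>u v. u \<in> V \<Longrightarrow> v \<in> V \<Longrightarrow> B u v = B v u"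
    "\<And>u. u \<in> V \<Longrightarrow> 0 \<le> B u u"
  shows "psd_form V I B"
  using assms by (simp add: psd_form_def)

lemma psd_formD:
  assumes "psd_form V I B"
  shows "bilin V I B" "\<And>u v. u \<in> V \<Longrightarrow> v \<in> V \<Longrightarrow> B u v = B v u" "\<And>u. u \<in> V \<Longrightarrow> 0 \<le> B u u"
  using assms by (simp_all add: psd_form_def)

lemma psd_form_add: "psd_form V I B \<Longrightarrow> psd_form V I C \<Longrightarrow> psd_form V I (\<lambda>u v. B u v + C u v)"
  unfolding psd_form_def by (simp add: bilin_add)

lemma psd_form_cmult: "psd_form V I B \<Longrightarrow> 0 \<le> k \<Longrightarrow> psd_form V I (\<lambda>u v. k * B u v)"
  unfolding psd_form_def by (simp add: bilin_cmult)

lemma psd_form_sum: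
  assumes "\<And>a. a \<in> A \<Longrightarrow> psd_form V I (B a)"
  shows "psd_form V I (\<lambda>u v. \<Sum>a\<in>A. B a u v)"
  using assms unfolding psd_form_def
  by (auto intro!: bilin_sum sum.cong sum_nonneg)

text \<open>Along the line v + t u the quadratic form is affine in \<open>t\<close>, because the
  coefficient of t^2 is \<open>B u u = 0\<close>; a nonzero slope would make it negative somewhere.
  The chosen \<open>t\<close> gives the value -1.\<close>

lemma psd_form_null:
  assumes "psd_form V I B" "lin_space V" "u \<in> V" "v \<in> V" "B u u = 0"
  shows "B u v = 0"
proof (rule ccontr)
  assume ne: "B u v \<noteq> 0"
  define t where "t = - (B v v + 1) / (2 * B u v)"
  note b = psd_formD[OF assms(1)]
  have w: "fadd v t u \<in> V" using assms by (simp add: lin_space_def)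
  have "B (fadd v t u) (fadd v t u) = B v v + 2 * t * B u v"
    using bilinD[OF b(1)] w assms b(2)[OF \<open>v \<in> V\<close> \<open>u \<in> V\<close>]
    by (simp add: algebra_simps)
  also have "\<dots> = - 1" using ne by (simp add: t_def field_simps)
  finally show False using b(3)[OF w] by simp
qed

text \<open>Restricting to the functions that vanish at \<open>i\<close> removes \<open>i\<close>
  from the determining set. This plays the part of passing to a hyperplane and drives the inductions
  below.\<close>

lemma bilin_slice:
  assumes "bilin V (insert i J) B"
  shows "bilin {u \<in> V. u i = 0} J B"
proof (rule bilinI)
  fix u v w c
  assume h: "u \<in> {u \<in> V. u i = 0}" "v \<in> {u \<in> V. u i = 0}" "w \<in> {u \<in> V. u i = 0}"
  then show "B (fadd u c v) w = B u w + c * B v w" "B w (fadd u c v) = B w u + c * B w v"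
    using bilinD[OF assms] by simp_all
next
  fix u v
  assume h: "u \<in> {u \<in> V. u i = 0}" "v \<in> {u \<in> V. u i = 0}" "\<And>j. j \<in> J \<Longrightarrow> u j = 0"
  then show "B u v = 0" "B v u = 0"
    using bilin_zero[OF assms, of u v] by auto
qed

lemma psd_form_slice:
  "psd_form V (insert i J) B \<Longrightarrow> psd_form {u \<in> V. u i = 0} J B"
  unfolding psd_form_def using bilin_slice[of V i J B] by simp

lemma lin_space_slice: "lin_space V \<Longrightarrow> lin_space {u \<in> V. u i = 0}"
  by (auto simp: lin_space_def fadd_def)

lemma slice_decomp:
  assumes "lin_space V" "z \<in> V" "z i \<noteq> 0" "v \<in> V"
  obtains v' c where "v' \<in> {u \<in> V. u i = 0}" "v = fadd v' c z"
proof
  have "fadd v (- (v i / z i)) z \<in> V"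
    using assms by (simp add: lin_space_def)
  then show "fadd v (- (v i / z i)) z \<in> {u \<in> V. u i = 0}"
    using assms by (simp add: fadd_def)
  show "v = fadd (fadd v (- (v i / z i)) z) (v i / z i) z"
    by (simp add: fadd_def)
qed

text \<open>Induction on the determining set. The problem is solved on the slice
  \<open>u i = 0\<close>; a function that is nonzero at \<open>i\<close> is corrected by its
  \<open>B\<close>-projection onto the slice, itself supplied by the induction hypothesis. The
  result \<open>z\<close> is \<open>B\<close>-orthogonal to the slice, so only the coefficient of
  \<open>z\<close> remains to be found.\<close>

theorem galerkin_semidefinite:
  assumes "finite I" "lin_space V" "psd_form V I B"
    and "\<And>u v c. u \<in> V \<Longrightarrow> v \<in> V \<Longrightarrow> L (fadd u c v) = L u + c * L v"
    and "\<And>u. u \<in> V \<Longrightarrow> B u u = 0 \<Longrightarrow> L u = 0"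
  shows "\<exists>u\<in>V. \<forall>v\<in>V. B u v = L v"
  using assms
proof (induction I arbitrary: V L rule: finite_induct)
  case empty
  have z: "(\<lambda>_. 0) \<in> V" using empty by (simp add: lin_space_def)
  have "B u v = 0" if "u \<in> V" "v \<in> V" for u v
    using bilin_zero[OF psd_formD(1)[OF empty(2)] that] by simp
  then show ?case using z empty(4) by (intro bexI[OF _ z]) simp
next
  case (insert i J)
  note IH = insert.IH and V = insert.prems(1) and B = insert.prems(2)
    and L = insert.prems(3) and L0 = insert.prems(4)
  note b = psd_formD[OF B]
  let ?W = "{u \<in> V. u i = 0}"
  note W = lin_space_slice[OF V, of i] psd_form_slice[OF B]
  obtain u' where u': "u' \<in> ?W" "\<And>v. v \<in> ?W \<Longrightarrow> B u' v = L v"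
    using IH[OF W, of L] L L0 by blast
  show ?case
  proof (cases "\<exists>w\<in>V. w i \<noteq> 0")
    case False
    then have VW: "v \<in> ?W" if "v \<in> V" for v using that by blast
    show ?thesis using u'(1) by (intro bexI[of _ u'] ballI u'(2) VW) auto
  next
    case True
    then obtain w where w: "w \<in> V" "w i \<noteq> 0" by auto
    \<comment> \<open>The projection of \<open>w\<close>: the functional \<open>B w\<close> kills
      the null vectors of \<open>B\<close> by \<open>psd_form_null\<close>, so the induction
      hypothesis applies to it.\<close>
    have "\<exists>u\<in>?W. \<forall>v\<in>?W. B u v = B w v"
    proof (rule IH[OF W, of "B w"])
      show "B w (fadd u c v) = B w u + c * B w v" if "u \<in> ?W" "v \<in> ?W" for u v c
        using that w bilinD(2)[OF b(1)] by auto
      show "B w u = 0" if "u \<in> ?W" "B u u = 0" for u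
        using psd_form_null[OF B V _ w(1)] that b(2) w by auto
    qed
    then obtain w' where w': "w' \<in> ?W" "\<And>v. v \<in> ?W \<Longrightarrow> B w' v = B w v" by blast
    define z where "z = fadd w (- 1) w'"
    have zV: "z \<in> V" using w w' V by (simp add: z_def lin_space_def)
    have zi: "z i \<noteq> 0" using w w' by (simp add: z_def fadd_def)
    have zv: "B z v = 0" "B v z = 0" if "v \<in> ?W" for v
    proof -
      show "B z v = 0"
        using bilinD(1)[OF b(1), of w w' v "- 1"] w w' that by (simp add: z_def)
      then show "B v z = 0" using b(2)[OF zV] that by simp
    qed
    \<comment> \<open>If \<open>B z z = 0\<close>, the equation for the coefficient reads 0 =
      \<open>L z\<close>, which the compatibility hypothesis grants; 0 is then as good as any
      value.\<close>
    define k where "k = (if B z z = 0 then 0 else L z / B z z)"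
    have kz: "k * B z z = L z" using L0[OF zV] by (simp add: k_def)
    have "B (fadd u' k z) v = L v" if v: "v \<in> V" for v
    proof -
      obtain v' c where v': "v' \<in> ?W" "v = fadd v' c z"
        using slice_decomp[OF V zV zi v] by blast
      have "B (fadd u' k z) v = B u' v + k * B z v"
        using bilinD(1)[OF b(1), of u' z v k] u' zV v by simp
      also have "B u' v = L v'"
        using bilinD(2)[OF b(1), of v' z u' c] v' u' zV zv by simp
      also have "B z v = c * B z z"
        using bilinD(2)[OF b(1), of v' z z c] v' zV zv by simp
      also have "L v' + k * (c * B z z) = L v"
        using L[of v' z c] v' zV kz[symmetric] by (metis (mono_tags, lifting) mem_Collect_eq mult.left_commute)
      finally show ?thesis .
    qed
    moreover have "fadd u' k z \<in> V" using u' zV V by (simp add: lin_space_def)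
    ultimately show ?thesis by blast
  qed
qed

text \<open>The parallelogram identity, with the nonnegative term belonging to \<open>- c\<close>
  dropped.\<close>

lemma psd_form_fadd_le:
  assumes "psd_form V I B" "lin_space V" "u \<in> V" "v \<in> V"
  shows "B (fadd u c v) (fadd u c v) \<le> 2 * B u u + 2 * (c\<^sup>2 * B v v)"
proof -
  note b = psd_formD[OF assms(1)]
  have w: "fadd u c v \<in> V" "fadd u (- c) v \<in> V" using assms by (simp_all add: lin_space_def)
  have "B (fadd u c v) (fadd u c v) + B (fadd u (- c) v) (fadd u (- c) v)
      = 2 * B u u + 2 * (c\<^sup>2 * B v v)"
    using w assms(3,4) by (simp add: bilinD[OF b(1)] power2_eq_square algebra_simps)
  with b(3)[OF w(2)] show ?thesis by simp
qed

text \<open>Again by slices: \<open>u\<close> splits into a slice part and a multiple of some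
  \<open>z\<close> that is \<open>A\<close>-orthogonal to the slice. Then \<open>A u u\<close> is
  exactly the sum of the two energies, while \<open>psd_form_fadd_le\<close> bounds
  \<open>N u u\<close> by twice the sum of its own.\<close>

theorem psd_form_comparison:
  assumes "finite I" "lin_space V" "psd_form V I A" "psd_form V I N"
    and "\<And>u. u \<in> V \<Longrightarrow> A u u = 0 \<Longrightarrow> N u u = 0"
  shows "\<exists>C\<ge>0. \<forall>u\<in>V. N u u \<le> C * A u u"
  using assms
proof (induction I arbitrary: V rule: finite_induct)
  case empty
  then show ?case
    using bilin_zero(1)[OF psd_formD(1)[OF empty(2)]] by (intro exI[of _ 0]) force
next
  case (insert i J)
  note V = insert.prems(1) and A = insert.prems(2) and N = insert.prems(3)
    and AN = insert.prems(4)
  note a = psd_formD[OF A] and n = psd_formD[OF N]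
  let ?W = "{u \<in> V. u i = 0}"
  note W = lin_space_slice[OF V, of i] psd_form_slice[OF A]
  obtain C where C: "C \<ge> 0" "\<And>u. u \<in> ?W \<Longrightarrow> N u u \<le> C * A u u"
    using insert.IH[OF W psd_form_slice[OF N]] AN by blast
  show ?case
  proof (cases "\<exists>w\<in>V. w i \<noteq> 0")
    case False
    then have VW: "v \<in> ?W" if "v \<in> V" for v using that by blast
    show ?thesis by (intro exI[of _ C] conjI ballI C VW)
  next
    case True
    then obtain w where w: "w \<in> V" "w i \<noteq> 0" by auto
    have "\<exists>u\<in>?W. \<forall>v\<in>?W. A u v = A w v"
    proof (rule galerkin_semidefinite[OF insert.hyps(1) W, of "A w"])
      show "A w (fadd u c v) = A w u + c * A w v" if "u \<in> ?W" "v \<in> ?W" for u v c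
        using that w bilinD(2)[OF a(1)] by auto
      show "A w u = 0" if "u \<in> ?W" "A u u = 0" for u
        using psd_form_null[OF A V _ w(1)] that a(2) w by auto
    qed
    then obtain w' where w': "w' \<in> ?W" "\<And>v. v \<in> ?W \<Longrightarrow> A w' v = A w v" by blast
    define z where "z = fadd w (- 1) w'"
    have zV: "z \<in> V" using w w' V by (simp add: z_def lin_space_def)
    have zi: "z i \<noteq> 0" using w w' by (simp add: z_def fadd_def)
    have zv: "A z v = 0" "A v z = 0" if "v \<in> ?W" for v
    proof -
      show "A z v = 0"
        using bilinD(1)[OF a(1), of w w' v "- 1"] w w' that by (simp add: z_def)
      then show "A v z = 0" using a(2)[OF zV] that by simp
    qed
    \<comment> \<open>If \<open>A z z = 0\<close> then \<open>N z z = 0\<close> as well, so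
      \<open>K = 0\<close> is correct; otherwise \<open>K\<close> is the Rayleigh quotient of
      \<open>z\<close>.\<close>
    define K where "K = (if A z z = 0 then 0 else N z z / A z z)"
    have K: "K \<ge> 0" "N z z = K * A z z"
      using a(3)[OF zV] n(3)[OF zV] AN[OF zV] by (auto simp: K_def)
    have "N u u \<le> (2 * C + 2 * K) * A u u" if u: "u \<in> V" for u
    proof -
      obtain v c where v: "v \<in> ?W" "u = fadd v c z"
        using slice_decomp[OF V zV zi u] by blast
      have "A u u = A v v + c\<^sup>2 * A z z"
        using bilinD[OF a(1)] v zV u zv by (simp add: power2_eq_square algebra_simps)
      moreover have "N u u \<le> 2 * N v v + 2 * (c\<^sup>2 * N z z)"
        using psd_form_fadd_le[OF N V, of v z c] v zV by simp
      moreover have "N v v \<le> C * A v v" using C v by blast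
      moreover have "0 \<le> C * (c\<^sup>2 * A z z)" "0 \<le> K * A v v"
        using a(3) zV v C K by auto
      ultimately show ?thesis using K(2) by (simp add: algebra_simps)
    qed
    then show ?thesis using C K by (intro exI[of _ "2 * C + 2 * K"]) auto
  qed
qed

section \<open>Bivariate polynomials\<close>

text \<open>Reduces closure properties and differentiation to monomials; the assumption for 0 serves
  the empty sum.\<close>

lemma polys_induct [consumes 1, case_names monomial add zero]:
  assumes "f \<in> polys p"
    and m: "\<And>a b c. a + b \<le> p \<Longrightarrow> P (\<lambda>x. c * (x $ 1) ^ a * (x $ 2) ^ b)"
    and add: "\<And>f g. P f \<Longrightarrow> P g \<Longrightarrow> P (\<lambda>x. f x + g x)"
    and z: "P (\<lambda>x. 0)"
  shows "P f"
proof -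
  obtain c where c: "\<And>x. f x = (\<Sum>i\<le>p. \<Sum>j\<le>p - i. c i j * (x $ 1) ^ i * (x $ 2) ^ j)"
    using assms(1) by (auto simp: polys_def)
  have s: "P (\<lambda>x. \<Sum>i\<in>A. h i x)" if "finite A" "\<And>i. i \<in> A \<Longrightarrow> P (h i)"
    for A :: "nat set" and h
    using that by (induction A rule: finite_induct) (simp_all add: z add)
  have "P (\<lambda>x. \<Sum>i\<le>p. \<Sum>j\<le>p - i. c i j * (x $ 1) ^ i * (x $ 2) ^ j)"
    by (intro s m) auto
  moreover have "f = (\<lambda>x. \<Sum>i\<le>p. \<Sum>j\<le>p - i. c i j * (x $ 1) ^ i * (x $ 2) ^ j)"
    using c by (rule ext)
  ultimately show ?thesis by (simp only:)
qed

lemma polys_zero: "(\<lambda>x. 0) \<in> polys p"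
  unfolding polys_def by (rule CollectI, rule exI[of _ "\<lambda>_ _. 0"]) simp

lemma polys_add:
  assumes "f \<in> polys p" "g \<in> polys p" shows "(\<lambda>x. f x + g x) \<in> polys p"
proof -
  obtain c d where
    "\<And>x. f x = (\<Sum>i\<le>p. \<Sum>j\<le>p - i. c i j * (x $ 1) ^ i * (x $ 2) ^ j)"
    "\<And>x. g x = (\<Sum>i\<le>p. \<Sum>j\<le>p - i. d i j * (x $ 1) ^ i * (x $ 2) ^ j)"
    using assms by (auto simp: polys_def)
  then show ?thesis unfolding polys_def
    by (intro CollectI exI[of _ "\<lambda>i j. c i j + d i j"]) (simp add: sum.distrib algebra_simps)
qed

lemma polys_cmult:
  assumes "f \<in> polys p" shows "(\<lambda>x. k * f x) \<in> polys p"
proof -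
  obtain c where
    "\<And>x. f x = (\<Sum>i\<le>p. \<Sum>j\<le>p - i. c i j * (x $ 1) ^ i * (x $ 2) ^ j)"
    using assms by (auto simp: polys_def)
  then show ?thesis unfolding polys_def
    by (intro CollectI exI[of _ "\<lambda>i j. k * c i j"]) (simp add: sum_distrib_left algebra_simps)
qed

lemma polys_sum: "(\<And>i. i \<in> A \<Longrightarrow> f i \<in> polys p) \<Longrightarrow> (\<lambda>x. \<Sum>i\<in>A. f i x) \<in> polys p"
  by (induction A rule: infinite_finite_induct) (simp_all add: polys_zero polys_add)

lemma polys_monomial:
  assumes "a + b \<le> p" shows "(\<lambda>x. c * (x $ 1) ^ a * (x $ 2) ^ b) \<in> polys p"
proof -
  have "c * x ^ a * y ^ b
      = (\<Sum>i\<le>p. \<Sum>j\<le>p - i. (if i = a then if j = b then c else 0 else 0) * x ^ i * y ^ j)"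
    for x y :: real
  proof -
    have "(\<Sum>j\<le>p - i. (if i = a then if j = b then c else 0 else 0) * x ^ i * y ^ j)
        = (if i = a then c * x ^ a * y ^ b else 0)" for i
    proof (cases "i = a")
      case True
      have "(\<Sum>j\<le>p - a. (if j = b then c else 0) * x ^ a * y ^ j)
          = (\<Sum>j\<le>p - a. if j = b then c * x ^ a * y ^ b else 0)"
        by (intro sum.cong) auto
      with True show ?thesis using assms by simp
    qed simp
    then show ?thesis using assms by simp
  qed
  then show ?thesis unfolding polys_def
    by (intro CollectI exI[of _ "\<lambda>i j. if i = a then if j = b then c else 0 else 0"] allI) auto
qed

lemma polys_mono: "f \<in> polys p \<Longrightarrow> p \<le> q \<Longrightarrow> f \<in> polys q"
  by (induction f rule: polys_induct) (auto intro: polys_monomial polys_add polys_zero)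

lemma polys_mult:
  assumes "f \<in> polys m" "g \<in> polys n" shows "(\<lambda>x. f x * g x) \<in> polys (m + n)"
  using assms(1)
proof (induction f rule: polys_induct)
  case (monomial a b c)
  from assms(2) show ?case
  proof (induction g rule: polys_induct)
    case (monomial a' b' c')
    have "(\<lambda>x. (c * c') * (x $ 1) ^ (a + a') * (x $ 2) ^ (b + b')) \<in> polys (m + n)"
      using monomial \<open>a + b \<le> m\<close> by (intro polys_monomial) auto
    then show ?case by (simp add: power_add mult_ac)
  qed (simp_all add: distrib_left polys_add polys_zero)
qed (simp_all add: distrib_right polys_add polys_zero)

lemma polys_const: "(\<lambda>x. c) \<in> polys p"
  using polys_monomial[of 0 0 p c] by simp

lemma polys_coord: "(\<lambda>x. x $ i) \<in> polys 1"
  using polys_monomial[of 1 0 1 1] polys_monomial[of 0 1 1 1] exhaust_2[of i] by auto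

lemma polys_power: "f \<in> polys m \<Longrightarrow> (\<lambda>x. f x ^ k) \<in> polys (k * m)"
proof (induction k)
  case 0 then show ?case by (simp add: polys_const)
next
  case (Suc k) then show ?case using polys_mult[of f m "\<lambda>x. f x ^ k" "k * m"] by simp
qed

lemma polys_prod:
  assumes "finite A" "\<And>i. i \<in> A \<Longrightarrow> f i \<in> polys 1"
  shows "(\<lambda>x. \<Prod>i\<in>A. f i x) \<in> polys (card A)"
  using assms
proof (induction A rule: finite_induct)
  case empty then show ?case by (simp add: polys_const)
next
  case (insert i A)
  then show ?case using polys_mult[of "f i" 1 "\<lambda>x. \<Prod>i\<in>A. f i x" "card A"] by simp
qed

lemma polys_affine: "(\<lambda>x. k \<bullet> x + d) \<in> polys 1"
proof -
  have "(\<lambda>x. (k $ 1 * x $ 1 + k $ 2 * x $ 2) + d) \<in> polys 1"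
    by (intro polys_add polys_cmult polys_coord polys_const)
  then show ?thesis by (simp add: inner_vec_def sum_2)
qed

lemma polys_affine_comp:
  assumes "f \<in> polys p" "\<And>i. (\<lambda>x. \<phi> x $ i) \<in> polys 1"
  shows "(\<lambda>x. f (\<phi> x)) \<in> polys p"
  using assms(1)
proof (induction f rule: polys_induct)
  case (monomial a b c)
  have "(\<lambda>x. c * (\<phi> x $ 1 ^ a * \<phi> x $ 2 ^ b)) \<in> polys (a * 1 + b * 1)"
    by (intro polys_cmult polys_mult polys_power assms)
  then show ?case using monomial polys_mono by (auto simp: mult.assoc)
qed (simp_all add: polys_add polys_zero)

text \<open>The bound \<open>p\<close> is kept rather than lowered, so that differentiation maps
  \<open>polys p\<close> into itself and can be iterated.\<close>

lemma polys_derivative: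
  assumes "f \<in> polys p"
  obtains g :: "2 \<Rightarrow> pt \<Rightarrow> real" where "\<And>i. g i \<in> polys p"
    "\<And>x. (f has_derivative (\<lambda>h. g 1 x * h $ 1 + g 2 x * h $ 2)) (at x)"
proof -
  have "\<exists>g. (\<forall>i. g i \<in> polys p) \<and>
      (\<forall>x. (f has_derivative (\<lambda>h. g (1::2) x * h $ 1 + g 2 x * h $ 2)) (at x))"
    using assms
  proof (induction f rule: polys_induct)
    case (monomial a b c)
    \<comment> \<open>For \<open>a = 0\<close> the exponent \<open>a - 1\<close> is 0 in the natural
      numbers, but the factor \<open>real a\<close> removes the term.\<close>
    let ?g1 = "\<lambda>x :: pt. (c * real a) * (x $ 1) ^ (a - 1) * (x $ 2) ^ b"
    let ?g2 = "\<lambda>x :: pt. (c * real b) * (x $ 1) ^ a * (x $ 2) ^ (b - 1)"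
    have g: "?g1 \<in> polys p" "?g2 \<in> polys p"
      using monomial by (auto intro!: polys_monomial)
    have d: "((\<lambda>x. c * x $ 1 ^ a * x $ 2 ^ b) has_derivative (\<lambda>h. ?g1 x * h $ 1 + ?g2 x * h $ 2)) (at x)"
      for x :: pt
      by (auto intro!: derivative_eq_intros bounded_linear_imp_has_derivative bounded_linear_vec_nth
          simp: algebra_simps fun_eq_iff)
    show ?case
      by (rule exI[of _ "\<lambda>i. if i = 1 then ?g1 else ?g2"]) (use g d in auto)
  next
    case (add f g)
    then obtain F G where
      "\<forall>i. F i \<in> polys p" "\<forall>x. (f has_derivative (\<lambda>h. F (1::2) x * h $ 1 + F 2 x * h $ 2)) (at x)"
      "\<forall>i. G i \<in> polys p" "\<forall>x. (g has_derivative (\<lambda>h. G (1::2) x * h $ 1 + G 2 x * h $ 2)) (at x)"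
      by blast
    then show ?case
      by (intro exI[of _ "\<lambda>i x. F i x + G i x"])
        (auto intro!: polys_add derivative_eq_intros simp: algebra_simps)
  next
    case zero
    show ?case by (intro exI[of _ "\<lambda>_ _. 0"]) (auto simp: polys_zero)
  qed
  then show ?thesis using that by blast
qed

lemma polys_pd: "f \<in> polys p \<Longrightarrow> pd i f \<in> polys p"
  and polys_has_derivative:
    "f \<in> polys p \<Longrightarrow> (f has_derivative (\<lambda>h. pd 1 f x * h $ 1 + pd 2 f x * h $ 2)) (at x)"
proof -
  assume "f \<in> polys p"
  then obtain g :: "2 \<Rightarrow> pt \<Rightarrow> real" where g: "\<And>i. g i \<in> polys p"
    "\<And>x. (f has_derivative (\<lambda>h. g 1 x * h $ 1 + g 2 x * h $ 2)) (at x)"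
    by (rule polys_derivative) blast
  have "pd i f x = g i x" for i x
    using fun_cong[OF frechet_derivative_at[OF g(2)[of x]], of "axis i 1"] exhaust_2[of i]
    by (auto simp: pd_def axis_def)
  then have pg: "pd i f = g i" for i by auto
  show "pd i f \<in> polys p" using g pg by simp
  show "(f has_derivative (\<lambda>h. pd 1 f x * h $ 1 + pd 2 f x * h $ 2)) (at x)"
    using g pg by simp
qed

lemma polys_continuous: "f \<in> polys p \<Longrightarrow> continuous_on S f"
  by (meson continuous_at_imp_continuous_on has_derivative_continuous polys_has_derivative)

lemma polys_isCont: "f \<in> polys p \<Longrightarrow> isCont f x"
  by (meson has_derivative_continuous polys_has_derivative)

text \<open>The partial derivatives have zero derivative on the whole plane, hence are constants;
  subtracting the linear part leaves a function with zero derivative.\<close>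

lemma polys_affine_of_hessian_0:
  assumes f: "f \<in> polys p" and h: "\<And>i j x. pd i (pd j f) x = 0"
  obtains k d where "\<And>x. f x = k \<bullet> x + d"
proof -
  have c: "\<exists>c. \<forall>x. pd j f x = c" for j
  proof -
    have "(pd j f has_derivative (\<lambda>h. 0)) (at x)" for x
      using polys_has_derivative[OF polys_pd[OF f], of j x] h by simp
    then show ?thesis
      using has_derivative_zero_constant[of UNIV "pd j f"] by auto
  qed
  then obtain K where K: "\<And>j x. pd j f x = K j" by metis
  let ?k = "vector [K 1, K 2] :: pt"
  have "((\<lambda>x. f x - ?k \<bullet> x) has_derivative (\<lambda>h. 0)) (at x)" for x
  proof -
    have "((\<lambda>x. f x - ?k \<bullet> x) has_derivative
        (\<lambda>h. (pd 1 f x * h $ 1 + pd 2 f x * h $ 2) - ?k \<bullet> h)) (at x)"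
      by (intro has_derivative_diff polys_has_derivative[OF f] has_derivative_inner_right has_derivative_ident)
    then show ?thesis by (simp add: K inner_vec_def sum_2)
  qed
  then obtain d where "\<And>x. f x - ?k \<bullet> x = d"
    using has_derivative_zero_constant[of UNIV "\<lambda>x. f x - ?k \<bullet> x"] by auto
  then have "f x = ?k \<bullet> x + d" for x by (metis add.commute diff_add_cancel)
  then show ?thesis by (rule that)
qed

section \<open>Unisolvence\<close>

text \<open>Induction on the degree. Where the second coordinate is 0, the polynomial is univariate
  of degree at most p + 1 with p + 2 zeros, so all \<open>c i 0\<close> vanish. Hence
  \<open>f\<close> is the second coordinate times a polynomial \<open>g\<close> of degree p, which
  vanishes at the grid points with j > 0.\<close>

lemma polys_unisolvent_grid:
  assumes "f \<in> polys p" "\<And>i j. i + j \<le> p \<Longrightarrow> f (vector [real i, real j]) = 0"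
  shows "f x = 0"
  using assms
proof (induction p arbitrary: f x)
  case 0
  then obtain c where "\<And>x. f x = c 0 0" by (auto simp: polys_def)
  with 0(2)[of 0 0] show ?case by simp
next
  case (Suc p)
  obtain c where c: "\<And>x. f x = (\<Sum>i\<le>Suc p. \<Sum>j\<le>Suc p - i. c i j * (x $ 1) ^ i * (x $ 2) ^ j)"
    using Suc.prems(1) unfolding polys_def by blast
  have c0: "c i 0 = 0" if "i \<le> Suc p" for i
  proof (rule ccontr)
    assume "c i 0 \<noteq> 0"
    with that have "finite {z. (\<Sum>i\<le>Suc p. c i 0 * z ^ i) = 0} \<and>
        card {z. (\<Sum>i\<le>Suc p. c i 0 * z ^ i) = 0} \<le> Suc p"
      by (intro polyfun_rootbound exI[of _ i] conjI)
    moreover have "real ` {..Suc p} \<subseteq> {z. (\<Sum>i\<le>Suc p. c i 0 * z ^ i) = 0}"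
    proof
      fix z assume "z \<in> real ` {..Suc p}"
      then obtain n where n: "n \<le> Suc p" "z = real n" by auto
      have "(\<Sum>j\<le>Suc p - i. c i j * z ^ i * 0 ^ j) = c i 0 * z ^ i" for i
      proof -
        have "(\<Sum>j\<le>Suc p - i. c i j * z ^ i * 0 ^ j) = (\<Sum>j\<le>Suc p - i. if j = 0 then c i 0 * z ^ i else 0)"
          by (intro sum.cong) auto
        then show ?thesis by simp
      qed
      then have "f (vector [z, 0]) = (\<Sum>i\<le>Suc p. c i 0 * z ^ i)"
        unfolding c by (simp del: sum.atMost_Suc)
      then show "z \<in> {z. (\<Sum>i\<le>Suc p. c i 0 * z ^ i) = 0}"
        using Suc.prems(2)[of n 0] n by simp
    qed
    ultimately have "card (real ` {..Suc p}) \<le> Suc p"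
      using card_mono le_trans by blast
    then show False by (simp add: card_image)
  qed
  define g where "g x = (\<Sum>i\<le>p. \<Sum>j\<le>p - i. c i (Suc j) * (x $ 1) ^ i * (x $ 2) ^ j)" for x :: pt
  have g: "g \<in> polys p" unfolding polys_def g_def by auto
  have fg: "f x = x $ 2 * g x" for x
  proof -
    have "(\<Sum>j\<le>Suc p - i. c i j * x $ 1 ^ i * x $ 2 ^ j)
        = x $ 2 * (\<Sum>j\<le>p - i. c i (Suc j) * (x $ 1) ^ i * (x $ 2) ^ j)" if "i \<le> p" for i
    proof -
      have "Suc p - i = Suc (p - i)" using that by simp
      then show ?thesis using c0[of i] that
        by (simp add: sum.atMost_Suc_shift sum_distrib_left mult_ac del: sum.atMost_Suc)
    qed
    then show ?thesis using c0[of "Suc p"]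
      unfolding c g_def by (simp add: sum_distrib_left)
  qed
  \<comment> \<open>Shifting by one unit turns the zeros (i, j + 1) of \<open>g\<close> into the
    grid that the induction hypothesis asks for.\<close>
  define g' where "g' x = g (x + vector [0, 1])" for x
  have g': "g' \<in> polys p" unfolding g'_def
  proof (rule polys_affine_comp[OF g])
    fix i :: 2
    have "(\<lambda>x. x $ i + vector [0, 1] $ i) \<in> polys 1"
      by (intro polys_add polys_coord polys_const)
    then show "(\<lambda>x. (x + vector [0, 1]) $ i) \<in> polys 1" by simp
  qed
  have "g' x = 0" for x
  proof (rule Suc.IH[OF g'])
    fix i j :: nat assume "i + j \<le> p"
    have "vector [real i, real j] + vector [0, 1] = (vector [real i, real (Suc j)] :: pt)"
      by (simp add: vec_eq_iff forall_2)
    then show "g' (vector [real i, real j]) = 0"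
      using Suc.prems(2)[of i "Suc j"] fg[of "vector [real i, real (Suc j)]"] \<open>i + j \<le> p\<close>
      by (simp add: g'_def)
  qed
  from this[of "x - vector [0, 1]"] show ?case by (simp add: g'_def fg)
qed

lemma polys_unisolvent:
  assumes f: "f \<in> polys p"
    and z: "\<And>i j. i + j \<le> p \<Longrightarrow> f (a + real i *\<^sub>R v + real j *\<^sub>R w) = 0"
    and span: "x = a + s *\<^sub>R v + t *\<^sub>R w"
  shows "f x = 0"
proof -
  let ?g = "\<lambda>y :: pt. f (a + (y $ 1) *\<^sub>R v + (y $ 2) *\<^sub>R w)"
  have "?g \<in> polys p"
  proof (rule polys_affine_comp[OF f])
    fix i
    have "(\<lambda>y. (a $ i + v $ i * y $ 1) + w $ i * y $ 2) \<in> polys 1"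
      by (intro polys_add polys_cmult polys_const polys_coord)
    then show "(\<lambda>y. (a + y $ 1 *\<^sub>R v + y $ 2 *\<^sub>R w) $ i) \<in> polys 1"
      by (simp add: mult.commute)
  qed
  from polys_unisolvent_grid[OF this, of "vector [s, t]"] z span show ?thesis by simp
qed

text \<open>A unisolvent grid is scaled down until it fits into a ball inside
  \<open>U\<close>.\<close>

lemma polys_determining_set:
  assumes "open U" "U \<noteq> {}"
  obtains J where "finite J" "J \<subseteq> U" "\<And>f x. f \<in> polys p \<Longrightarrow> (\<And>y. y \<in> J \<Longrightarrow> f y = 0) \<Longrightarrow> f x = 0"
proof -
  obtain a \<epsilon> where a: "\<epsilon> > 0" "ball a \<epsilon> \<subseteq> U" using assms by (meson ex_in_conv openE)
  \<comment> \<open>Grid points lie within 2 p \<delta> < \<epsilon> of \<open>a\<close>; the added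
    1 keeps the denominator positive and the inequality strict.\<close>
  define \<delta> where "\<delta> = \<epsilon> / (2 * real p + 1)"
  have \<delta>: "\<delta> > 0" using a by (simp add: \<delta>_def)
  let ?P = "\<lambda>(i, j). a + real i *\<^sub>R (\<delta> *\<^sub>R axis 1 1) + real j *\<^sub>R (\<delta> *\<^sub>R axis 2 1)"
  let ?J = "?P ` ({..p} \<times> {..p})"
  show ?thesis
  proof
    show "finite ?J" by simp
    have "?P (i, j) \<in> U" if "i \<le> p" "j \<le> p" for i j
    proof -
      have "norm (real i *\<^sub>R (\<delta> *\<^sub>R axis 1 1) + real j *\<^sub>R (\<delta> *\<^sub>R axis 2 1) :: pt) \<le> real i * \<delta> + real j * \<delta>"
        using \<delta> by (intro order.trans[OF norm_triangle_ineq]) (simp add: norm_axis_1)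
      also have "\<dots> \<le> real p * \<delta> + real p * \<delta>" using that \<delta> by (intro add_mono mult_right_mono) auto
      also have "\<dots> < \<epsilon>" using a mult_strict_left_mono[of "2 * real p" "2 * real p + 1" \<epsilon>]
          by (simp add: \<delta>_def divide_less_eq mult_ac flip: add_divide_distrib)
      finally have "?P (i, j) \<in> ball a \<epsilon>"
        unfolding mem_ball dist_commute[of a] by (simp add: dist_norm add.assoc)
      then show ?thesis using a by auto
    qed
    then show "?J \<subseteq> U" by auto
    fix f x assume f: "f \<in> polys p" and z: "\<And>y. y \<in> ?J \<Longrightarrow> f y = 0"
    show "f x = 0"
    proof (rule polys_unisolvent[OF f, of a "\<delta> *\<^sub>R axis 1 1" "\<delta> *\<^sub>R axis 2 1"])
      show "f (a + real i *\<^sub>R (\<delta> *\<^sub>R axis 1 1) + real j *\<^sub>R (\<delta> *\<^sub>R axis 2 1)) = 0" if "i + j \<le> p" for i j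
        using that by (intro z) (auto intro!: image_eqI[of _ _ "(i, j)"])
      show "x = a + ((x - a) $ 1 / \<delta>) *\<^sub>R \<delta> *\<^sub>R axis 1 1 + ((x - a) $ 2 / \<delta>) *\<^sub>R \<delta> *\<^sub>R axis 2 1"
        using \<delta> by (simp add: vec_eq_iff forall_2 axis_def)
    qed
  qed
qed

lemma polys_zero_of_open:
  assumes "open U" "U \<noteq> {}" "f \<in> polys p" "\<And>x. x \<in> U \<Longrightarrow> f x = 0"
  shows "f x = 0"
  using polys_determining_set[OF assms(1,2), of p] assms(3,4) by (metis subset_iff)

section \<open>Triangles and barycentric coordinates\<close>

definition cross2 :: "pt \<Rightarrow> pt \<Rightarrow> real" where
  "cross2 u v = u $ 1 * v $ 2 - u $ 2 * v $ 1"

text \<open>The barycentric coordinate belonging to the vertex \<open>a\<close> of the triangle \<open>a\<close>, \<open>b\<close>, \<open>c\<close>.\<close>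

definition bary :: "pt \<Rightarrow> pt \<Rightarrow> pt \<Rightarrow> pt \<Rightarrow> real" where
  "bary a b c x = cross2 (b - x) (c - x) / cross2 (b - a) (c - a)"

text \<open>The vertices are listed in order, so that \<open>tri_rotate\<close> and
  \<open>tri_swap\<close> can bring any edge into the position \<open>a\<close>, \<open>b\<close>;
  the geometric lemmas then treat only that edge.\<close>

definition tri :: "pt set \<Rightarrow> pt \<Rightarrow> pt \<Rightarrow> pt \<Rightarrow> bool" where
  "tri T a b c \<longleftrightarrow> \<not> collinear {a, b, c} \<and> T = interior (convex hull {a, b, c})"

lemma tri_rotate: "tri T a b c \<Longrightarrow> tri T b c a"
  and tri_swap: "tri T a b c \<Longrightarrow> tri T b a c"
  by (simp_all add: tri_def insert_commute)

lemma cross2_nonzero: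
  assumes "\<not> collinear {a, b, c}" shows "cross2 (b - a) (c - a) \<noteq> 0"
proof
  assume z: "cross2 (b - a) (c - a) = 0"
  have nc: "\<not> collinear {0, b - a, c - a}"
    using assms collinear_3[of b a c] by (simp add: insert_commute)
  define u v where uv: "u = b - a" "v = c - a"
  have z': "u $ 1 * v $ 2 = u $ 2 * v $ 1" using z by (simp add: cross2_def uv)
  have "u \<noteq> 0" using nc by (auto simp: collinear_lemma uv)
  then have "u $ 1 \<noteq> 0 \<or> u $ 2 \<noteq> 0" by (simp add: vec_eq_iff forall_2)
  then have "\<exists>k. v = k *\<^sub>R u"
  proof
    assume "u $ 1 \<noteq> 0"
    then show ?thesis using z'
      by (intro exI[of _ "v $ 1 / u $ 1"]) (simp add: vec_eq_iff forall_2 field_simps)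
  next
    assume "u $ 2 \<noteq> 0"
    then show ?thesis using z'
      by (intro exI[of _ "v $ 2 / u $ 2"]) (simp add: vec_eq_iff forall_2 field_simps)
  qed
  then show False using nc by (auto simp: collinear_lemma uv)
qed

context
  fixes T a b c assumes T: "tri T a b c"
begin

lemma tri_cross2: "cross2 (b - a) (c - a) \<noteq> 0" "cross2 (c - b) (a - b) \<noteq> 0"
  "cross2 (a - c) (b - c) \<noteq> 0"
  using cross2_nonzero[of a b c] cross2_nonzero[of b c a] cross2_nonzero[of c a b] T
  by (simp_all add: tri_def insert_commute)

lemma tri_distinct: "a \<noteq> b" "b \<noteq> c" "a \<noteq> c"
  using T by (auto simp: tri_def insert_commute)

lemma tri_affine_independent: "\<not> affine_dependent {a, b, c}"
  using T by (simp add: tri_def collinear_3_eq_affine_dependent)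

lemma bary_sum: "bary a b c x + bary b c a x + bary c a b x = 1"
proof -
  define d where "d = cross2 (b - a) (c - a)"
  have d: "cross2 (c - b) (a - b) = d" "cross2 (a - c) (b - c) = d"
    by (simp_all add: d_def cross2_def algebra_simps)
  have "cross2 (b - x) (c - x) + cross2 (c - x) (a - x) + cross2 (a - x) (b - x) = d"
    by (simp add: d_def cross2_def algebra_simps)
  then show ?thesis using tri_cross2(1)
    by (simp add: bary_def d flip: d_def add_divide_distrib)
qed

lemma bary_decomp: "x = bary a b c x *\<^sub>R a + bary b c a x *\<^sub>R b + bary c a b x *\<^sub>R c"
proof -
  define d where "d = cross2 (b - a) (c - a)"
  have d: "cross2 (c - b) (a - b) = d" "cross2 (a - c) (b - c) = d"
    by (simp_all add: d_def cross2_def algebra_simps)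
  have d0: "d \<noteq> 0" using tri_cross2(1) by (simp add: d_def)
  have "d * x $ i = cross2 (b - x) (c - x) * a $ i + cross2 (c - x) (a - x) * b $ i
      + cross2 (a - x) (b - x) * c $ i" for i
    using exhaust_2[of i] by (auto simp: d_def cross2_def algebra_simps)
  then have "x $ i = (cross2 (b - x) (c - x) * a $ i + cross2 (c - x) (a - x) * b $ i
      + cross2 (a - x) (b - x) * c $ i) / d" for i
    using d0 by (simp add: nonzero_eq_divide_eq mult.commute)
  then show ?thesis
    by (simp add: vec_eq_iff bary_def d add_divide_distrib flip: d_def)
qed

lemma bary_unique:
  assumes "u + v + w = 1" shows "bary a b c (u *\<^sub>R a + v *\<^sub>R b + w *\<^sub>R c) = u"
proof -
  have u: "u = 1 - v - w" using assms by simp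
  have "cross2 (b - (u *\<^sub>R a + v *\<^sub>R b + w *\<^sub>R c)) (c - (u *\<^sub>R a + v *\<^sub>R b + w *\<^sub>R c))
      = u * cross2 (b - a) (c - a)"
    unfolding u by (simp add: cross2_def algebra_simps)
  then show ?thesis using tri_cross2(1) by (simp add: bary_def)
qed

text \<open>The coordinate of \<open>a\<close> vanishes on the line through \<open>b\<close> and
  \<open>c\<close>, so its gradient is normal to that edge. This is what allows two triangles with a
  common edge to be compared.\<close>

lemma bary_affine:
  obtains k where "k \<noteq> 0" "k \<bullet> (c - b) = 0" "\<And>x. bary a b c x = k \<bullet> (x - b)"
proof
  let ?d = "cross2 (b - a) (c - a)"
  let ?k = "(1 / ?d) *\<^sub>R rot90 (c - b)"
  have "rot90 (c - b) \<noteq> 0"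
    using tri_distinct by (auto simp: rot90_def vec_eq_iff forall_2)
  then show "?k \<noteq> 0" using tri_cross2(1) by simp
  have "rot90 (c - b) \<bullet> (c - b) = 0" by (simp add: inner_vec_def sum_2 rot90_def algebra_simps)
  then show "?k \<bullet> (c - b) = 0" by simp
  show "bary a b c x = ?k \<bullet> (x - b)" for x
  proof -
    have "cross2 (b - x) (c - x) = rot90 (c - b) \<bullet> (x - b)"
      by (simp add: cross2_def inner_vec_def sum_2 rot90_def algebra_simps)
    then show ?thesis by (simp add: bary_def)
  qed
qed

end

section \<open>Interior, closure, vertices and edges of a triangle\<close>

lemma tri_interior:
  assumes "tri T a b c"
  shows "T = {x. 0 < bary a b c x \<and> 0 < bary b c a x \<and> 0 < bary c a b x}"
proof -
  have eq: "T = {v. \<exists>x y z. 0 < x \<and> 0 < y \<and> 0 < z \<and> x + y + z = 1 \<and> x *\<^sub>R a + y *\<^sub>R b + z *\<^sub>R c = v}"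
    using interior_convex_hull_3_minimal[of a b c] assms by (simp add: tri_def)
  show ?thesis
  proof (intro set_eqI iffI)
    fix v assume "v \<in> T"
    then obtain x y z where v: "0 < x" "0 < y" "0 < z" "x + y + z = 1" "v = x *\<^sub>R a + y *\<^sub>R b + z *\<^sub>R c"
      unfolding eq by auto
    have "bary a b c v = x" "bary b c a v = y" "bary c a b v = z"
      using bary_unique[OF assms, of x y z] bary_unique[OF tri_rotate[OF assms], of y z x]
        bary_unique[OF tri_rotate[OF tri_rotate[OF assms]], of z x y] v
      by (simp_all add: algebra_simps)
    then show "v \<in> {x. 0 < bary a b c x \<and> 0 < bary b c a x \<and> 0 < bary c a b x}" using v by simp
  next
    fix v assume v: "v \<in> {x. 0 < bary a b c x \<and> 0 < bary b c a x \<and> 0 < bary c a b x}"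
    then show "v \<in> T"
      unfolding eq using bary_sum[OF assms, of v] bary_decomp[OF assms, of v]
      by (intro CollectI exI[of _ "bary a b c v"] exI[of _ "bary b c a v"] exI[of _ "bary c a b v"]) auto
  qed
qed

lemma tri_closure_hull:
  assumes "tri T a b c" shows "closure T = convex hull {a, b, c}"
proof -
  have "(1/3) *\<^sub>R a + (1/3) *\<^sub>R b + (1/3) *\<^sub>R c \<in> interior (convex hull {a, b, c})"
    using interior_convex_hull_3_minimal[of a b c] assms
    by (auto simp: tri_def intro!: exI[of _ "1/3::real"])
  then have "closure (interior (convex hull {a, b, c})) = closure (convex hull {a, b, c})"
    by (intro convex_closure_interior convex_convex_hull) auto
  then show ?thesis using assms
    by (simp add: tri_def compact_imp_closed finite_imp_compact_convex_hull)
qed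

lemma tri_closure:
  assumes "tri T a b c"
  shows "closure T = {x. 0 \<le> bary a b c x \<and> 0 \<le> bary b c a x \<and> 0 \<le> bary c a b x}"
  unfolding tri_closure_hull[OF assms]
proof (intro set_eqI iffI)
  fix v assume "v \<in> convex hull {a, b, c}"
  then obtain x y z where v: "0 \<le> x" "0 \<le> y" "0 \<le> z" "x + y + z = 1" "v = x *\<^sub>R a + y *\<^sub>R b + z *\<^sub>R c"
    unfolding convex_hull_3 by auto
  have "bary a b c v = x" "bary b c a v = y" "bary c a b v = z"
    using bary_unique[OF assms, of x y z] bary_unique[OF tri_rotate[OF assms], of y z x]
      bary_unique[OF tri_rotate[OF tri_rotate[OF assms]], of z x y] v
    by (simp_all add: algebra_simps)
  then show "v \<in> {x. 0 \<le> bary a b c x \<and> 0 \<le> bary b c a x \<and> 0 \<le> bary c a b x}" using v by simp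
next
  fix v assume v: "v \<in> {x. 0 \<le> bary a b c x \<and> 0 \<le> bary b c a x \<and> 0 \<le> bary c a b x}"
  then show "v \<in> convex hull {a, b, c}"
    unfolding convex_hull_3 using bary_sum[OF assms, of v] bary_decomp[OF assms, of v]
    by (intro CollectI exI[of _ "bary a b c v"] exI[of _ "bary b c a v"] exI[of _ "bary c a b v"]) auto
qed

lemma tri_basic:
  assumes "tri T a b c"
  shows "open T" "convex T" "bounded T" "T \<noteq> {}" "T = interior (closure T)"
proof -
  show "open T" "T = interior (closure T)"
    using assms tri_closure_hull[OF assms] by (simp_all add: tri_def)
  show "convex T" using assms by (simp add: tri_def convex_interior)
  have "compact (closure T)"
    using tri_closure_hull[OF assms] by (simp add: finite_imp_compact_convex_hull)
  then show "bounded T" by (meson bounded_subset closure_subset compact_imp_bounded)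
  show "T \<noteq> {}"
    using interior_convex_hull_3_minimal[of a b c] assms
    by (auto simp: tri_def intro!: exI[of _ "1/3::real"])
qed

lemma tri_vertices: "tri T a b c \<Longrightarrow> vertices T = {a, b, c}"
  using extreme_point_of_convex_hull_affine_independent[OF tri_affine_independent]
  by (auto simp: vertices_def tri_closure_hull)

text \<open>The faces of a simplex are the hulls of subsets of its vertices, and dimension one
  selects the subsets with two elements.\<close>

lemma tri_edges:
  assumes "tri T a b c"
  shows "edges_of T = {open_segment a b, open_segment b c, open_segment c a}"
proof -
  note d = tri_distinct[OF assms] and ai = tri_affine_independent[OF assms]
  have e: "f edge_of closure T \<longleftrightarrow>
      f = closed_segment a b \<or> f = closed_segment b c \<or> f = closed_segment c a" for f
  proof
    assume f: "f edge_of closure T"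
    then obtain S where S: "S \<subseteq> {a, b, c}" "f = convex hull S"
      using face_of_convex_hull_affine_independent[OF ai]
      by (auto simp: edge_of_def tri_closure_hull[OF assms])
    have "\<not> affine_dependent S" using ai S(1) affine_dependent_subset by blast
    then have "aff_dim f = int (card S) - 1"
      using S by (simp add: aff_dim_convex_hull aff_dim_affine_independent)
    then have "card S = 2" using f by (simp add: edge_of_def)
    then obtain x y where "S = {x, y}" "x \<noteq> y" by (auto simp: card_2_iff)
    then have "S = {a, b} \<or> S = {b, c} \<or> S = {c, a}" using S(1) by auto
    then show "f = closed_segment a b \<or> f = closed_segment b c \<or> f = closed_segment c a"
      using S(2) by (auto simp: segment_convex_hull)
  next
    have "closed_segment x y edge_of closure T" if "{x, y} \<subseteq> {a, b, c}" "x \<noteq> y" for x y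
    proof -
      have "closed_segment x y face_of closure T"
        using face_of_convex_hull_affine_independent[OF ai] that
        unfolding tri_closure_hull[OF assms] segment_convex_hull by blast
      moreover have "aff_dim (closed_segment x y) = 1"
        using that by (simp add: segment_convex_hull aff_dim_convex_hull)
      ultimately show ?thesis by (simp add: edge_of_def)
    qed
    then show "f edge_of closure T"
      if "f = closed_segment a b \<or> f = closed_segment b c \<or> f = closed_segment c a"
      using that d by blast
  qed
  have "edges_of T = rel_interior ` {closed_segment a b, closed_segment b c, closed_segment c a}"
    unfolding edges_of_def e by blast
  then show ?thesis using d by (simp add: rel_interior_closed_segment)
qed

lemma simplex_tri:
  assumes "2 simplex closure T" "T = interior (closure T)"
  obtains a b c where "tri T a b c"
proof -
  obtain C where C: "\<not> affine_dependent C" "int (card C) = 2 + 1" "closure T = convex hull C"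
    using assms(1) by (auto simp: simplex_def)
  then have "card C = 3" by simp
  then obtain a b c where abc: "C = {a, b, c}" "a \<noteq> b" "b \<noteq> c" "a \<noteq> c" by (auto simp: card_3_iff)
  then have "\<not> collinear {a, b, c}" using C by (simp add: collinear_3_eq_affine_dependent)
  then have "tri T a b c" using assms(2) C abc by (simp add: tri_def)
  then show ?thesis by (rule that)
qed

lemma edge_tri:
  assumes "tri T a b c" "e \<in> edges_of T"
  obtains a' b' c' where "tri T a' b' c'" "e = open_segment a' b'"
proof -
  consider "e = open_segment a b" | "e = open_segment b c" | "e = open_segment c a"
    using assms(2) unfolding tri_edges[OF assms(1)] by blast
  then show ?thesis
    using that[OF assms(1)] that[OF tri_rotate[OF assms(1)]]
      that[OF tri_rotate[OF tri_rotate[OF assms(1)]]] by cases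
qed

lemma bary_polys: "bary a b c \<in> polys 1"
proof -
  have "(\<lambda>x. (1 / cross2 (b - a) (c - a)) * (rot90 (c - b) \<bullet> x + cross2 b c)) \<in> polys 1"
    by (intro polys_cmult polys_affine)
  moreover have "cross2 (b - x) (c - x) = rot90 (c - b) \<bullet> x + cross2 b c" for x
    by (simp add: inner_vec_def sum_2 rot90_def cross2_def algebra_simps)
  then have "bary a b c = (\<lambda>x. (1 / cross2 (b - a) (c - a)) * (rot90 (c - b) \<bullet> x + cross2 b c))"
    by (simp add: bary_def fun_eq_iff)
  ultimately show ?thesis by simp
qed

lemma continuous_on_bary: "continuous_on S (bary a b c)"
  by (rule polys_continuous[OF bary_polys])

text \<open>Near a point of the open edge the coordinates of \<open>a\<close> and \<open>b\<close>
  stay positive, so the sign of the coordinate of \<open>c\<close> alone decides.\<close>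

lemma tri_edge_halfplane:
  assumes T: "tri T a b c" and x: "x \<in> open_segment a b"
  obtains \<epsilon> where "\<epsilon> > 0" "\<And>y. y \<in> ball x \<epsilon> \<Longrightarrow> y \<in> T \<longleftrightarrow> 0 < bary c a b y"
    "\<And>y. y \<in> ball x \<epsilon> \<Longrightarrow> y \<in> closure T \<longleftrightarrow> 0 \<le> bary c a b y"
    "\<And>y. y \<in> ball x \<epsilon> \<Longrightarrow> y \<in> open_segment a b \<longleftrightarrow> bary c a b y = 0"
proof -
  note T' = tri_rotate[OF T] and T'' = tri_rotate[OF tri_rotate[OF T]]
  have seg: "y \<in> open_segment a b \<longleftrightarrow> 0 < bary a b c y \<and> 0 < bary b c a y \<and> bary c a b y = 0" for y
  proof
    assume "y \<in> open_segment a b"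
    then obtain u where u: "0 < u" "u < 1" "y = (1 - u) *\<^sub>R a + u *\<^sub>R b"
      by (auto simp: in_segment)
    then have "bary a b c y = 1 - u" "bary b c a y = u" "bary c a b y = 0"
      using bary_unique[OF T, of "1 - u" u 0] bary_unique[OF T', of u 0 "1 - u"]
        bary_unique[OF T'', of 0 "1 - u" u] by (simp_all add: add.commute)
    with u show "0 < bary a b c y \<and> 0 < bary b c a y \<and> bary c a b y = 0" by simp
  next
    assume h: "0 < bary a b c y \<and> 0 < bary b c a y \<and> bary c a b y = 0"
    have e: "bary a b c y = 1 - bary b c a y" using bary_sum[OF T, of y] h by simp
    have "y = bary a b c y *\<^sub>R a + bary b c a y *\<^sub>R b" using bary_decomp[OF T, of y] h by simp
    then have "y = (1 - bary b c a y) *\<^sub>R a + bary b c a y *\<^sub>R b" unfolding e .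
    moreover have "bary b c a y < 1" using e h by simp
    ultimately show "y \<in> open_segment a b"
      using h tri_distinct[OF T] unfolding in_segment by blast
  qed
  have "open {y. 0 < bary a b c y \<and> 0 < bary b c a y}"
    by (intro open_Collect_conj open_Collect_less continuous_on_bary continuous_intros)
  moreover have "x \<in> {y. 0 < bary a b c y \<and> 0 < bary b c a y}" using x seg by simp
  ultimately obtain \<epsilon> where "\<epsilon> > 0" and \<epsilon>: "ball x \<epsilon> \<subseteq> {y. 0 < bary a b c y \<and> 0 < bary b c a y}"
    by (meson openE)
  show ?thesis
  proof
    fix y assume "y \<in> ball x \<epsilon>"
    then have y: "0 < bary a b c y" "0 < bary b c a y" using \<epsilon> by auto
    then show "y \<in> T \<longleftrightarrow> 0 < bary c a b y" "y \<in> closure T \<longleftrightarrow> 0 \<le> bary c a b y"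
      "y \<in> open_segment a b \<longleftrightarrow> bary c a b y = 0"
      unfolding seg tri_closure[OF T] using tri_interior[OF T] by auto
  qed fact
qed

lemma tri_closure_cases:
  assumes T: "tri T a b c" and x: "x \<in> closure T"
  shows "x \<in> T \<or> x \<in> vertices T \<or> (\<exists>e\<in>edges_of T. x \<in> e)"
proof (cases "x \<in> T \<or> x \<in> vertices T")
  case False
  have seg: "x \<in> closed_segment b' c'" if T': "tri T a' b' c'" and z: "bary a' b' c' x = 0" for a' b' c'
  proof -
    have e: "bary b' c' a' x = 1 - bary c' a' b' x" using bary_sum[OF T', of x] z by simp
    have "x = bary b' c' a' x *\<^sub>R b' + bary c' a' b' x *\<^sub>R c'" using bary_decomp[OF T', of x] z by simp
    then have "x = (1 - bary c' a' b' x) *\<^sub>R b' + bary c' a' b' x *\<^sub>R c'" unfolding e .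
    moreover have "0 \<le> bary c' a' b' x" "bary c' a' b' x \<le> 1"
      using x e unfolding tri_closure[OF T'] by auto
    ultimately show ?thesis unfolding in_segment by blast
  qed
  have "bary a b c x = 0 \<or> bary b c a x = 0 \<or> bary c a b x = 0"
    using False x tri_interior[OF T] unfolding tri_closure[OF T] by force
  then have "x \<in> closed_segment a b \<or> x \<in> closed_segment b c \<or> x \<in> closed_segment c a"
    using seg[OF T] seg[OF tri_rotate[OF T]] seg[OF tri_rotate[OF tri_rotate[OF T]]] by blast
  then show ?thesis using False
    unfolding tri_edges[OF T] tri_vertices[OF T] open_segment_def by auto
qed auto

section \<open>Lagrange shape functions\<close>

lemma tri_nodes:
  assumes "tri T a b c"
  shows "nodes p T = {(real i / real p) *\<^sub>R a + (real j / real p) *\<^sub>R b + (real l / real p) *\<^sub>R c |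
    i j l. i + j + l = p}"
proof (intro set_eqI iffI)
  note d = tri_distinct[OF assms]
  fix x assume "x \<in> nodes p T"
  then obtain k where "(\<Sum>v\<in>{a,b,c}. k v) = p" "x = (\<Sum>v\<in>{a,b,c}. (real (k v) / real p) *\<^sub>R v)"
    by (auto simp: nodes_def tri_vertices[OF assms])
  then show "x \<in> {(real i / real p) *\<^sub>R a + (real j / real p) *\<^sub>R b + (real l / real p) *\<^sub>R c |
    i j l. i + j + l = p}"
    using d by (intro CollectI exI[of _ "k a"] exI[of _ "k b"] exI[of _ "k c"]) (simp add: add.assoc)
next
  note d = tri_distinct[OF assms]
  fix x assume "x \<in> {(real i / real p) *\<^sub>R a + (real j / real p) *\<^sub>R b + (real l / real p) *\<^sub>R c |
    i j l. i + j + l = p}"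
  then obtain i j l where "i + j + l = p"
    "x = (real i / real p) *\<^sub>R a + (real j / real p) *\<^sub>R b + (real l / real p) *\<^sub>R c" by auto
  then show "x \<in> nodes p T"
    unfolding nodes_def tri_vertices[OF assms] using d
    by (intro CollectI exI[of _ "\<lambda>v. if v = a then i else if v = b then j else l"]) (simp add: add.assoc)
qed

lemma vertices_subset_nodes:
  assumes "tri T a b c" "p > 0" shows "vertices T \<subseteq> nodes p T"
proof -
  let ?N = "\<lambda>i j l. (real i / real p) *\<^sub>R a + (real j / real p) *\<^sub>R b + (real l / real p) *\<^sub>R c"
  have "?N i j l \<in> nodes p T" if "i + j + l = p" for i j l
    using that unfolding tri_nodes[OF assms(1)] by blast
  from this[of p 0 0] this[of 0 p 0] this[of 0 0 p] show ?thesis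
    using assms(2) by (simp add: tri_vertices[OF assms(1)])
qed

text \<open>A polynomial in one barycentric coordinate: zero at the levels m/p with m < i, and 1 at
  i/p. The product of three such factors, with indices summing to p, is the Lagrange shape function
  of a node.\<close>

definition lagrange_factor :: "nat \<Rightarrow> nat \<Rightarrow> real \<Rightarrow> real" where
  "lagrange_factor p i s = (\<Prod>m<i. (real p * s - real m) / (real i - real m))"

lemma lagrange_factor_self: "p > 0 \<Longrightarrow> lagrange_factor p i (real i / real p) = 1"
  by (simp add: lagrange_factor_def)

lemma lagrange_factor_less: "p > 0 \<Longrightarrow> j < i \<Longrightarrow> lagrange_factor p i (real j / real p) = 0"
  by (auto simp: lagrange_factor_def prod_zero_iff)

lemma lagrange_factor_polys:
  assumes "g \<in> polys 1" shows "(\<lambda>x. lagrange_factor p i (g x)) \<in> polys i"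
proof -
  have "(\<lambda>x. \<Prod>m\<in>{..<i}. (1 / (real i - real m)) * (real p * g x + (- real m))) \<in> polys (card {..<i})"
    by (intro polys_prod polys_cmult polys_add polys_const assms) simp
  then show ?thesis by (simp add: lagrange_factor_def)
qed

text \<open>\<open>shape_fun\<close> is a definite description, so its degree is known only after
  existence, by the product of three factors, and uniqueness, by unisolvence, are settled.\<close>

lemma shape_fun_polys:
  assumes T: "tri T a b c" and p: "p > 0" and A: "A \<in> nodes p T"
  shows "shape_fun p T A \<in> polys p"
proof -
  note T' = tri_rotate[OF T] and T'' = tri_rotate[OF tri_rotate[OF T]]
  let ?N = "\<lambda>i j l. (real i / real p) *\<^sub>R a + (real j / real p) *\<^sub>R b + (real l / real p) *\<^sub>R c"
  have N: "bary a b c (?N i j l) = real i / real p" "bary b c a (?N i j l) = real j / real p"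
    "bary c a b (?N i j l) = real l / real p" if "i + j + l = p" for i j l
  proof -
    have s: "real i / real p + real j / real p + real l / real p = 1"
    proof -
      have "real i + real j + real l = real p" unfolding that[symmetric] by simp
      then show ?thesis using p by (simp flip: add_divide_distrib)
    qed
    show "bary a b c (?N i j l) = real i / real p" "bary b c a (?N i j l) = real j / real p"
      "bary c a b (?N i j l) = real l / real p"
      using bary_unique[OF T s] bary_unique[OF T', of "real j / real p" "real l / real p" "real i / real p"]
        bary_unique[OF T'', of "real l / real p" "real i / real p" "real j / real p"] s
      by (simp_all add: add_ac)
  qed
  obtain i j l where ijl: "i + j + l = p" "A = ?N i j l" using A by (auto simp: tri_nodes[OF T])
  let ?L = "\<lambda>x. lagrange_factor p i (bary a b c x) * lagrange_factor p j (bary b c a x)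
      * lagrange_factor p l (bary c a b x)"
  have "?L \<in> polys (i + j + l)"
    by (intro polys_mult lagrange_factor_polys bary_polys)
  then have L: "?L \<in> polys p" unfolding ijl(1) .
  have LB: "?L B = (if B = A then 1 else 0)" if B: "B \<in> nodes p T" for B
  proof -
    obtain i' j' l' where B: "i' + j' + l' = p" "B = ?N i' j' l'" using B by (auto simp: tri_nodes[OF T])
    show ?thesis
    proof (cases "B = A")
      case True
      then show ?thesis using N[OF ijl(1)] ijl(2) p by (simp add: lagrange_factor_self)
    next
      case False
      \<comment> \<open>Both index triples sum to \<open>p\<close>, so a different node has some
        smaller index, and the corresponding factor vanishes there.\<close>
      have "i' < i \<or> j' < j \<or> l' < l"
      proof (rule ccontr)
        assume "\<not> (i' < i \<or> j' < j \<or> l' < l)"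
        then have "i' = i" "j' = j" "l' = l" using B(1) ijl(1) by linarith+
        then show False using False B(2) ijl(2) by simp
      qed
      then show ?thesis using N[OF B(1)] B(2) p False by (auto simp: lagrange_factor_less)
    qed
  qed
  have uniq: "f = ?L" if f: "f \<in> polys p" "\<forall>B\<in>nodes p T. f B = (if B = A then 1 else 0)" for f
  proof
    fix x
    have fL: "(\<lambda>x. f x + (- 1) * ?L x) \<in> polys p" by (intro polys_add polys_cmult f L)
    \<comment> \<open>Seen from the corner \<open>c\<close>, the nodes form the grid with steps (a -
      c)/p and (b - c)/p.\<close>
    have "f x + (- 1) * ?L x = 0"
    proof (rule polys_unisolvent[OF fL, of c "(1 / real p) *\<^sub>R (a - c)" "(1 / real p) *\<^sub>R (b - c)"])
      fix i j :: nat assume ij: "i + j \<le> p"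
      define l where "l = p - i - j"
      have l: "i + j + l = p" using ij by (simp add: l_def)
      have "real l = real p - real i - real j" unfolding l[symmetric] by simp
      then have "real l / real p = 1 - real i / real p - real j / real p"
        using p by (simp add: diff_divide_distrib)
      then have "c + real i *\<^sub>R (1 / real p) *\<^sub>R (a - c) + real j *\<^sub>R (1 / real p) *\<^sub>R (b - c) = ?N i j l"
        unfolding \<open>real l / real p = _\<close> by (simp add: algebra_simps)
      moreover have "?N i j l \<in> nodes p T" using l by (auto simp: tri_nodes[OF T])
      ultimately show "f (c + real i *\<^sub>R (1 / real p) *\<^sub>R (a - c) + real j *\<^sub>R (1 / real p) *\<^sub>R (b - c)) + (- 1) *
          ?L (c + real i *\<^sub>R (1 / real p) *\<^sub>R (a - c) + real j *\<^sub>R (1 / real p) *\<^sub>R (b - c)) = 0"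
        using f(2) LB by simp
    next
      have "x = c + bary a b c x *\<^sub>R (a - c) + bary b c a x *\<^sub>R (b - c)"
      proof -
        have "bary c a b x = 1 - bary a b c x - bary b c a x" using bary_sum[OF T, of x] by simp
        then have "x = bary a b c x *\<^sub>R a + bary b c a x *\<^sub>R b + (1 - bary a b c x - bary b c a x) *\<^sub>R c"
          using bary_decomp[OF T, of x] by metis
        also have "\<dots> = c + bary a b c x *\<^sub>R (a - c) + bary b c a x *\<^sub>R (b - c)"
          by (simp add: algebra_simps)
        finally show ?thesis .
      qed
      then show "x = c + (real p * bary a b c x) *\<^sub>R (1 / real p) *\<^sub>R (a - c)
          + (real p * bary b c a x) *\<^sub>R (1 / real p) *\<^sub>R (b - c)" using p by simp
    qed
    then show "f x = ?L x" by simp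
  qed
  have "shape_fun p T A = ?L"
    unfolding shape_fun_def
  proof (rule the_equality)
    show "?L \<in> polys p \<and> (\<forall>B\<in>nodes p T. ?L B = (if B = A then 1 else 0))" using L LB by blast
    fix f assume "f \<in> polys p \<and> (\<forall>B\<in>nodes p T. f B = (if B = A then 1 else 0))"
    then show "f = ?L" using uniq by blast
  qed
  with L show ?thesis by simp
qed

section \<open>The interface curve\<close>

text \<open>By the Jordan-Brouwer theorems every component of the complement has the whole curve as
  its frontier, and the inside and the outside each contain a component.\<close>

lemma closed_curve_in_closure_sides:
  fixes g :: "real \<Rightarrow> pt"
  assumes "simple_path g" "pathfinish g = pathstart g" "x \<in> path_image g"
  shows "x \<in> closure (inside (path_image g))" "x \<in> closure (outside (path_image g))"
proof -
  let ?G = "path_image g"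
  have "?G homeomorphic sphere (0 :: complex) 1"
    using homeomorphic_simple_path_image_circle[OF assms(1,2)] by simp
  moreover have "sphere (0 :: complex) 1 homeomorphic sphere (0 :: pt) 1"
    by (rule homeomorphic_spheres_gen) auto
  ultimately have hom: "?G homeomorphic sphere (0 :: pt) 1" by (rule homeomorphic_trans)
  have fr: "x \<in> closure C" if "C \<in> components (- ?G)" for C
    using Jordan_Brouwer_frontier[OF hom that] assms(3) by (auto simp: frontier_def)
  have "bounded ?G" using assms(1) by (simp add: bounded_simple_path_image)
  have "\<not> connected (- ?G)" using Jordan_Brouwer_separation[OF hom] by simp
  then obtain C where C: "C \<in> components (- ?G)" "bounded C"
    using cobounded_has_bounded_component[of "- ?G"] \<open>bounded ?G\<close> by auto
  then obtain y where y: "C = connected_component_set (- ?G) y" by (auto simp: components_def)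
  have "C \<subseteq> inside ?G"
  proof
    fix z assume z: "z \<in> C"
    then have "connected_component_set (- ?G) z = C"
      using y connected_component_eq by blast
    moreover have "z \<notin> ?G" using z C(1) in_components_subset by blast
    ultimately show "z \<in> inside ?G" using C(2) by (simp add: inside_def)
  qed
  then show "x \<in> closure (inside ?G)" using fr[OF C(1)] closure_mono by blast
  obtain w where w: "w \<in> outside ?G"
    using outside_bounded_nonempty[OF \<open>bounded ?G\<close>] by blast
  have "connected_component_set (- ?G) w \<in> components (- ?G)"
    using w by (auto simp: components_def outside_def)
  moreover have "connected_component_set (- ?G) w \<subseteq> outside ?G"
  proof
    fix z assume z: "z \<in> connected_component_set (- ?G) w"
    then have "connected_component_set (- ?G) z = connected_component_set (- ?G) w"
      using connected_component_eq by blast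
    moreover have "z \<notin> ?G" using z connected_component_subset by blast
    ultimately show "z \<in> outside ?G" using w by (simp add: outside_def)
  qed
  ultimately show "x \<in> closure (outside ?G)" using fr closure_mono by blast
qed

lemma rot90_simps: "rot90 v \<bullet> v = 0" "norm (rot90 v) = norm v"
  by (simp_all add: rot90_def inner_vec_def sum_2 norm_vec_def L2_set_def algebra_simps)

lemma continuous_on_rot90:
  assumes "continuous_on S f" shows "continuous_on S (\<lambda>x. rot90 (f x))"
proof -
  have "rot90 v = (- (v $ 2)) *\<^sub>R axis 1 1 + (v $ 1) *\<^sub>R axis 2 1" for v
    by (simp add: rot90_def vec_eq_iff forall_2 axis_def)
  then show ?thesis using assms by (auto intro!: continuous_intros)
qed

text \<open>The normal as a function of the parameter: \<open>normal\<close> recovers the parameter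
  from the point by a definite description, in which continuity is not visible.\<close>

definition curve_normal :: "ife_data \<Rightarrow> real \<Rightarrow> pt" where
  "curve_normal D t = rot90 (sgn (vector_derivative (curve D) (at t)))"

context
  fixes D :: ife_data assumes C2: "closed_regular_simple_C2 (curve D)"
begin

lemma curve_simple: "simple_path (curve D)" and curve_periodic: "curve D (t + 1) = curve D t"
  and curve_has_derivative:
    "(curve D has_vector_derivative vector_derivative (curve D) (at t)) (at t)"
  and curve_regular: "vector_derivative (curve D) (at t) \<noteq> 0"
  and curve_derivative_continuous: "continuous_on S (\<lambda>t. vector_derivative (curve D) (at t))"
  and curve_continuous: "continuous_on S (curve D)"
proof -
  show s: "simple_path (curve D)" "curve D (t + 1) = curve D t" "vector_derivative (curve D) (at t) \<noteq> 0"
    using C2 by (simp_all add: closed_regular_simple_C2_def)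
  have C1: "curve D C1_differentiable_on UNIV" using C2 by (simp add: closed_regular_simple_C2_def)
  then show "(curve D has_vector_derivative vector_derivative (curve D) (at t)) (at t)"
    by (auto simp: C1_differentiable_on_eq vector_derivative_works)
  show "continuous_on S (\<lambda>t. vector_derivative (curve D) (at t))"
    using C1 by (auto simp: C1_differentiable_on_eq intro: continuous_on_subset)
  show "continuous_on S (curve D)"
    using C1_differentiable_imp_continuous_on[OF C1] by (rule continuous_on_subset) simp
qed

lemma curve_loop: "pathfinish (curve D) = pathstart (curve D)"
  using curve_periodic[of 0] by (simp add: pathfinish_def pathstart_def)

lemma Gam_closed: "closed (Gam D)" and Gam_compact: "compact (Gam D)"
  using curve_simple by (simp_all add: Gam_def closed_simple_path_image compact_simple_path_image)

lemma Gam_negligible: "negligible (Gam D)"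
  unfolding Gam_def path_image_def
proof (rule negligible_differentiable_image_lowdim)
  show "curve D differentiable_on {0..1}"
    using curve_has_derivative
    by (auto simp: differentiable_on_def intro!: differentiableI_vector[OF has_vector_derivative_at_within])
qed simp

lemma Gam_param:
  assumes "x \<in> Gam D" obtains t where "t \<in> {0..<1}" "curve D t = x"
proof -
  obtain t where t: "t \<in> {0..1}" "curve D t = x" using assms by (auto simp: Gam_def path_image_def)
  show ?thesis
  proof (cases "t = 1")
    case True
    then show ?thesis using t curve_periodic[of 0] that[of 0] by simp
  qed (use t that[of t] in auto)
qed

lemma vector_derivative_periodic:
  "vector_derivative (curve D) (at (t + 1)) = vector_derivative (curve D) (at t)"
proof (rule vector_derivative_at)
  have "((curve D \<circ> (\<lambda>s. s - 1)) has_vector_derivative 1 *\<^sub>R vector_derivative (curve D) (at (t + 1 - 1))) (at (t + 1))"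
    by (rule vector_diff_chain_at) (auto intro!: derivative_eq_intros curve_has_derivative)
  moreover have "curve D \<circ> (\<lambda>s. s - 1) = curve D"
    using curve_periodic[of "s - 1" for s] by (auto simp: fun_eq_iff)
  ultimately show "(curve D has_vector_derivative vector_derivative (curve D) (at t)) (at (t + 1))"
    by simp
qed

lemma normal_curve:
  assumes "t \<in> {0..1}" shows "normal D (curve D t) = curve_normal D t"
proof -
  have inj: "s = t" if "s \<in> {0..<1}" "t \<in> {0..<1}" "curve D s = curve D t" for s t
    using curve_simple that unfolding simple_path_def loop_free_def by force
  have *: "tangent D (curve D t) = sgn (vector_derivative (curve D) (at t))" if "t \<in> {0..<1}" for t
  proof -
    have "(THE s. s \<in> {0..<1} \<and> curve D s = curve D t) = t"
      using that inj by (intro the_equality) blast+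
    then show ?thesis by (simp add: tangent_def)
  qed
  have "tangent D (curve D t) = sgn (vector_derivative (curve D) (at t))"
  \<comment> \<open>At \<open>t = 1\<close> the description returns the parameter 0, and periodicity
    identifies the two derivatives.\<close>
  proof (cases "t = 1")
    case True
    then show ?thesis using *[of 0] curve_periodic[of 0] vector_derivative_periodic[of 0] by simp
  qed (use * assms in auto)
  then show ?thesis by (simp add: normal_def curve_normal_def)
qed

lemma curve_normal_simps:
  "norm (curve_normal D t) = 1" "curve_normal D t \<bullet> vector_derivative (curve D) (at t) = 0"
proof -
  show "norm (curve_normal D t) = 1"
    using curve_regular by (simp add: curve_normal_def rot90_simps norm_sgn)
  have "rot90 (sgn v) \<bullet> v = norm v * (rot90 (sgn v) \<bullet> sgn v)" for v :: pt
    by (cases "v = 0") (simp_all add: sgn_div_norm)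
  then show "curve_normal D t \<bullet> vector_derivative (curve D) (at t) = 0"
    by (simp add: curve_normal_def rot90_simps)
qed

lemma curve_normal_continuous: "continuous_on S (curve_normal D)"
  unfolding curve_normal_def using curve_regular
  by (intro continuous_on_rot90 continuous_on_sgn curve_derivative_continuous) auto

text \<open>The difference quotients of the curve along a sequence of points of the segment are parallel
  to the segment.\<close>

lemma normal_on_segment:
  assumes ab: "a \<noteq> b" "open_segment a b \<subseteq> Gam D" and x: "x \<in> open_segment a b"
  obtains c where "normal D x = c *\<^sub>R rot90 (b - a)" "\<bar>c\<bar> * norm (b - a) = 1"
proof -
  obtain u where u: "0 < u" "u < 1" "x = (1 - u) *\<^sub>R a + u *\<^sub>R b"
    using x by (auto simp: in_segment)
  \<comment> \<open>Parameters decreasing to \<open>u\<close>: the factor is 1/(n + 2) < 1, which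
    keeps them below 1.\<close>
  define v where "v n = u + (1 - u) * inverse (real (Suc (n + 1)))" for n :: nat
  have v: "u < v n" "v n < 1" for n
  proof -
    show "u < v n" using u by (simp add: v_def)
    have "(1 - u) * inverse (real (Suc (n + 1))) < (1 - u) * 1"
      using u by (intro mult_strict_left_mono) (simp_all add: field_simps)
    then show "v n < 1" by (simp add: v_def)
  qed
  have vlim: "v \<longlonglongrightarrow> u"
  proof -
    have "v \<longlonglongrightarrow> u + (1 - u) * 0" unfolding v_def
      by (intro tendsto_intros LIMSEQ_ignore_initial_segment[OF LIMSEQ_inverse_real_of_nat, of 1])
    then show ?thesis by simp
  qed
  define y where "y n = (1 - v n) *\<^sub>R a + v n *\<^sub>R b" for n
  have "y n \<in> open_segment a b" for n
    using v[of n] u ab(1) by (auto simp: in_segment y_def intro!: exI[of _ "v n"])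
  then have "y n \<in> curve D ` {0..1}" for n
    using ab(2) unfolding Gam_def path_image_def by blast
  then have "\<exists>t\<in>{0..1}. curve D t = y n" for n
    by (metis (no_types, lifting) imageE)
  then obtain t where t: "\<And>n. t n \<in> {0..1}" "\<And>n. curve D (t n) = y n" by metis
  \<comment> \<open>The curve parameters of the points \<open>y n\<close> need not converge, but a
    subsequence does, and its limit is a parameter of \<open>x\<close>.\<close>
  obtain s k where s: "s \<in> {0..1}" "strict_mono (k :: nat \<Rightarrow> nat)" "(t \<circ> k) \<longlonglongrightarrow> s"
    using compact_imp_seq_compact[OF compact_Icc, of "0::real" 1] t(1)
    unfolding seq_compact_def by blast
  have "y \<longlonglongrightarrow> (1 - u) *\<^sub>R a + u *\<^sub>R b" unfolding y_def by (intro tendsto_intros vlim)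
  then have ylim: "(y \<circ> k) \<longlonglongrightarrow> x" using s(2) u(3) by (simp add: LIMSEQ_subseq_LIMSEQ)
  have "(\<lambda>n. curve D ((t \<circ> k) n)) \<longlonglongrightarrow> curve D s"
    by (rule isCont_tendsto_compose[OF _ s(3)])
      (use curve_continuous[of UNIV] in \<open>simp add: continuous_on_eq_continuous_at\<close>)
  then have "(y \<circ> k) \<longlonglongrightarrow> curve D s" using t(2) by (simp add: o_def)
  then have xs: "curve D s = x" using ylim LIMSEQ_unique by blast
  let ?w = "rot90 (b - a)"
  let ?d = "vector_derivative (curve D) (at s)"
  have "((\<lambda>t. ?w \<bullet> curve D t) has_real_derivative ?w \<bullet> ?d) (at s)"
    using has_vector_derivative_def curve_has_derivative[of s]
    unfolding has_field_derivative_def has_vector_derivative_def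
    by (auto intro!: derivative_eq_intros simp: mult.commute fun_eq_iff)
  then have q: "((\<lambda>t. (?w \<bullet> curve D t - ?w \<bullet> curve D s) / (t - s)) \<longlongrightarrow> ?w \<bullet> ?d) (at s)"
    by (simp add: has_field_derivative_iff)
  have wy: "?w \<bullet> y n = ?w \<bullet> x" for n
  proof -
    have "y n - x = (v n - u) *\<^sub>R (b - a)" by (simp add: y_def u algebra_simps)
    then have "?w \<bullet> (y n - x) = 0" by (simp add: rot90_simps)
    then show ?thesis by (simp add: inner_diff_right)
  qed
  have yx: "y n \<noteq> x" for n
  proof -
    have "y n - x = (v n - u) *\<^sub>R (b - a)" by (simp add: y_def u algebra_simps)
    then show ?thesis using v(1)[of n] ab(1) by auto
  qed
  \<comment> \<open>The parameters differ from \<open>s\<close> because the points differ from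
    \<open>x\<close>. The difference quotients of the component along \<open>?w\<close> are
    therefore defined; they are all 0 and converge to \<open>?w \<bullet> ?d\<close>.\<close>
  have "filterlim (t \<circ> k) (at s) sequentially"
  proof (rule filterlim_atI[OF s(3)], rule always_eventually, rule allI)
    show "(t \<circ> k) n \<noteq> s" for n using yx[of "k n"] t(2)[of "k n"] xs by auto
  qed
  from filterlim_compose[OF q this]
  have "(\<lambda>n. 0) \<longlonglongrightarrow> ?w \<bullet> ?d" by (simp add: t(2) wy xs)
  then have wd: "?w \<bullet> ?d = 0" by (simp add: LIMSEQ_const_iff)
  define n where "n = curve_normal D s"
  have nd: "n \<bullet> ?d = 0" and n1: "norm n = 1" using curve_normal_simps[of s] by (simp_all add: n_def)
  have w0: "?w \<noteq> 0" using ab(1) rot90_simps(2)[of "b - a"] by auto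
  \<comment> \<open>\<open>n\<close> and \<open>?w\<close> are both perpendicular to the nonzero
    vector \<open>?d\<close>, hence parallel in the plane.\<close>
  have par: "n $ 1 * ?w $ 2 = n $ 2 * ?w $ 1"
  proof -
    have d0: "?d $ 1 \<noteq> 0 \<or> ?d $ 2 \<noteq> 0" using curve_regular[of s] by (simp add: vec_eq_iff forall_2)
    have e: "?w $ 1 * ?d $ 1 = - (?w $ 2 * ?d $ 2)" "n $ 1 * ?d $ 1 = - (n $ 2 * ?d $ 2)"
      using wd nd by (simp_all add: inner_vec_def sum_2)
    have "(n $ 1 * ?w $ 2 - n $ 2 * ?w $ 1) * ?d $ 1 = 0"
      "(n $ 1 * ?w $ 2 - n $ 2 * ?w $ 1) * ?d $ 2 = 0"
      using e by algebra+
    then show ?thesis using d0 by auto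
  qed
  define c where "c = (n \<bullet> ?w) / (?w \<bullet> ?w)"
  have nc: "n = c *\<^sub>R ?w"
  proof -
    have "(?w \<bullet> ?w) * n $ 1 = (n \<bullet> ?w) * ?w $ 1" "(?w \<bullet> ?w) * n $ 2 = (n \<bullet> ?w) * ?w $ 2"
      using par by (simp_all add: inner_vec_def sum_2) algebra+
    then show ?thesis using w0 by (simp add: vec_eq_iff forall_2 c_def field_simps)
  qed
  show ?thesis
  proof
    show "normal D x = c *\<^sub>R rot90 (b - a)" using normal_curve[OF s(1)] nc by (simp add: xs n_def)
    show "\<bar>c\<bar> * norm (b - a) = 1" using n1 nc rot90_simps(2)[of "b - a"] by (metis norm_scaleR)
  qed
qed

text \<open>A point of the interface near the segment but not on it would lie on the normal segment through
  its foot point as well as on its own normal segment.\<close>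

lemma Gam_near_segment:
  assumes r: "0 < r"
    and disj: "\<And>X Y. X \<in> Gam D \<Longrightarrow> Y \<in> Gam D \<Longrightarrow> X \<noteq> Y \<Longrightarrow>
      closed_segment (X - r *\<^sub>R normal D X) (X + r *\<^sub>R normal D X) \<inter>
      closed_segment (Y - r *\<^sub>R normal D Y) (Y + r *\<^sub>R normal D Y) = {}"
    and ab: "a \<noteq> b" "open_segment a b \<subseteq> Gam D" and x: "x \<in> open_segment a b"
  obtains \<epsilon> where "\<epsilon> > 0" "ball x \<epsilon> \<inter> Gam D \<subseteq> open_segment a b"
proof -
  let ?e = "b - a" and ?w = "rot90 (b - a)"
  let ?N = "?e \<bullet> ?e"
  have N: "?N > 0" using ab by simp
  have nw: "norm ?w = norm ?e" by (rule rot90_simps)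
  \<comment> \<open>Coordinates along and across the line through \<open>a\<close> and
    \<open>b\<close>, in units of \<open>b - a\<close> and of its rotation.\<close>
  define u where "u y = ((y - a) \<bullet> ?e) / ?N" for y
  define \<tau> where "\<tau> y = ((y - a) \<bullet> ?w) / ?N" for y
  have dec: "y = (1 - u y) *\<^sub>R a + u y *\<^sub>R b + \<tau> y *\<^sub>R ?w" for y
  proof -
    have "?N *\<^sub>R (y - a) = ((y - a) \<bullet> ?e) *\<^sub>R ?e + ((y - a) \<bullet> ?w) *\<^sub>R ?w"
      by (simp add: vec_eq_iff forall_2 inner_vec_def sum_2 rot90_def algebra_simps)
    then have "(1 / ?N) *\<^sub>R ?N *\<^sub>R (y - a) = (1 / ?N) *\<^sub>R (((y - a) \<bullet> ?e) *\<^sub>R ?e + ((y - a) \<bullet> ?w) *\<^sub>R ?w)"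
      by simp
    then have "y - a = u y *\<^sub>R ?e + \<tau> y *\<^sub>R ?w"
      using N by (simp add: u_def \<tau>_def scaleR_add_right)
    then show ?thesis by (simp add: algebra_simps)
  qed
  define U where "U = {y. 0 < u y \<and> u y < 1 \<and> \<bar>\<tau> y\<bar> * norm ?w < r}"
  have "open U" unfolding U_def u_def \<tau>_def
    by (intro open_Collect_conj open_Collect_less continuous_intros) (use N in auto)
  moreover have "x \<in> U"
  proof -
    obtain t where t: "0 < t" "t < 1" "x = (1 - t) *\<^sub>R a + t *\<^sub>R b" using x by (auto simp: in_segment)
    then have "x - a = t *\<^sub>R ?e" by (simp add: algebra_simps)
    then have "u x = t" "\<tau> x = 0" using N rot90_simps(1)[of ?e] by (simp_all add: u_def \<tau>_def inner_commute)
    then show ?thesis using t r by (simp add: U_def)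
  qed
  ultimately obtain \<epsilon> where \<epsilon>: "\<epsilon> > 0" "ball x \<epsilon> \<subseteq> U" by (meson openE)
  have "y \<in> open_segment a b" if y: "y \<in> U" "y \<in> Gam D" for y
  proof -
    define z where "z = (1 - u y) *\<^sub>R a + u y *\<^sub>R b"
    have z: "z \<in> open_segment a b" using y ab by (auto simp: U_def z_def in_segment)
    obtain c where c: "normal D z = c *\<^sub>R ?w" "\<bar>c\<bar> * norm ?e = 1"
      using normal_on_segment[OF ab z] by blast
    have c0: "c \<noteq> 0" using c(2) by auto
    define n s where ns: "n = normal D z" "s = \<tau> y / c"
    have "s *\<^sub>R n = \<tau> y *\<^sub>R ?w" using c0 by (simp add: ns c(1))
    moreover have "y = z + \<tau> y *\<^sub>R ?w" unfolding z_def by (rule dec)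
    ultimately have yz: "y = z + s *\<^sub>R n" by simp
    have "\<bar>\<tau> y / c\<bar> \<le> r"
    proof -
      have "1 / \<bar>c\<bar> = norm ?w" using c(2) c0 nw by (simp add: field_simps)
      then have "\<bar>\<tau> y / c\<bar> = \<bar>\<tau> y\<bar> * norm ?w" by (simp add: abs_mult abs_inverse divide_inverse)
      then show ?thesis using y by (simp add: U_def)
    qed
    then have "\<bar>s\<bar> \<le> r" unfolding ns .
    then have sr: "- r \<le> s" "s \<le> r" by linarith+
    \<comment> \<open>The point of the segment with offset \<open>(2 * \<theta> - 1) * r\<close>
      along \<open>m\<close>; \<theta> = 1/2 is the centre.\<close>
    have seg: "v + ((2 * \<theta> - 1) * r) *\<^sub>R m = (1 - \<theta>) *\<^sub>R (v - r *\<^sub>R m) + \<theta> *\<^sub>R (v + r *\<^sub>R m)" for v m :: pt and \<theta>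
      by (simp add: algebra_simps flip: scaleR_2)
    have "y \<in> closed_segment (z - r *\<^sub>R normal D z) (z + r *\<^sub>R normal D z)"
    proof -
      let ?t = "(1 + s / r) / 2"
      have "(2 * ?t - 1) * r = s" using r by (simp add: field_simps)
      then have "y = (1 - ?t) *\<^sub>R (z - r *\<^sub>R n) + ?t *\<^sub>R (z + r *\<^sub>R n)"
        using yz seg[of z ?t n] by simp
      moreover have "0 \<le> ?t" "?t \<le> 1" using sr r by (simp_all add: field_simps)
      ultimately show ?thesis unfolding in_segment ns(1) by blast
    qed
    moreover have "y \<in> closed_segment (y - r *\<^sub>R normal D y) (y + r *\<^sub>R normal D y)"
    proof -
      have "y = (1 - 1 / 2) *\<^sub>R (y - r *\<^sub>R normal D y) + (1 / 2) *\<^sub>R (y + r *\<^sub>R normal D y)"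
        using seg[of y "1 / 2" "normal D y"] by simp
      moreover have "0 \<le> (1 / 2 :: real)" "(1 / 2 :: real) \<le> 1" by simp_all
      ultimately show ?thesis unfolding in_segment by blast
    qed
    ultimately have "y = z" using disj[of y z] y z ab by blast
    then show ?thesis using z by simp
  qed
  then show ?thesis using \<epsilon> by (intro that[of \<epsilon>]) auto
qed

end

section \<open>Forms given by integrals\<close>

text \<open>Lebesgue measure is complete, so a change on a null set preserves measurability. This is
  needed because traces agree with polynomials only almost everywhere.\<close>

lemma measurable_lebesgue_on_AE:
  fixes f g :: "'b :: euclidean_space \<Rightarrow> real"
  assumes S: "S \<in> sets lebesgue" and f: "f \<in> borel_measurable (lebesgue_on S)"
    and ae: "AE x in lebesgue_on S. f x = g x"
  shows "g \<in> borel_measurable (lebesgue_on S)"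
proof -
  have "(\<lambda>x. if x \<in> S then f x else 0) \<in> borel_measurable lebesgue"
    using f S by (simp add: borel_measurable_if)
  moreover have "AE x in lebesgue. (if x \<in> S then f x else 0) = (if x \<in> S then g x else 0)"
    using ae S by (auto simp: AE_restrict_space_iff elim!: AE_mp)
  ultimately have "(\<lambda>x. if x \<in> S then g x else 0) \<in> borel_measurable lebesgue"
    by (rule borel_measurable_AE)
  then show ?thesis using S by (simp add: borel_measurable_if)
qed

text \<open>Measurable and essentially bounded: a class closed under sums, products and changes on
  null sets, whose members are integrable over sets of finite measure. The integrands of the
  bilinear form are built within it.\<close>

definition bddm :: "'b :: euclidean_space set \<Rightarrow> ('b \<Rightarrow> real) \<Rightarrow> bool" where
  "bddm S w \<longleftrightarrow> w \<in> borel_measurable (lebesgue_on S) \<and> (\<exists>K. AE x in lebesgue_on S. \<bar>w x\<bar> \<le> K)"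

lemma bddm_measurable: "bddm S w \<Longrightarrow> w \<in> borel_measurable (lebesgue_on S)"
  by (simp add: bddm_def)

lemma bddm_const: "bddm S (\<lambda>x. c)"
  by (auto simp: bddm_def)

lemma bddm_add:
  assumes "bddm S v" "bddm S w" shows "bddm S (\<lambda>x. v x + w x)"
proof -
  obtain K L where "AE x in lebesgue_on S. \<bar>v x\<bar> \<le> K" "AE x in lebesgue_on S. \<bar>w x\<bar> \<le> L"
    using assms by (auto simp: bddm_def)
  then have "AE x in lebesgue_on S. \<bar>v x + w x\<bar> \<le> K + L" by eventually_elim simp
  then show ?thesis using assms by (auto simp: bddm_def)
qed

lemma bddm_mult:
  assumes "bddm S v" "bddm S w" shows "bddm S (\<lambda>x. v x * w x)"
proof -
  obtain K L where "AE x in lebesgue_on S. \<bar>v x\<bar> \<le> K" "AE x in lebesgue_on S. \<bar>w x\<bar> \<le> L"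
    using assms by (auto simp: bddm_def)
  then have "AE x in lebesgue_on S. \<bar>v x * w x\<bar> \<le> \<bar>K\<bar> * \<bar>L\<bar>"
    by eventually_elim (auto simp: abs_mult intro!: mult_mono)
  then show ?thesis using assms by (auto simp: bddm_def)
qed

lemma bddm_cong:
  assumes "S \<in> sets lebesgue" "bddm S v" "AE x in lebesgue_on S. v x = w x" shows "bddm S w"
proof -
  obtain K where "AE x in lebesgue_on S. \<bar>v x\<bar> \<le> K" using assms by (auto simp: bddm_def)
  with assms(3) have "AE x in lebesgue_on S. \<bar>w x\<bar> \<le> K" by eventually_elim simp
  then show ?thesis using measurable_lebesgue_on_AE[OF assms(1) bddm_measurable[OF assms(2)] assms(3)]
    by (auto simp: bddm_def)
qed

lemma AE_lebesgue_on_subset: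
  assumes "S' \<subseteq> S" "S' \<in> sets lebesgue" "S \<in> sets lebesgue" "AE x in lebesgue_on S. P x"
  shows "AE x in lebesgue_on S'. P x"
  using assms by (auto simp: AE_restrict_space_iff elim!: AE_mp)

lemma bddm_subset:
  assumes "S' \<subseteq> S" "S' \<in> sets lebesgue" "S \<in> sets lebesgue" "bddm S w" shows "bddm S' w"
  using AE_lebesgue_on_subset[OF assms(1-3)] assms(4) measurable_restrict_mono[of w lebesgue S borel S'] assms(1)
  by (fastforce simp: bddm_def)

lemma bddm_continuous:
  assumes "S \<in> sets lebesgue" "S \<subseteq> K" "compact K" "continuous_on K w" shows "bddm S w"
proof -
  have "w \<in> borel_measurable (lebesgue_on S)"
    using assms continuous_on_subset by (blast intro: continuous_imp_measurable_on_sets_lebesgue)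
  moreover obtain B where "\<And>x. x \<in> K \<Longrightarrow> \<bar>w x\<bar> \<le> B"
    using compact_imp_bounded[OF compact_continuous_image[OF assms(4,3)]] by (auto simp: bounded_iff)
  then have "AE x in lebesgue_on S. \<bar>w x\<bar> \<le> B" using assms(2) by (intro AE_I2) auto
  ultimately show ?thesis by (auto simp: bddm_def)
qed

lemma bddm_indicator:
  assumes "S \<in> sets lebesgue" "{x \<in> S. P x} \<in> sets lebesgue"
  shows "bddm S (\<lambda>x. if P x then 1 else 0)"
proof -
  have "{x \<in> S. P x} \<in> sets (lebesgue_on S)" using assms by (auto simp: sets_restrict_space_iff)
  then have "(\<lambda>x. if P x then 1 else 0 :: real) \<in> borel_measurable (lebesgue_on S)"
    by (intro measurable_If) auto
  then show ?thesis unfolding bddm_def by (auto intro!: exI[of _ 1])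
qed

lemma bddm_integrable:
  assumes "bddm S w" "S \<in> lmeasurable" shows "integrable (lebesgue_on S) w"
proof -
  obtain K where K: "AE x in lebesgue_on S. norm (w x) \<le> K"
    using assms(1) by (auto simp: bddm_def)
  show ?thesis
    by (rule finite_measure.integrable_const_bound[OF finite_measure_lebesgue_on[OF assms(2)] K
          bddm_measurable[OF assms(1)]])
qed

text \<open>A linear operator from \<open>V\<close> to essentially bounded functions on
  \<open>S\<close> that sees \<open>u\<close> only through its values on \<open>I\<close>. Linearity
  is asked for almost everywhere, since traces are not under control at the exceptional points of an
  edge.\<close>

definition lop ::
  "('i \<Rightarrow> real) set \<Rightarrow> 'i set \<Rightarrow> 'b :: euclidean_space set \<Rightarrow> (('i \<Rightarrow> real) \<Rightarrow> 'b \<Rightarrow> real) \<Rightarrow> bool" where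
  "lop V I S X \<longleftrightarrow> S \<in> lmeasurable \<and> (\<forall>u\<in>V. bddm S (X u)) \<and>
     (\<forall>u\<in>V. \<forall>v\<in>V. \<forall>c. AE x in lebesgue_on S. X (fadd u c v) x = X u x + c * X v x) \<and>
     (\<forall>u\<in>V. (\<forall>i\<in>I. u i = 0) \<longrightarrow> (AE x in lebesgue_on S. X u x = 0))"

lemma lopI:
  assumes "S \<in> lmeasurable" "\<And>u. u \<in> V \<Longrightarrow> bddm S (X u)"
    "\<And>u v c. u \<in> V \<Longrightarrow> v \<in> V \<Longrightarrow> AE x in lebesgue_on S. X (fadd u c v) x = X u x + c * X v x"
    "\<And>u. u \<in> V \<Longrightarrow> \<forall>i\<in>I. u i = 0 \<Longrightarrow> AE x in lebesgue_on S. X u x = 0"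
  shows "lop V I S X"
  unfolding lop_def using assms by simp

lemma lopD:
  assumes "lop V I S X"
  shows "S \<in> lmeasurable" "S \<in> sets lebesgue" "\<And>u. u \<in> V \<Longrightarrow> bddm S (X u)"
    "\<And>u v c. u \<in> V \<Longrightarrow> v \<in> V \<Longrightarrow> AE x in lebesgue_on S. X (fadd u c v) x = X u x + c * X v x"
    "\<And>u. u \<in> V \<Longrightarrow> \<forall>i\<in>I. u i = 0 \<Longrightarrow> AE x in lebesgue_on S. X u x = 0"
  using assms unfolding lop_def by (simp_all add: fmeasurableD)

text \<open>Lets an operator defined by limits inherit these properties from an explicit formula in
  the polynomials of the pieces, which agrees with it off a null set.\<close>

lemma lop_cong:
  assumes V: "lin_space V" and X: "lop V I S X"
    and XY: "\<And>u. u \<in> V \<Longrightarrow> AE x in lebesgue_on S. X u x = Y u x"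
  shows "lop V I S Y"
proof (rule lopI)
  note X = lopD[OF X]
  show "S \<in> lmeasurable" by (rule X)
  show "bddm S (Y u)" if "u \<in> V" for u using bddm_cong X(2,3) XY that by blast
  show "AE x in lebesgue_on S. Y (fadd u c v) x = Y u x + c * Y v x" if "u \<in> V" "v \<in> V" for u v c
  proof -
    have "fadd u c v \<in> V" using V that by (simp add: lin_space_def)
    from X(4)[OF that, of c] XY[OF that(1)] XY[OF that(2)] XY[OF this] show ?thesis
      by eventually_elim simp
  qed
  show "AE x in lebesgue_on S. Y u x = 0" if "u \<in> V" "\<forall>i\<in>I. u i = 0" for u
    using X(5)[OF that] XY[OF that(1)] by eventually_elim simp
qed

lemma lop_add:
  assumes X: "lop V I S X" and Y: "lop V I S Y" shows "lop V I S (\<lambda>u x. X u x + Y u x)"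
proof (rule lopI)
  note X = lopD[OF X] and Y = lopD[OF Y]
  show "S \<in> lmeasurable" by (rule X)
  show "bddm S (\<lambda>x. X u x + Y u x)" if "u \<in> V" for u using bddm_add X(3) Y(3) that by blast
  show "AE x in lebesgue_on S. X (fadd u c v) x + Y (fadd u c v) x = X u x + Y u x + c * (X v x + Y v x)"
    if "u \<in> V" "v \<in> V" for u v c
    using X(4)[OF that, of c] Y(4)[OF that, of c] by eventually_elim (simp add: algebra_simps)
  show "AE x in lebesgue_on S. X u x + Y u x = 0" if "u \<in> V" "\<forall>i\<in>I. u i = 0" for u
    using X(5)[OF that] Y(5)[OF that] by eventually_elim simp
qed

lemma lop_mult:
  assumes w: "bddm S w" and X: "lop V I S X" shows "lop V I S (\<lambda>u x. w x * X u x)"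
proof (rule lopI)
  note X = lopD[OF X]
  show "S \<in> lmeasurable" by (rule X)
  show "bddm S (\<lambda>x. w x * X u x)" if "u \<in> V" for u using bddm_mult w X(3) that by blast
  show "AE x in lebesgue_on S. w x * X (fadd u c v) x = w x * X u x + c * (w x * X v x)"
    if "u \<in> V" "v \<in> V" for u v c
    using X(4)[OF that, of c] by eventually_elim (simp add: algebra_simps)
  show "AE x in lebesgue_on S. w x * X u x = 0" if "u \<in> V" "\<forall>i\<in>I. u i = 0" for u
    using X(5)[OF that] by eventually_elim simp
qed

lemma lop_cmult: "lop V I S X \<Longrightarrow> lop V I S (\<lambda>u x. k * X u x)"
  by (rule lop_mult[OF bddm_const])

lemma lop_diff: "lop V I S X \<Longrightarrow> lop V I S Y \<Longrightarrow> lop V I S (\<lambda>u x. X u x - Y u x)"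
  using lop_add[of V I S X "\<lambda>u x. (- 1) * Y u x"] lop_cmult[of V I S Y "- 1"] by simp

lemma lop_subset:
  assumes X: "lop V I S X" and S': "S' \<subseteq> S" "S' \<in> sets lebesgue" shows "lop V I S' X"
proof (rule lopI)
  note X = lopD[OF X]
  note ae = AE_lebesgue_on_subset[OF S' X(2)]
  show "S' \<in> lmeasurable" using S' X(1) fmeasurableI2 by blast
  show "bddm S' (X u)" if "u \<in> V" for u using bddm_subset[OF S' X(2)] X(3) that by blast
  show "AE x in lebesgue_on S'. X (fadd u c v) x = X u x + c * X v x"
    if "u \<in> V" "v \<in> V" for u v c by (rule ae[OF X(4)[OF that]])
  show "AE x in lebesgue_on S'. X u x = 0" if "u \<in> V" "\<forall>i\<in>I. u i = 0" for u
    by (rule ae[OF X(5)[OF that]])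
qed

lemma lop_integrable:
  assumes "lop V I S X" "lop V I S Y" "bddm S w" "u \<in> V" "v \<in> V"
  shows "integrable (lebesgue_on S) (\<lambda>x. w x * (X u x * Y v x))"
  by (intro bddm_integrable bddm_mult lopD[OF assms(1)] lopD[OF assms(2)] assms)

lemma bilin_integral:
  assumes V: "lin_space V" and X: "lop V I S X" and Y: "lop V I S Y" and w: "bddm S w"
  shows "bilin V I (\<lambda>u v. integral\<^sup>L (lebesgue_on S) (\<lambda>x. w x * (X u x * Y v x)))"
proof (rule bilinI)
  note int = lop_integrable[OF X Y w]
  note X = lopD[OF X] and Y = lopD[OF Y]
  have cong: "integral\<^sup>L (lebesgue_on S) f = integral\<^sup>L (lebesgue_on S) g"
    if "integrable (lebesgue_on S) f" "integrable (lebesgue_on S) g" "AE x in lebesgue_on S. f x = g x" for f g :: "'b \<Rightarrow> real"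
    using that by (intro integral_cong_AE) auto
  show "integral\<^sup>L (lebesgue_on S) (\<lambda>x. w x * (X (fadd u c v) x * Y z x))
      = integral\<^sup>L (lebesgue_on S) (\<lambda>x. w x * (X u x * Y z x))
        + c * integral\<^sup>L (lebesgue_on S) (\<lambda>x. w x * (X v x * Y z x))"
    if h: "u \<in> V" "v \<in> V" "z \<in> V" for u v z c
  proof -
    have uv: "fadd u c v \<in> V" using V h by (simp add: lin_space_def)
    have i: "integrable (lebesgue_on S) (\<lambda>x. w x * (X u x * Y z x) + c * (w x * (X v x * Y z x)))"
      using int h by (intro Bochner_Integration.integrable_add integrable_mult_right) auto
    have "integral\<^sup>L (lebesgue_on S) (\<lambda>x. w x * (X (fadd u c v) x * Y z x))
        = integral\<^sup>L (lebesgue_on S) (\<lambda>x. w x * (X u x * Y z x) + c * (w x * (X v x * Y z x)))"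
    proof (rule cong[OF int[OF uv h(3)] i])
      show "AE x in lebesgue_on S. w x * (X (fadd u c v) x * Y z x)
          = w x * (X u x * Y z x) + c * (w x * (X v x * Y z x))"
        using X(4)[OF h(1,2), of c] by eventually_elim (simp add: algebra_simps)
    qed
    also have "\<dots> = integral\<^sup>L (lebesgue_on S) (\<lambda>x. w x * (X u x * Y z x))
        + c * integral\<^sup>L (lebesgue_on S) (\<lambda>x. w x * (X v x * Y z x))"
      using int h by (subst Bochner_Integration.integral_add) auto
    finally show ?thesis .
  qed
  show "integral\<^sup>L (lebesgue_on S) (\<lambda>x. w x * (X z x * Y (fadd u c v) x))
      = integral\<^sup>L (lebesgue_on S) (\<lambda>x. w x * (X z x * Y u x))
        + c * integral\<^sup>L (lebesgue_on S) (\<lambda>x. w x * (X z x * Y v x))"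
    if h: "u \<in> V" "v \<in> V" "z \<in> V" for u v z c
  proof -
    have uv: "fadd u c v \<in> V" using V h by (simp add: lin_space_def)
    have i: "integrable (lebesgue_on S) (\<lambda>x. w x * (X z x * Y u x) + c * (w x * (X z x * Y v x)))"
      using int h by (intro Bochner_Integration.integrable_add integrable_mult_right) auto
    have "integral\<^sup>L (lebesgue_on S) (\<lambda>x. w x * (X z x * Y (fadd u c v) x))
        = integral\<^sup>L (lebesgue_on S) (\<lambda>x. w x * (X z x * Y u x) + c * (w x * (X z x * Y v x)))"
    proof (rule cong[OF int[OF h(3) uv] i])
      show "AE x in lebesgue_on S. w x * (X z x * Y (fadd u c v) x)
          = w x * (X z x * Y u x) + c * (w x * (X z x * Y v x))"
        using Y(4)[OF h(1,2), of c] by eventually_elim (simp add: algebra_simps)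
    qed
    also have "\<dots> = integral\<^sup>L (lebesgue_on S) (\<lambda>x. w x * (X z x * Y u x))
        + c * integral\<^sup>L (lebesgue_on S) (\<lambda>x. w x * (X z x * Y v x))"
      using int h by (subst Bochner_Integration.integral_add) auto
    finally show ?thesis .
  qed
  show "integral\<^sup>L (lebesgue_on S) (\<lambda>x. w x * (X u x * Y v x)) = 0"
    if "u \<in> V" "v \<in> V" "\<And>i. i \<in> I \<Longrightarrow> u i = 0" for u v
  proof (rule integral_eq_zero_AE)
    show "AE x in lebesgue_on S. w x * (X u x * Y v x) = 0"
    proof -
      have "\<forall>i\<in>I. u i = 0" using that(3) by blast
      from X(5)[OF that(1) this] show ?thesis by eventually_elim simp
    qed
  qed
  show "integral\<^sup>L (lebesgue_on S) (\<lambda>x. w x * (X v x * Y u x)) = 0"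
    if "u \<in> V" "v \<in> V" "\<And>i. i \<in> I \<Longrightarrow> u i = 0" for u v
  proof (rule integral_eq_zero_AE)
    show "AE x in lebesgue_on S. w x * (X v x * Y u x) = 0"
    proof -
      have "\<forall>i\<in>I. u i = 0" using that(3) by blast
      from Y(5)[OF that(1) this] show ?thesis by eventually_elim simp
    qed
  qed
qed

lemma psd_form_integral:
  assumes V: "lin_space V" and X: "lop V I S X" and w: "bddm S w" and nn: "\<And>x. x \<in> S \<Longrightarrow> 0 \<le> w x"
  shows "psd_form V I (\<lambda>u v. integral\<^sup>L (lebesgue_on S) (\<lambda>x. w x * (X u x * X v x)))"
proof (rule psd_formI[OF bilin_integral[OF V X X w]])
  show "integral\<^sup>L (lebesgue_on S) (\<lambda>x. w x * (X u x * X v x)) = integral\<^sup>L (lebesgue_on S) (\<lambda>x. w x * (X v x * X u x))" for u v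
    by (simp add: mult.commute)
  show "0 \<le> integral\<^sup>L (lebesgue_on S) (\<lambda>x. w x * (X u x * X u x))" for u
    using nn by (intro Bochner_Integration.integral_nonneg) simp
qed

lemma integral_square_zero:
  assumes X: "lop V I S X" and w: "bddm S w" and pos: "\<And>x. x \<in> S \<Longrightarrow> 0 < w x" and u: "u \<in> V"
    and z: "integral\<^sup>L (lebesgue_on S) (\<lambda>x. w x * (X u x * X u x)) = 0"
  shows "AE x in lebesgue_on S. X u x = 0"
proof -
  have nn: "0 \<le> w x * (X u x * X u x)" if "x \<in> S" for x
    using pos[OF that] by simp
  have "AE x in lebesgue_on S. 0 \<le> w x * (X u x * X u x)" by (rule AE_I2) (use nn in simp)
  from integral_nonneg_eq_0_iff_AE[OF lop_integrable[OF X X w u u] this] z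
  have "AE x in lebesgue_on S. w x * (X u x * X u x) = 0" by blast
  moreover have "AE x in lebesgue_on S. x \<in> S" by (rule AE_I2) simp
  ultimately show ?thesis
  proof eventually_elim
    case (elim x)
    then show ?case using pos[of x] by auto
  qed
qed

text \<open>Integrates the pointwise inequality 0 \<le> (t X - Y)^2 / t against the weight
  \<open>w\<close>.\<close>

lemma integral_young:
  assumes X: "lop V I S X" and Y: "lop V I S Y" and w: "bddm S w" and nn: "\<And>x. x \<in> S \<Longrightarrow> 0 \<le> w x"
    and u: "u \<in> V" and t: "t > 0"
  shows "2 * integral\<^sup>L (lebesgue_on S) (\<lambda>x. w x * (X u x * Y u x))
    \<le> t * integral\<^sup>L (lebesgue_on S) (\<lambda>x. w x * (X u x * X u x))
      + (1 / t) * integral\<^sup>L (lebesgue_on S) (\<lambda>x. w x * (Y u x * Y u x))"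
proof -
  note i = lop_integrable[OF X Y w u u] lop_integrable[OF X X w u u] lop_integrable[OF Y Y w u u]
  have "integral\<^sup>L (lebesgue_on S) (\<lambda>x. 2 * (w x * (X u x * Y u x)))
      \<le> integral\<^sup>L (lebesgue_on S) (\<lambda>x. t * (w x * (X u x * X u x)) + (1 / t) * (w x * (Y u x * Y u x)))"
  proof (rule integral_mono)
    fix x assume "x \<in> space (lebesgue_on S)"
    then have w0: "0 \<le> w x" using nn by simp
    have "0 \<le> (1 / t) * (t * X u x - Y u x)\<^sup>2" using t by simp
    also have "(1 / t) * (t * X u x - Y u x)\<^sup>2 = t * (X u x * X u x) + (1 / t) * (Y u x * Y u x) - 2 * (X u x * Y u x)"
      using t by (simp add: power2_eq_square field_simps)
    finally have "2 * (X u x * Y u x) \<le> t * (X u x * X u x) + (1 / t) * (Y u x * Y u x)" by simp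
    from mult_left_mono[OF this w0]
    show "2 * (w x * (X u x * Y u x)) \<le> t * (w x * (X u x * X u x)) + (1 / t) * (w x * (Y u x * Y u x))"
      by (simp add: algebra_simps)
  qed (use i in auto)
  also have "\<dots> = t * integral\<^sup>L (lebesgue_on S) (\<lambda>x. w x * (X u x * X u x))
      + (1 / t) * integral\<^sup>L (lebesgue_on S) (\<lambda>x. w x * (Y u x * Y u x))"
    using i by (subst Bochner_Integration.integral_add) auto
  finally show ?thesis by simp
qed

text \<open>The points where \<open>f\<close> is nonzero form an open set, and an open null set is
  empty.\<close>

lemma zero_on_open_of_AE:
  fixes f :: "'b :: euclidean_space \<Rightarrow> real"
  assumes U: "open U" "U \<subseteq> S" and S: "S \<in> sets lebesgue" and f: "continuous_on U f"
    and ae: "AE x in lebesgue_on S. f x = 0" and x: "x \<in> U"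
  shows "f x = 0"
proof (rule ccontr)
  assume "f x \<noteq> 0"
  define W where "W = {y \<in> U. f y \<noteq> 0}"
  have "open W"
  proof -
    have "open (U \<inter> f -` (- {0}))" by (rule continuous_open_preimage[OF f U(1)]) auto
    moreover have "W = U \<inter> f -` (- {0})" by (auto simp: W_def)
    ultimately show ?thesis by simp
  qed
  moreover have "W \<noteq> {}" using x \<open>f x \<noteq> 0\<close> by (auto simp: W_def)
  moreover have "negligible W"
  proof -
    have "AE y in lebesgue. y \<in> S \<longrightarrow> f y = 0" using ae S by (simp add: AE_restrict_space_iff)
    then have "AE y in lebesgue. y \<notin> W" by (rule AE_mp) (use U in \<open>auto simp: W_def\<close>)
    then show ?thesis using \<open>open W\<close> by (simp add: negligible_iff_null_sets AE_iff_null_sets)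
  qed
  ultimately show False using open_not_negligible by blast
qed

section \<open>Geometry of the mesh\<close>

lemma open_segment_eqD:
  fixes a b :: "'a :: euclidean_space"
  assumes "open_segment a b = open_segment c d" "a \<noteq> b"
  shows "{a, b} = {c, d}"
proof -
  have "c \<noteq> d" using assms by (metis open_segment_eq_empty)
  then have "closed_segment a b = closed_segment c d"
    using assms closure_open_segment by metis
  then show ?thesis by simp
qed

text \<open>Near \<open>x\<close> the element \<open>T\<close> lies on the side \<open>s\<close>, so that a trace from \<open>T\<close> at \<open>x\<close> only sees
  the polynomial on \<open>T \<inter> side D s\<close>.\<close>

definition sided :: "ife_data \<Rightarrow> pt set \<Rightarrow> bool \<Rightarrow> pt \<Rightarrow> bool" where
  "sided D T s x \<longleftrightarrow> (\<exists>\<epsilon>>0. T \<inter> ball x \<epsilon> \<subseteq> side D s)"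

lemma open_sided: "open {x. sided D T s x}"
  unfolding open_contains_ball
proof
  fix x assume "x \<in> {x. sided D T s x}"
  then obtain \<epsilon> where \<epsilon>: "\<epsilon> > 0" "T \<inter> ball x \<epsilon> \<subseteq> side D s" by (auto simp: sided_def)
  have "sided D T s y" if "y \<in> ball x (\<epsilon> / 2)" for y
  proof -
    have "ball y (\<epsilon> / 2) \<subseteq> ball x \<epsilon>"
    proof
      fix z assume "z \<in> ball y (\<epsilon> / 2)"
      then show "z \<in> ball x \<epsilon>" using that dist_triangle[of x z y] by (simp add: mem_ball)
    qed
    then show ?thesis unfolding sided_def using \<epsilon> by (intro exI[of _ "\<epsilon> / 2"]) auto
  qed
  then show "\<exists>e>0. ball x e \<subseteq> {x. sided D T s x}"
    using \<epsilon> by (intro exI[of _ "\<epsilon> / 2"]) auto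
qed

locale ife_problem =
  fixes D :: ife_data and r \<kappa> :: real and p :: nat
  assumes setting: "ife_setting D r \<kappa>" and p: "p \<in> {2, 3}"
begin

lemma p_pos: "p > 0" using p by auto

lemma C2: "closed_regular_simple_C2 (curve D)"
  using setting unfolding ife_setting_def by (elim conjE)

lemma Gam_Om: "Gam D \<subseteq> Om D"
  using setting unfolding ife_setting_def by (elim conjE)

lemma beta_pos: "0 < betaP D" "0 < betaM D"
proof -
  show "0 < betaP D" using setting unfolding ife_setting_def by (elim conjE)
  show "0 < betaM D" using setting unfolding ife_setting_def by (elim conjE)
qed

lemma mesh: "triangular_mesh (Om D) (mesh D)"
  using setting unfolding ife_setting_def by (elim conjE)

lemma edge_cut: "e \<in> edges D \<Longrightarrow> e \<subseteq> Gam D \<or> (\<exists>x. Gam D \<inter> e \<subseteq> {x})"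
  using setting unfolding ife_setting_def by (elim conjE) (rule bspec)

lemma r_pos: "0 < r"
  using setting unfolding ife_setting_def by (elim conjE)

lemma normals_disjoint:
  assumes "X \<in> Gam D" "Y \<in> Gam D" "X \<noteq> Y"
  shows "closed_segment (X - r *\<^sub>R normal D X) (X + r *\<^sub>R normal D X) \<inter>
      closed_segment (Y - r *\<^sub>R normal D Y) (Y + r *\<^sub>R normal D Y) = {}"
proof -
  have "\<forall>X\<in>Gam D. \<forall>Y\<in>Gam D. X \<noteq> Y \<longrightarrow>
      closed_segment (X - r *\<^sub>R normal D X) (X + r *\<^sub>R normal D X) \<inter>
      closed_segment (Y - r *\<^sub>R normal D Y) (Y + r *\<^sub>R normal D Y) = {}"
    using setting unfolding ife_setting_def by (elim conjE)
  from bspec[OF bspec[OF this assms(1)] assms(2)] assms(3) show ?thesis by (rule mp)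
qed

lemma polygonal: "polygonal_domain (Om D)"
  using setting unfolding ife_setting_def by (elim conjE)

lemma Om: "open (Om D)" "connected (Om D)" "Om D \<noteq> {}" "bounded (Om D)" "interior (closure (Om D)) = Om D"
  using polygonal unfolding polygonal_domain_def by simp_all

section \<open>Elements of the mesh and their intersections\<close>

lemma finite_mesh: "finite (mesh D)"
proof -
  have "inj_on closure (mesh D)"
    using mesh unfolding triangular_mesh_def inj_on_def by metis
  moreover have "finite (closure ` mesh D)"
    using mesh by (simp add: triangular_mesh_def triangulation_def)
  ultimately show ?thesis using finite_imageD by blast
qed

lemma mesh_tri: assumes "T \<in> mesh D" obtains a b c where "tri T a b c"
  using mesh assms simplex_tri[of T] unfolding triangular_mesh_def by metis

lemma mesh_basic:
  assumes "T \<in> mesh D"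
  shows "open T" "convex T" "bounded T" "T \<noteq> {}" "T = interior (closure T)" "T \<subseteq> Om D"
proof -
  obtain a b c where "tri T a b c" using mesh_tri[OF assms] .
  from tri_basic[OF this] show o: "open T" "convex T" "bounded T" "T \<noteq> {}" "T = interior (closure T)" .
  have "closure T \<subseteq> closure (Om D)" using mesh assms unfolding triangular_mesh_def by blast
  then have "interior (closure T) \<subseteq> Om D" using interior_mono Om(5) by metis
  then show "T \<subseteq> Om D" using o(5) by blast
qed

lemma mesh_cover: "x \<in> closure (Om D) \<Longrightarrow> \<exists>T\<in>mesh D. x \<in> closure T"
  using mesh unfolding triangular_mesh_def by blast

lemma mesh_Int_face: "T \<in> mesh D \<Longrightarrow> T' \<in> mesh D \<Longrightarrow> closure T \<inter> closure T' face_of closure T"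
  using mesh unfolding triangular_mesh_def triangulation_def by blast

lemma mesh_closure_inj: "T \<in> mesh D \<Longrightarrow> T' \<in> mesh D \<Longrightarrow> closure T \<subseteq> closure T' \<Longrightarrow> closure T' \<subseteq> closure T \<Longrightarrow> T = T'"
  using mesh_basic(5) by (metis subset_antisym)

text \<open>Closed elements intersect in a common face, and a face that meets the interior of a
  convex set is the whole set.\<close>

lemma mesh_face_full:
  assumes "T \<in> mesh D" "T' \<in> mesh D" "T \<inter> closure T' \<noteq> {}"
  shows "closure T \<subseteq> closure T'"
proof -
  have "closure T \<inter> closure T' \<inter> interior (closure T) \<noteq> {}"
    using assms mesh_basic(5)[OF assms(1)] closure_subset[of T] by blast
  then have "closure T \<inter> closure T' = closure T"
    using face_of_disjoint_interior[OF mesh_Int_face[OF assms(1,2)]] by blast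
  then show ?thesis by blast
qed

lemma mesh_disjoint:
  assumes "T \<in> mesh D" "T' \<in> mesh D" "T \<noteq> T'" shows "T \<inter> T' = {}"
proof (rule ccontr)
  assume "T \<inter> T' \<noteq> {}"
  then have "T \<inter> closure T' \<noteq> {}" "T' \<inter> closure T \<noteq> {}"
    using closure_subset[of T] closure_subset[of T'] by blast+
  then show False using mesh_face_full assms mesh_closure_inj by metis
qed

subsection \<open>The two sides of the interface\<close>

lemma sides: "OmP D = Om D \<inter> inside (Gam D) \<and> OmM D = Om D \<inter> outside (Gam D) \<or>
    OmP D = Om D \<inter> outside (Gam D) \<and> OmM D = Om D \<inter> inside (Gam D)"
  using setting unfolding ife_setting_def by (elim conjE)

lemma side_eq: "side D s = Om D \<inter> inside (Gam D) \<or> side D s = Om D \<inter> outside (Gam D)"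
  using sides by (cases s) (auto simp: side_def)

lemma side_open: "open (side D s)"
  using side_eq[of s] Om(1) open_inside[OF Gam_closed[OF C2]] open_outside[OF Gam_closed[OF C2]]
  by (metis open_Int)

lemma side_cover: "Om D = OmP D \<union> OmM D \<union> Gam D"
proof -
  have "x \<in> inside (Gam D) \<or> x \<in> outside (Gam D) \<or> x \<in> Gam D" for x
    using inside_Un_outside[of "Gam D"] by blast
  then show ?thesis using sides Gam_Om by (elim disjE conjE) auto
qed

lemma side_disjoint: "OmP D \<inter> OmM D = {}" "side D s \<inter> Gam D = {}" "side D s \<subseteq> Om D"
proof -
  have d: "inside (Gam D) \<inter> outside (Gam D) = {}" "inside (Gam D) \<union> outside (Gam D) = - Gam D" by simp_all
  show "OmP D \<inter> OmM D = {}" using sides d(1) by blast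
  show "side D s \<inter> Gam D = {}" "side D s \<subseteq> Om D"
    using side_eq[of s] d by blast+
qed

lemma side_unique: "x \<in> side D s \<Longrightarrow> x \<in> side D s' \<Longrightarrow> s = s'"
  using side_disjoint(1) by (cases s; cases s') (auto simp: side_def)

lemma side_cases: "x \<in> Om D \<Longrightarrow> x \<notin> Gam D \<Longrightarrow> \<exists>s. x \<in> side D s"
proof -
  assume "x \<in> Om D" "x \<notin> Gam D"
  then have "x \<in> side D True \<or> x \<in> side D False" using side_cover by (auto simp: side_def)
  then show ?thesis by blast
qed

lemma connected_in_side:
  assumes "connected S" "S \<subseteq> Om D" "S \<inter> Gam D = {}"
  obtains s where "S \<subseteq> side D s"
proof -
  have "OmP D \<inter> S = {} \<or> OmM D \<inter> S = {}"
    using connectedD[OF assms(1) side_open[of True] side_open[of False]] side_disjoint(1) side_cover assms(2,3)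
    unfolding side_def by auto
  then have "S \<subseteq> side D True \<or> S \<subseteq> side D False"
    using side_cover assms(2,3) unfolding side_def by auto
  then show ?thesis using that by blast
qed

text \<open>Localizes the Jordan curve statement to the open set \<open>T\<close>. Limits from
  \<open>T \<inter> side D s\<close> at an interface point are then taken along a nontrivial filter,
  so both interface traces make sense.\<close>

lemma Gam_in_closure_side:
  assumes "open T" "T \<subseteq> Om D" "x \<in> T" "x \<in> Gam D"
  shows "x \<in> closure (T \<inter> side D s)"
proof -
  have "x \<in> closure (inside (Gam D))" "x \<in> closure (outside (Gam D))"
    using closed_curve_in_closure_sides[OF curve_simple[OF C2] curve_loop[OF C2]] assms(4)
    unfolding Gam_def by blast+
  then obtain S where S: "x \<in> closure S" "side D s = Om D \<inter> S" using side_eq[of s] by blast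
  then have "T \<inter> S = T \<inter> side D s" using assms(2) by blast
  moreover have "x \<in> closure (T \<inter> S)"
    using open_Int_closure_subset[OF assms(1), of S] S(1) assms(3) by blast
  ultimately show ?thesis by simp
qed

subsection \<open>Interior edges\<close>

text \<open>Resolves the choice in \<open>adjacent\<close>. Both triangles can be listed with the
  same \<open>a\<close>, \<open>b\<close>, because an open segment determines its end points up to
  order.\<close>

lemma interior_edgeE:
  assumes "e \<in> interior_edges D"
  obtains T1 T2 a b c1 c2 where "adjacent D e = (T1, T2)" "T1 \<in> mesh D" "T2 \<in> mesh D" "T1 \<noteq> T2"
    "e \<in> edges_of T1" "e \<in> edges_of T2" "tri T1 a b c1" "tri T2 a b c2" "e = open_segment a b" "a \<noteq> b"
proof -
  let ?P = "\<lambda>(T1, T2). T1 \<in> mesh D \<and> T2 \<in> mesh D \<and> T1 \<noteq> T2 \<and> e \<in> edges_of T1 \<and> e \<in> edges_of T2"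
  have "\<exists>q. ?P q" using assms by (auto simp: interior_edges_def)
  then have "?P (adjacent D e)" unfolding adjacent_def by (rule someI_ex)
  moreover obtain T1 T2 where T: "adjacent D e = (T1, T2)" by fastforce
  ultimately have m: "T1 \<in> mesh D" "T2 \<in> mesh D" "T1 \<noteq> T2" "e \<in> edges_of T1" "e \<in> edges_of T2"
    by auto
  obtain a b c where t1: "tri T1 a b c" "e = open_segment a b"
    using mesh_tri[OF m(1)] edge_tri m(4) by metis
  obtain a' b' c' where t2: "tri T2 a' b' c'" "e = open_segment a' b'"
    using mesh_tri[OF m(2)] edge_tri m(5) by metis
  have ab: "a \<noteq> b" using tri_distinct[OF t1(1)] by simp
  have "{a, b} = {a', b'}" using open_segment_eqD t1(2) t2(2) ab by metis
  then have "tri T2 a b c'" using t2(1) tri_swap by (auto simp: doubleton_eq_iff)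
  then show ?thesis using that T m t1 ab by blast
qed

text \<open>Both gradients are normal to the edge, hence proportional. A positive factor would put
  points just off the midpoint into both triangles, so the triangles lie on opposite sides of the
  edge.\<close>

lemma interior_edge_local:
  assumes "tri T1 a b c1" "tri T2 a b c2" "T1 \<inter> T2 = {}" 
  obtains k m where "k \<noteq> 0" "k \<bullet> (b - a) = 0" "m > 0" "\<And>y. bary c1 a b y = k \<bullet> (y - a)"
    "\<And>y. bary c2 a b y = - m * (k \<bullet> (y - a))"
proof -
  note t1 = tri_rotate[OF tri_rotate[OF assms(1)]] and t2 = tri_rotate[OF tri_rotate[OF assms(2)]]
  obtain k1 where k1: "k1 \<noteq> 0" "k1 \<bullet> (b - a) = 0" "\<And>y. bary c1 a b y = k1 \<bullet> (y - a)"
    using bary_affine[OF t1] by blast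
  obtain k2 where k2: "k2 \<noteq> 0" "k2 \<bullet> (b - a) = 0" "\<And>y. bary c2 a b y = k2 \<bullet> (y - a)"
    using bary_affine[OF t2] by blast
  have ab: "b - a \<noteq> 0" using tri_distinct[OF assms(1)] by simp
  obtain m where m: "k2 = m *\<^sub>R k1"
  proof -
    define w where "w = b - a"
    have w: "w $ 1 \<noteq> 0 \<or> w $ 2 \<noteq> 0" using ab by (simp add: w_def vec_eq_iff forall_2)
    have e: "k1 $ 1 * w $ 1 + k1 $ 2 * w $ 2 = 0" "k2 $ 1 * w $ 1 + k2 $ 2 * w $ 2 = 0"
      using k1(2) k2(2) by (simp_all add: w_def inner_vec_def sum_2)
    have "(k1 $ 1 * k2 $ 2 - k1 $ 2 * k2 $ 1) * w $ 1 = 0" "(k1 $ 1 * k2 $ 2 - k1 $ 2 * k2 $ 1) * w $ 2 = 0"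
      using e by algebra+
    then have c: "k1 $ 1 * k2 $ 2 = k1 $ 2 * k2 $ 1" using w by auto
    have "k1 $ 1 \<noteq> 0 \<or> k1 $ 2 \<noteq> 0" using k1(1) by (simp add: vec_eq_iff forall_2)
    then show ?thesis
    proof
      assume "k1 $ 1 \<noteq> 0"
      then show ?thesis using c that[of "k2 $ 1 / k1 $ 1"] by (simp add: vec_eq_iff forall_2 field_simps)
    next
      assume "k1 $ 2 \<noteq> 0"
      then show ?thesis using c that[of "k2 $ 2 / k1 $ 2"] by (simp add: vec_eq_iff forall_2 field_simps)
    qed
  qed
  have "m < 0"
  proof (rule ccontr)
    assume "\<not> m < 0"
    moreover have "m \<noteq> 0" using m k2(1) by auto
    ultimately have mp: "m > 0" by simp
    define x where "x = midpoint a b"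
    have x: "x \<in> open_segment a b" using ab by (simp add: x_def)
    obtain \<epsilon>1 where e1: "\<epsilon>1 > 0" "\<And>y. y \<in> ball x \<epsilon>1 \<Longrightarrow> y \<in> T1 \<longleftrightarrow> 0 < bary c1 a b y"
      using tri_edge_halfplane[OF assms(1) x] by metis
    obtain \<epsilon>2 where e2: "\<epsilon>2 > 0" "\<And>y. y \<in> ball x \<epsilon>2 \<Longrightarrow> y \<in> T2 \<longleftrightarrow> 0 < bary c2 a b y"
      using tri_edge_halfplane[OF assms(2) x] by metis
    \<comment> \<open>Makes the displacement along \<open>k1\<close> half as long as the smaller of
      the two radii.\<close>
    define t where "t = min \<epsilon>1 \<epsilon>2 / (2 * norm k1)"
    have t: "t > 0" using e1(1) e2(1) k1(1) by (simp add: t_def)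
    define y where "y = x + t *\<^sub>R k1"
    have "norm (t *\<^sub>R k1) = min \<epsilon>1 \<epsilon>2 / 2" using t k1(1) e1(1) e2(1) by (simp add: t_def)
    then have yb: "y \<in> ball x \<epsilon>1" "y \<in> ball x \<epsilon>2" using e1(1) e2(1) by (auto simp: y_def dist_norm)
    have "x - a = (1/2) *\<^sub>R (b - a)" by (simp add: x_def midpoint_def vec_eq_iff field_simps)
    then have "k1 \<bullet> (x - a) = 0" using k1(2) by simp
    then have "k1 \<bullet> (y - a) = t * (k1 \<bullet> k1)"
      by (simp add: y_def inner_diff_right inner_add_right)
    then have "k1 \<bullet> (y - a) > 0" using t k1(1) by simp
    then have "y \<in> T1" "y \<in> T2" using e1(2)[OF yb(1)] e2(2)[OF yb(2)] k1(3) k2(3) m mp by simp_all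
    then show False using assms(3) by blast
  qed
  then show ?thesis using that[of k1 "- m"] k1 k2 m by simp
qed

lemma interior_edge_nbhd:
  assumes "tri T1 a b c1" "tri T2 a b c2" "T1 \<inter> T2 = {}" "x \<in> open_segment a b"
  obtains \<epsilon> where "\<epsilon> > 0" "ball x \<epsilon> \<subseteq> T1 \<union> T2 \<union> open_segment a b"
proof -
  obtain k m where k: "m > 0" "\<And>y. bary c1 a b y = k \<bullet> (y - a)" "\<And>y. bary c2 a b y = - m * (k \<bullet> (y - a))"
    using interior_edge_local[OF assms(1-3)] by metis
  obtain \<epsilon>1 where e1: "\<epsilon>1 > 0" "\<And>y. y \<in> ball x \<epsilon>1 \<Longrightarrow> y \<in> T1 \<longleftrightarrow> 0 < bary c1 a b y"
     "\<And>y. y \<in> ball x \<epsilon>1 \<Longrightarrow> y \<in> open_segment a b \<longleftrightarrow> bary c1 a b y = 0"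
    using tri_edge_halfplane[OF assms(1,4)] by metis
  obtain \<epsilon>2 where e2: "\<epsilon>2 > 0" "\<And>y. y \<in> ball x \<epsilon>2 \<Longrightarrow> y \<in> T2 \<longleftrightarrow> 0 < bary c2 a b y"
    using tri_edge_halfplane[OF assms(2,4)] by metis
  have "y \<in> T1 \<union> T2 \<union> open_segment a b" if "y \<in> ball x (min \<epsilon>1 \<epsilon>2)" for y
  proof -
    have y: "y \<in> ball x \<epsilon>1" "y \<in> ball x \<epsilon>2" using that by auto
    consider "k \<bullet> (y - a) > 0" | "k \<bullet> (y - a) = 0" | "k \<bullet> (y - a) < 0" by linarith
    then show ?thesis
    proof cases
      case 3
      then have "- m * (k \<bullet> (y - a)) > 0" using k(1) by (simp add: mult_less_0_iff)
      then show ?thesis using e2(2)[OF y(2)] k by simp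
    qed (use e1(2,3)[of y] y k in simp_all)
  qed
  then have "ball x (min \<epsilon>1 \<epsilon>2) \<subseteq> T1 \<union> T2 \<union> open_segment a b" by (rule subsetI)
  moreover have "min \<epsilon>1 \<epsilon>2 > 0" using e1(1) e2(1) by simp
  ultimately show ?thesis using that by blast
qed

text \<open>The ball from \<open>interior_edge_nbhd\<close> lies in the closure of the domain, and
  the interior of that closure is the domain itself.\<close>

lemma interior_edge_subset_Om:
  assumes "e \<in> interior_edges D" shows "e \<subseteq> Om D"
proof
  fix x assume x: "x \<in> e"
  obtain T1 T2 a b c1 c2 where e: "adjacent D e = (T1, T2)" "T1 \<in> mesh D" "T2 \<in> mesh D" "T1 \<noteq> T2"
    "e \<in> edges_of T1" "e \<in> edges_of T2" "tri T1 a b c1" "tri T2 a b c2" "e = open_segment a b" "a \<noteq> b"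
    using assms by (rule interior_edgeE)
  obtain \<epsilon> where eps: "\<epsilon> > 0" "ball x \<epsilon> \<subseteq> T1 \<union> T2 \<union> open_segment a b"
    using x unfolding e(9) by (rule interior_edge_nbhd[OF e(7,8) mesh_disjoint[OF e(2-4)]])
  have "closed_segment a b \<subseteq> closure T1"
    unfolding tri_closure_hull[OF e(7)] segment_convex_hull by (intro hull_mono) auto
  then have "open_segment a b \<subseteq> closure T1" using segment_open_subset_closed by blast
  then have "ball x \<epsilon> \<subseteq> closure (Om D)"
    using eps(2) closure_mono[OF mesh_basic(6)[OF e(2)]] closure_mono[OF mesh_basic(6)[OF e(3)]]
      closure_subset[of T1] closure_subset[of T2] by blast
  then have "x \<in> interior (closure (Om D))" using eps(1) mem_interior by blast
  then show "x \<in> Om D" using Om(5) by simp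
qed

lemma tri_barycenter:
  assumes "tri T a b c" shows "bary c a b (barycenter T) = 1/3"
proof -
  note d = tri_distinct[OF assms]
  have "barycenter T = (1/3) *\<^sub>R c + (1/3) *\<^sub>R a + (1/3) *\<^sub>R b"
    using d by (simp add: barycenter_def tri_vertices[OF assms] scaleR_add_right)
  then show ?thesis using bary_unique[OF tri_rotate[OF tri_rotate[OF assms]], of "1/3" "1/3" "1/3"] by simp
qed

text \<open>Resolves the definite description of the normal: two unit vectors are perpendicular to
  the edge, and the barycenters single out one of them.\<close>

lemma edge_normal_props:
  assumes "e \<in> interior_edges D" "e = open_segment a b" "a \<noteq> b"
  shows "norm (edge_normal D e) = 1" "edge_normal D e \<bullet> (b - a) = 0"
proof -
  obtain T1 T2 a' b' c1 c2 where e: "adjacent D e = (T1, T2)" "T1 \<in> mesh D" "T2 \<in> mesh D" "T1 \<noteq> T2"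
    "e \<in> edges_of T1" "e \<in> edges_of T2" "tri T1 a' b' c1" "tri T2 a' b' c2" "e = open_segment a' b'" "a' \<noteq> b'"
    using assms(1) by (rule interior_edgeE)
  have "{a, b} = {a', b'}" using open_segment_eqD[of a b a' b'] assms(2,3) e(9) by simp
  then have T: "tri T1 a b c1" "tri T2 a b c2"
    using e(7,8) tri_swap[OF e(7)] tri_swap[OF e(8)] by (auto simp: doubleton_eq_iff)
  obtain k m where k: "k \<noteq> 0" "k \<bullet> (b - a) = 0" "m > 0" "\<And>y. bary c1 a b y = k \<bullet> (y - a)"
    "\<And>y. bary c2 a b y = - m * (k \<bullet> (y - a))"
    by (rule interior_edge_local[OF T mesh_disjoint[OF e(2-4)]], rule that)
  let ?d = "barycenter T2 - barycenter T1"
  have "k \<bullet> (barycenter T1 - a) = 1/3" using tri_barycenter[OF T(1)] k(4) by simp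
  moreover have "m * (k \<bullet> (barycenter T2 - a)) = - (1/3)" using tri_barycenter[OF T(2)] k(5)[of "barycenter T2"] by simp
  then have "k \<bullet> (barycenter T2 - a) < 0" using k(3) mult_nonneg_nonneg[of m "k \<bullet> (barycenter T2 - a)"] by linarith
  ultimately have kd: "k \<bullet> ?d < 0" by (simp add: inner_diff_right)
  let ?P = "\<lambda>n. norm n = 1 \<and> (\<forall>x\<in>e. \<forall>y\<in>e. n \<bullet> (x - y) = 0) \<and> 0 < n \<bullet> ?d"
  \<comment> \<open>\<open>k\<close> is the gradient of a coordinate that is positive in
    \<open>T1\<close>, so the normal pointing from \<open>T1\<close> to \<open>T2\<close> is its
    negative, normalized.\<close>
  define n0 where "n0 = (- 1 / norm k) *\<^sub>R k"
  have n0: "norm n0 = 1" "n0 \<bullet> (b - a) = 0" "0 < n0 \<bullet> ?d"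
    using k kd by (simp_all add: n0_def divide_neg_pos)
  have perp: "(\<forall>x\<in>e. \<forall>y\<in>e. n \<bullet> (x - y) = 0) \<longleftrightarrow> n \<bullet> (b - a) = 0" for n
  proof
    assume h: "\<forall>x\<in>e. \<forall>y\<in>e. n \<bullet> (x - y) = 0"
    \<comment> \<open>The end points do not belong to \<open>e\<close>; the difference of two
      interior points is already a nonzero multiple of \<open>b - a\<close>.\<close>
    have seg: "(1 - u) *\<^sub>R a + u *\<^sub>R b \<in> e" if "0 < u" "u < 1" for u
      using that assms(3) unfolding assms(2) in_segment by blast
    have "(1 - 1/2) *\<^sub>R a + (1/2) *\<^sub>R b \<in> e" "(1 - 1/4) *\<^sub>R a + (1/4) *\<^sub>R b \<in> e"
      using seg[of "1/2"] seg[of "1/4"] by simp_all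
    then have "n \<bullet> (((1 - 1/2) *\<^sub>R a + (1/2) *\<^sub>R b) - ((1 - 1/4) *\<^sub>R a + (1/4) *\<^sub>R b)) = 0" using h by blast
    then show "n \<bullet> (b - a) = 0" by (simp add: inner_diff_right inner_add_right)
  next
    assume h: "n \<bullet> (b - a) = 0"
    show "\<forall>x\<in>e. \<forall>y\<in>e. n \<bullet> (x - y) = 0"
    proof (intro ballI)
      fix x y assume "x \<in> e" "y \<in> e"
      then obtain u v where xy: "x = (1 - u) *\<^sub>R a + u *\<^sub>R b" "y = (1 - v) *\<^sub>R a + v *\<^sub>R b"
        unfolding assms(2) in_segment by blast
      have "x - y = (u - v) *\<^sub>R (b - a)" unfolding xy by (simp add: algebra_simps)
      then show "n \<bullet> (x - y) = 0" using h by simp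
    qed
  qed
  have uniq: "n = n0" if n: "norm n = 1" "n \<bullet> (b - a) = 0" "0 < n \<bullet> ?d" for n
  proof -
    define w where "w = b - a"
    have w: "w $ 1 \<noteq> 0 \<or> w $ 2 \<noteq> 0" using assms(3) by (auto simp: w_def vec_eq_iff forall_2)
    have e: "n $ 1 * w $ 1 + n $ 2 * w $ 2 = 0" "n0 $ 1 * w $ 1 + n0 $ 2 * w $ 2 = 0"
      using n(2) n0(2) by (simp_all add: w_def inner_vec_def sum_2)
    have "(n $ 1 * n0 $ 2 - n $ 2 * n0 $ 1) * w $ 1 = 0" "(n $ 1 * n0 $ 2 - n $ 2 * n0 $ 1) * w $ 2 = 0"
      using e by algebra+
    then have c: "n $ 1 * n0 $ 2 = n $ 2 * n0 $ 1" using w by auto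
    have q: "n $ 1 * n $ 1 + n $ 2 * n $ 2 = 1" "n0 $ 1 * n0 $ 1 + n0 $ 2 * n0 $ 2 = 1"
      using n(1) n0(1) by (simp_all add: norm_eq_1 inner_vec_def sum_2)
    define s where "s = n $ 1 * n0 $ 1 + n $ 2 * n0 $ 2"
    have ns: "n $ 1 = s * n0 $ 1" "n $ 2 = s * n0 $ 2" using c q(2) unfolding s_def by algebra+
    then have nn: "n = s *\<^sub>R n0" by (simp add: vec_eq_iff forall_2)
    have "s > 0" using n(3) n0(3) nn by (simp add: zero_less_mult_iff)
    moreover have "\<bar>s\<bar> = 1" using n(1) n0(1) nn by simp
    ultimately show ?thesis using nn by simp
  qed
  have "(THE n. ?P n) = n0"
  proof (rule the_equality)
    show "?P n0" using n0 perp[of n0] by simp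
    fix n assume "?P n"
    then show "n = n0" using uniq[of n] perp[of n] by simp
  qed
  then have en: "edge_normal D e = n0" by (simp only: edge_normal_def e(1) fst_conv snd_conv)
  show "norm (edge_normal D e) = 1" unfolding en by (rule n0(1))
  show "edge_normal D e \<bullet> (b - a) = 0" unfolding en by (rule n0(2))
qed

lemma edge_disjoint_element:
  assumes "tri T a b c" shows "open_segment a b \<inter> T = {}"
proof (rule ccontr)
  assume "open_segment a b \<inter> T \<noteq> {}"
  then obtain x where x: "x \<in> open_segment a b" "x \<in> T" by blast
  obtain \<epsilon> where "\<epsilon> > 0" "\<And>y. y \<in> ball x \<epsilon> \<Longrightarrow> y \<in> T \<longleftrightarrow> 0 < bary c a b y"
    "\<And>y. y \<in> ball x \<epsilon> \<Longrightarrow> y \<in> open_segment a b \<longleftrightarrow> bary c a b y = 0"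
    using tri_edge_halfplane[OF assms x(1)] by metis
  from this(2)[of x] this(3)[of x] this(1) x show False by simp
qed

lemma sided_off_Gam:
  assumes "x \<in> side D s" shows "sided D T s x"
proof -
  obtain \<epsilon> where "\<epsilon> > 0" "ball x \<epsilon> \<subseteq> side D s" by (rule openE[OF side_open assms])
  then show ?thesis unfolding sided_def by (intro exI[of _ \<epsilon>]) auto
qed

lemma Gam_near_edge:
  assumes "a \<noteq> b" "open_segment a b \<subseteq> Gam D" "x \<in> open_segment a b"
  shows "\<exists>\<epsilon>>0. ball x \<epsilon> \<inter> Gam D \<subseteq> open_segment a b"
proof (rule Gam_near_segment[OF C2 r_pos _ assms])
  show "closed_segment (X - r *\<^sub>R normal D X) (X + r *\<^sub>R normal D X) \<inter>
      closed_segment (Y - r *\<^sub>R normal D Y) (Y + r *\<^sub>R normal D Y) = {}"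
    if "X \<in> Gam D" "Y \<in> Gam D" "X \<noteq> Y" for X Y
    using that by (rule normals_disjoint)
qed blast

text \<open>On an edge inside the interface, \<open>Gam_near_edge\<close> shows that near each point
  the convex set \<open>T \<inter> ball x \<epsilon>\<close> misses the interface, and so lies on
  one side. On any other edge only the single intersection point has to be excluded.\<close>

lemma edge_sided:
  assumes "T \<in> mesh D" "e \<in> edges_of T" "e \<subseteq> Om D"
  obtains F where "finite F" "\<And>x. x \<in> e - F \<Longrightarrow> \<exists>s. sided D T s x"
proof -
  obtain a0 b0 c0 where t0: "tri T a0 b0 c0" by (rule mesh_tri[OF assms(1)])
  obtain a b c where t: "tri T a b c" "e = open_segment a b" by (rule edge_tri[OF t0 assms(2)])
  have ab: "a \<noteq> b" using tri_distinct[OF t(1)] by simp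
  have "e \<in> edges D" using assms by (auto simp: edges_def)
  then consider "e \<subseteq> Gam D" | x0 where "Gam D \<inter> e \<subseteq> {x0}" using edge_cut by blast
  then show ?thesis
  proof cases
    case 1
    have "\<exists>s. sided D T s x" if x: "x \<in> e" for x
    proof -
      obtain \<epsilon> where eps: "\<epsilon> > 0" "ball x \<epsilon> \<inter> Gam D \<subseteq> e"
        using Gam_near_edge[OF ab] 1 x unfolding t(2) by blast
      have "T \<inter> ball x \<epsilon> \<inter> Gam D = {}"
        using eps(2) edge_disjoint_element[OF t(1)] t(2) by blast
      moreover have "connected (T \<inter> ball x \<epsilon>)"
        by (intro convex_connected convex_Int mesh_basic[OF assms(1)] convex_ball)
      ultimately obtain s where "T \<inter> ball x \<epsilon> \<subseteq> side D s"
        using connected_in_side[of "T \<inter> ball x \<epsilon>"] mesh_basic(6)[OF assms(1)] by blast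
      then show ?thesis using eps(1) unfolding sided_def by blast
    qed
    then show ?thesis by (intro that[of "{}"]) auto
  next
    case 2
    have "\<exists>s. sided D T s x" if "x \<in> e - {x0}" for x
    proof -
      have "x \<in> Om D" "x \<notin> Gam D" using that 2 assms(3) by auto
      then show ?thesis using side_cases sided_off_Gam by blast
    qed
    then show ?thesis by (intro that[of "{x0}"]) auto
  qed
qed

text \<open>The case that needs work is a point on an edge of \<open>T\<close>: inside the domain
  there must be an element across the edge, and that element must have the very same edge.\<close>

lemma Om_point_cases:
  assumes x: "x \<in> Om D"
  obtains (elem) T where "T \<in> mesh D" "x \<in> T"
  | (vertex) T where "T \<in> mesh D" "x \<in> vertices T"
  | (edge) e where "e \<in> interior_edges D" "x \<in> e"
proof -
  obtain T where T: "T \<in> mesh D" "x \<in> closure T" using mesh_cover x closure_subset by blast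
  obtain a b c where abc: "tri T a b c" using mesh_tri[OF T(1)] .
  consider "x \<in> T" | "x \<in> vertices T" | e where "e \<in> edges_of T" "x \<in> e"
    using tri_closure_cases[OF abc T(2)] by blast
  then show ?thesis
  proof cases
    case 1
    show ?thesis by (rule elem[OF T(1) 1])
  next
    case 2
    show ?thesis by (rule vertex[OF T(1) 2])
  next
    case (3 e)
    obtain a b c where t: "tri T a b c" "e = open_segment a b" using edge_tri[OF abc 3(1)] .
    have ab: "a \<noteq> b" using tri_distinct[OF t(1)] by simp
    have xs: "x \<in> open_segment a b" using 3 t by simp
    obtain \<epsilon>0 where e0: "\<epsilon>0 > 0" "\<And>y. y \<in> ball x \<epsilon>0 \<Longrightarrow> y \<in> closure T \<longleftrightarrow> 0 \<le> bary c a b y"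
      "\<And>y. y \<in> ball x \<epsilon>0 \<Longrightarrow> y \<in> open_segment a b \<longleftrightarrow> bary c a b y = 0"
      using tri_edge_halfplane[OF t(1) xs] by metis
    obtain k where k: "k \<noteq> 0" "\<And>y. bary c a b y = k \<bullet> (y - a)"
      using bary_affine[OF tri_rotate[OF tri_rotate[OF t(1)]]] by metis
    \<comment> \<open>Removing the closed elements that miss \<open>x\<close> ensures that any
      element found near \<open>x\<close> also contains \<open>x\<close> in its closure.\<close>
    let ?K = "\<Union>(closure ` {T'\<in>mesh D. x \<notin> closure T'})"
    have "closed ?K" using finite_mesh by (intro closed_Union) auto
    then have "open (Om D \<inter> ball x \<epsilon>0 - ?K)" using Om(1) by (intro open_Diff open_Int) auto
    moreover have "x \<in> Om D \<inter> ball x \<epsilon>0 - ?K" using x e0(1) by auto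
    ultimately obtain \<epsilon> where eps: "\<epsilon> > 0" "ball x \<epsilon> \<subseteq> Om D \<inter> ball x \<epsilon>0 - ?K" by (meson openE)
    \<comment> \<open>A point just across the edge, where the coordinate of \<open>c\<close> is
      negative.\<close>
    define y where "y = x - (\<epsilon> / (2 * norm k)) *\<^sub>R k"
    have yb: "y \<in> ball x \<epsilon>" using eps(1) k(1) by (simp add: y_def dist_norm)
    have "bary c a b x = 0" using e0 xs by simp
    then have "bary c a b y = - ((\<epsilon> / (2 * norm k)) * (k \<bullet> k))"
      by (simp add: k(2) y_def inner_diff_right)
    then have "bary c a b y < 0" using eps(1) k(1) by (simp add: zero_less_mult_iff)
    then have yT: "y \<notin> closure T" using e0(2) yb eps(2) by fastforce
    obtain T' where T': "T' \<in> mesh D" "y \<in> closure T'"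
      using mesh_cover[of y] yb eps(2) closure_subset by blast
    have xT': "x \<in> closure T'" using yb eps(2) T' by blast
    have ne: "T' \<noteq> T" using yT T'(2) by blast
    define F where "F = closure T' \<inter> closure T"
    have F: "F face_of closure T'" "F face_of closure T"
      using mesh_Int_face[OF T'(1) T(1)] mesh_Int_face[OF T(1) T'(1)] by (simp_all add: F_def Int_commute)
    have xF: "x \<in> F" using xT' T(2) by (simp add: F_def)
    obtain S where S: "S \<subseteq> {a, b, c}" "F = convex hull S"
      using F(2) face_of_convex_hull_affine_independent[OF tri_affine_independent[OF t(1)]]
      unfolding tri_closure_hull[OF t(1)] by blast
    have "closed_segment a b \<subseteq> F"
    proof -
      have "a \<in> closure T" "b \<in> closure T"
        unfolding tri_closure_hull[OF t(1)] by (simp_all add: hull_inc)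
      then have "a \<in> F \<and> b \<in> F" using face_ofD[OF F(2) xs _ _ xF] by blast
      moreover have "convex F" using F(2) face_of_imp_convex by blast
      ultimately show ?thesis by (simp add: closed_segment_subset)
    qed
    moreover have "F \<subseteq> closed_segment a b"
    proof -
      \<comment> \<open>If \<open>c\<close> belonged to the common face, the face would be all of
        \<open>closure T\<close>, and the two elements would overlap.\<close>
      have "c \<notin> F"
      proof
        assume "c \<in> F"
        moreover have "a \<in> F" "b \<in> F" using \<open>closed_segment a b \<subseteq> F\<close> by auto
        moreover have "convex F" using F(2) face_of_imp_convex by blast
        ultimately have "convex hull {a, b, c} \<subseteq> F" by (intro hull_minimal) auto
        then have "closure T \<subseteq> closure T'" using tri_closure_hull[OF t(1)] by (simp add: F_def)
        then have "T \<inter> closure T' \<noteq> {}" using mesh_basic(4)[OF T(1)] closure_subset by blast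
        then have "T \<inter> T' \<noteq> {}" using open_Int_closure_eq_empty[OF mesh_basic(1)[OF T(1)]] by blast
        then show False using mesh_disjoint[OF T(1) T'(1)] ne by blast
      qed
      then have "c \<notin> S" using hull_inc[of c S convex] S(2) by metis
      then have "S \<subseteq> {a, b}" using S(1) by blast
      then show ?thesis using S(2) hull_mono[of S "{a, b}" convex] by (simp add: segment_convex_hull)
    qed
    ultimately have Feq: "F = closed_segment a b" by blast
    have "aff_dim F = 1" using ab unfolding Feq segment_convex_hull by (simp add: aff_dim_convex_hull)
    then have "F edge_of closure T'" using F(1) by (simp add: edge_of_def)
    moreover have "rel_interior F = e" using Feq t(2) ab by (simp add: rel_interior_closed_segment)
    ultimately have "e \<in> edges_of T'" unfolding edges_of_def by blast
    then have "e \<in> interior_edges D" using 3(1) T(1) T'(1) ne unfolding interior_edges_def by blast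
    from edge[OF this 3(2)] show ?thesis .
  qed
qed

lemma finite_vertices: "finite (\<Union>T\<in>mesh D. vertices T)"
proof (rule finite_UN_I[OF finite_mesh])
  fix T assume "T \<in> mesh D"
  then obtain a b c where "tri T a b c" by (rule mesh_tri)
  then show "finite (vertices T)" by (simp add: tri_vertices)
qed

lemma finite_edges: "finite (edges D)"
  unfolding edges_def
proof (rule finite_UN_I[OF finite_mesh])
  fix T assume "T \<in> mesh D"
  then obtain a b c where "tri T a b c" by (rule mesh_tri)
  then show "finite (edges_of T)" by (simp add: tri_edges)
qed

lemma interior_edges_subset: "interior_edges D \<subseteq> edges D"
  by (auto simp: interior_edges_def edges_def)

end

section \<open>Differential operators with constant coefficients\<close>

lemma pd_local:
  assumes U: "open U" "\<And>y. y \<in> U \<Longrightarrow> u y = v y" and x: "x \<in> U"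
  shows "pd i u x = pd i v x"
proof -
  have "(u has_derivative F) (at x) \<longleftrightarrow> (v has_derivative F) (at x)" for F
    using has_derivative_transform_within_open[of u F x UNIV U v]
      has_derivative_transform_within_open[of v F x UNIV U u] U x by auto
  then have "frechet_derivative u (at x) = frechet_derivative v (at x)"
    unfolding frechet_derivative_def by simp
  then show ?thesis by (simp add: pd_def)
qed

lemma polys_fadd: "f \<in> polys p \<Longrightarrow> g \<in> polys p \<Longrightarrow> fadd f c g \<in> polys p"
  unfolding fadd_def by (intro polys_add polys_cmult)

lemma pd_fadd:
  assumes "f \<in> polys p" "g \<in> polys p" shows "pd i (fadd f c g) = fadd (pd i f) c (pd i g)"
proof
  fix x
  have "(fadd f c g has_derivative (\<lambda>h. (pd 1 f x * h $ 1 + pd 2 f x * h $ 2)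
      + c * (pd 1 g x * h $ 1 + pd 2 g x * h $ 2))) (at x)"
    unfolding fadd_def
    by (intro has_derivative_add has_derivative_mult_right polys_has_derivative[OF assms(1)]
        polys_has_derivative[OF assms(2)])
  moreover have "(fadd f c g has_derivative (\<lambda>h. pd 1 (fadd f c g) x * h $ 1 + pd 2 (fadd f c g) x * h $ 2)) (at x)"
    by (rule polys_has_derivative[OF polys_fadd[OF assms]])
  ultimately have "(\<lambda>h :: pt. (pd 1 f x * h $ 1 + pd 2 f x * h $ 2) + c * (pd 1 g x * h $ 1 + pd 2 g x * h $ 2))
     = (\<lambda>h. pd 1 (fadd f c g) x * h $ 1 + pd 2 (fadd f c g) x * h $ 2)"
    by (rule has_derivative_unique)
  from fun_cong[OF this, of "axis i 1"] show "pd i (fadd f c g) x = fadd (pd i f) c (pd i g) x"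
    using exhaust_2[of i] by (auto simp: axis_def fadd_def)
qed

text \<open>Locality lets \<open>u\<close> be replaced by its polynomial on an open piece; the other
  conditions make the operator a linear map of \<open>polys p\<close> into itself. The trace lemmas
  are thus proved once for \<open>u\<close>, \<open>pd\<close>, \<open>dn\<close> and
  \<open>dnn\<close> and their compositions with \<open>pd\<close>.\<close>

definition diff_op :: "nat \<Rightarrow> ((pt \<Rightarrow> real) \<Rightarrow> pt \<Rightarrow> real) \<Rightarrow> bool" where
  "diff_op p L \<longleftrightarrow>
     (\<forall>U u v. open U \<longrightarrow> (\<forall>y\<in>U. u y = v y) \<longrightarrow> (\<forall>x\<in>U. L u x = L v x)) \<and>
     (\<forall>f\<in>polys p. L f \<in> polys p) \<and>
     (\<forall>f\<in>polys p. \<forall>g\<in>polys p. \<forall>c. L (fadd f c g) = fadd (L f) c (L g))"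

lemma diff_opD:
  assumes "diff_op p L"
  shows "open U \<Longrightarrow> \<forall>y\<in>U. u y = v y \<Longrightarrow> x \<in> U \<Longrightarrow> L u x = L v x"
    "f \<in> polys p \<Longrightarrow> L f \<in> polys p"
    "f \<in> polys p \<Longrightarrow> g \<in> polys p \<Longrightarrow> L (fadd f c g) = fadd (L f) c (L g)"
  using assms unfolding diff_op_def by (metis, blast, blast)

lemma diff_opI:
  assumes "\<And>U u v x. open U \<Longrightarrow> \<forall>y\<in>U. u y = v y \<Longrightarrow> x \<in> U \<Longrightarrow> L u x = L v x"
    "\<And>f. f \<in> polys p \<Longrightarrow> L f \<in> polys p"
    "\<And>f g c. f \<in> polys p \<Longrightarrow> g \<in> polys p \<Longrightarrow> L (fadd f c g) = fadd (L f) c (L g)"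
  shows "diff_op p L"
  unfolding diff_op_def using assms by simp

lemma diff_op_zero:
  assumes "diff_op p L" shows "L (\<lambda>x. 0) = (\<lambda>x. 0)"
proof -
  have "L (fadd (\<lambda>x. 0) (-1) (\<lambda>x. 0)) = fadd (L (\<lambda>x. 0)) (-1) (L (\<lambda>x. 0))"
    by (rule diff_opD(3)[OF assms polys_zero polys_zero])
  then show ?thesis by (simp add: fadd_def)
qed

lemma diff_op_id: "diff_op p (\<lambda>u. u)"
  by (rule diff_opI) auto

lemma diff_op_pd:
  assumes "diff_op p L" shows "diff_op p (\<lambda>u. pd i (L u))"
proof (rule diff_opI)
  show "pd i (L u) x = pd i (L v) x" if "open U" "\<forall>y\<in>U. u y = v y" "x \<in> U" for U u v x
    using pd_local[OF that(1) diff_opD(1)[OF assms that(1,2)] that(3)] .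
  show "pd i (L f) \<in> polys p" if "f \<in> polys p" for f
    by (intro polys_pd diff_opD(2)[OF assms] that)
  show "pd i (L (fadd f c g)) = fadd (pd i (L f)) c (pd i (L g))" if "f \<in> polys p" "g \<in> polys p" for f g c
    unfolding diff_opD(3)[OF assms that]
    by (rule pd_fadd[OF diff_opD(2)[OF assms that(1)] diff_opD(2)[OF assms that(2)]])
qed

lemma diff_op_lincomb:
  assumes "\<And>i. i \<in> A \<Longrightarrow> diff_op p (L i)" shows "diff_op p (\<lambda>u x. \<Sum>i\<in>A. k i * L i u x)"
proof (rule diff_opI)
  show "(\<Sum>i\<in>A. k i * L i u x) = (\<Sum>i\<in>A. k i * L i v x)" if "open U" "\<forall>y\<in>U. u y = v y" "x \<in> U" for U u v x
    using diff_opD(1)[OF assms that] by (intro sum.cong) auto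
  show "(\<lambda>x. \<Sum>i\<in>A. k i * L i f x) \<in> polys p" if "f \<in> polys p" for f
    by (intro polys_sum polys_cmult diff_opD(2)[OF assms] that)
  show "(\<lambda>x. \<Sum>i\<in>A. k i * L i (fadd f c g) x) = fadd (\<lambda>x. \<Sum>i\<in>A. k i * L i f x) c (\<lambda>x. \<Sum>i\<in>A. k i * L i g x)"
    if "f \<in> polys p" "g \<in> polys p" for f g c
  proof
    fix x
    have "(\<Sum>i\<in>A. k i * L i (fadd f c g) x) = (\<Sum>i\<in>A. k i * L i f x + c * (k i * L i g x))"
      using diff_opD(3)[OF assms that] by (intro sum.cong) (auto simp: fadd_def algebra_simps)
    then show "(\<Sum>i\<in>A. k i * L i (fadd f c g) x) = fadd (\<lambda>x. \<Sum>i\<in>A. k i * L i f x) c (\<lambda>x. \<Sum>i\<in>A. k i * L i g x) x"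
      by (simp add: fadd_def sum.distrib sum_distrib_left)
  qed
qed

lemma diff_op_dn: "diff_op p (dn n)"
  using diff_op_lincomb[of UNIV p "\<lambda>i u. pd i u" "\<lambda>i. n $ i"] diff_op_pd[OF diff_op_id]
  unfolding dn_def[abs_def] by blast

lemma diff_op_dnn: "diff_op p (dnn n)"
proof -
  have "diff_op p (\<lambda>u x. \<Sum>j\<in>UNIV. n $ j * pd i (pd j u) x)" for i
    by (intro diff_op_lincomb diff_op_pd diff_op_id)
  then have "diff_op p (\<lambda>u x. \<Sum>i\<in>UNIV. n $ i * (\<Sum>j\<in>UNIV. n $ j * pd i (pd j u) x))"
    by (rule diff_op_lincomb)
  then show ?thesis unfolding dnn_def[abs_def] by (simp add: sum_distrib_left mult.assoc)
qed

section \<open>The finite element space\<close>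

lemma within_nontrivial:
  fixes S :: "pt set"
  assumes "open S" "x \<in> closure S" shows "\<not> trivial_limit (at x within S)"
proof (cases "x \<in> S")
  case True
  then show ?thesis using at_within_open[OF True assms(1)] at_neq_bot[of x] by simp
next
  case False
  then show ?thesis using assms(2) by (simp add: trivial_limit_within closure_def)
qed

lemma sum_fadd_coeff: "(\<Sum>A\<in>N. (c A + k * d A) * f A) = (\<Sum>A\<in>N. c A * f A) + k * (\<Sum>A\<in>N. d A * f A)"
  for k :: real
  by (simp add: sum.distrib sum_distrib_left algebra_simps)

lemma in_local_space_fadd:
  assumes "in_local_space D p T u" "in_local_space D p T v" shows "in_local_space D p T (fadd u k v)"
proof (cases "T \<in> interface_elements D")
  case True
  obtain c where c: "\<And>x. x\<in>T \<inter> OmP D \<Longrightarrow> u x = (\<Sum>A\<in>nodes p T. c A * fst (ife_shape D p T A) x)"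
    "\<And>x. x\<in>T \<inter> OmM D \<Longrightarrow> u x = (\<Sum>A\<in>nodes p T. c A * snd (ife_shape D p T A) x)"
    using assms(1) True unfolding in_local_space_def by auto
  obtain d where d: "\<And>x. x\<in>T \<inter> OmP D \<Longrightarrow> v x = (\<Sum>A\<in>nodes p T. d A * fst (ife_shape D p T A) x)"
    "\<And>x. x\<in>T \<inter> OmM D \<Longrightarrow> v x = (\<Sum>A\<in>nodes p T. d A * snd (ife_shape D p T A) x)"
    using assms(2) True unfolding in_local_space_def by auto
  show ?thesis unfolding in_local_space_def fadd_def using True c d
    by (simp, intro exI[of _ "\<lambda>A. c A + k * d A"]) (simp add: sum_fadd_coeff)
next
  case False
  then obtain f g where "f \<in> polys p" "g \<in> polys p" "\<And>x. x \<in> T \<Longrightarrow> u x = f x" "\<And>x. x \<in> T \<Longrightarrow> v x = g x"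
    using assms unfolding in_local_space_def by auto
  then show ?thesis unfolding in_local_space_def using False
    by (simp, intro bexI[of _ "fadd f k g"] polys_fadd) (simp_all add: fadd_def)
qed

lemma L2_fadd:
  assumes "u \<in> L2 S" "v \<in> L2 S" shows "fadd u c v \<in> L2 S"
proof -
  have m: "u \<in> borel_measurable (lebesgue_on S)" "v \<in> borel_measurable (lebesgue_on S)"
    and i: "integrable (lebesgue_on S) (\<lambda>x. (u x)\<^sup>2)" "integrable (lebesgue_on S) (\<lambda>x. (v x)\<^sup>2)"
    using assms by (auto simp: L2_def)
  have "integrable (lebesgue_on S) (\<lambda>x. (u x + c * v x)\<^sup>2)"
  proof (rule Bochner_Integration.integrable_bound)
    show "integrable (lebesgue_on S) (\<lambda>x. 2 * (u x)\<^sup>2 + (2 * c\<^sup>2) * (v x)\<^sup>2)"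
      using i by (intro Bochner_Integration.integrable_add integrable_mult_right)
    show "(\<lambda>x. (u x + c * v x)\<^sup>2) \<in> borel_measurable (lebesgue_on S)" using m by measurable
    have "(a + c * b)\<^sup>2 \<le> 2 * a\<^sup>2 + (2 * c\<^sup>2) * b\<^sup>2" for a b :: real
    proof -
      have "0 \<le> (a - c * b)\<^sup>2" by simp
      then show ?thesis by (simp add: power2_eq_square algebra_simps)
    qed
    then show "AE x in lebesgue_on S. norm ((u x + c * v x)\<^sup>2) \<le> norm (2 * (u x)\<^sup>2 + (2 * c\<^sup>2) * (v x)\<^sup>2)"
      by (intro AE_I2) (simp add: abs_of_nonneg)
  qed
  then show ?thesis using m unfolding L2_def fadd_def by auto
qed

lemma L2_mult_integrable:
  assumes "f \<in> L2 S" "v \<in> L2 S" shows "integrable (lebesgue_on S) (\<lambda>x. f x * v x)"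
proof (rule Bochner_Integration.integrable_bound)
  have m: "f \<in> borel_measurable (lebesgue_on S)" "v \<in> borel_measurable (lebesgue_on S)"
    and i: "integrable (lebesgue_on S) (\<lambda>x. (f x)\<^sup>2)" "integrable (lebesgue_on S) (\<lambda>x. (v x)\<^sup>2)"
    using assms by (auto simp: L2_def)
  show "integrable (lebesgue_on S) (\<lambda>x. (f x)\<^sup>2 + (v x)\<^sup>2)" using i by simp
  show "(\<lambda>x. f x * v x) \<in> borel_measurable (lebesgue_on S)" using m by measurable
  have "\<bar>a * b\<bar> \<le> a\<^sup>2 + b\<^sup>2" for a b :: real
  proof -
    have "2 * (\<bar>a\<bar> * \<bar>b\<bar>) \<le> a\<^sup>2 + b\<^sup>2" using sum_squares_bound[of "\<bar>a\<bar>" "\<bar>b\<bar>"] by simp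
    moreover have "0 \<le> \<bar>a\<bar> * \<bar>b\<bar>" by simp
    ultimately show ?thesis unfolding abs_mult by linarith
  qed
  then show "AE x in lebesgue_on S. norm (f x * v x) \<le> norm ((f x)\<^sup>2 + (v x)\<^sup>2)"
    by (intro AE_I2) (simp add: abs_of_nonneg)
qed

lemma lin_space_S_h: "lin_space (S_h D p)"
  unfolding lin_space_def
proof (intro conjI ballI allI)
  have "in_local_space D p T (\<lambda>x. 0)" for T
    unfolding in_local_space_def by (auto intro: exI[of _ "\<lambda>_. 0"] bexI[OF _ polys_zero])
  then show "(\<lambda>_. 0) \<in> S_h D p" by (auto simp: S_h_def L2_def)
  fix u v c assume u: "u \<in> S_h D p" and v: "v \<in> S_h D p"
  have "continuous (at x within closure (Om D)) (fadd u c v)"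
    if "continuous (at x within closure (Om D)) u" "continuous (at x within closure (Om D)) v" for x
    using that unfolding fadd_def by (intro continuous_intros)
  then show "fadd u c v \<in> S_h D p"
    using u v unfolding S_h_def by (auto simp: L2_fadd in_local_space_fadd) (simp add: fadd_def)
qed

text \<open>Stated for arbitrary coefficients, so that it applies to whatever the choice in
  \<open>ife_shape\<close> returns.\<close>

lemma ife_comb_polys:
  assumes "tri T a b c" "p > 0" "A \<in> nodes p T"
  shows "fst (ife_comb D p T A k) \<in> polys p" "snd (ife_comb D p T A k) \<in> polys p"
proof -
  have "fst (xi D p T B) \<in> polys p" "snd (xi D p T B) \<in> polys p"
    "fst (eta D p T B) \<in> polys p" "snd (eta D p T B) \<in> polys p" if "B \<in> nodes p T" for B
    using shape_fun_polys[OF assms(1,2) that] by (simp_all add: xi_def eta_def polys_zero)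
  then show "fst (ife_comb D p T A k) \<in> polys p" "snd (ife_comb D p T A k) \<in> polys p"
    using assms(3) unfolding ife_comb_def by (auto intro!: polys_add polys_sum polys_cmult)
qed

text \<open>The restriction of \<open>u\<close> to a piece, extended to the plane; it is unique
  because a polynomial is determined by its values on a nonempty open set. The value 0 on empty
  pieces keeps it linear in \<open>u\<close> without exceptions.\<close>

definition piece_poly :: "ife_data \<Rightarrow> nat \<Rightarrow> (pt \<Rightarrow> real) \<Rightarrow> pt set \<Rightarrow> bool \<Rightarrow> pt \<Rightarrow> real" where
  "piece_poly D p u T s =
     (if T \<inter> side D s = {} then (\<lambda>_. 0)
      else (THE q. q \<in> polys p \<and> (\<forall>x\<in>T \<inter> side D s. u x = q x)))"

context ife_problem
begin

lemma open_piece: "T \<in> mesh D \<Longrightarrow> open (T \<inter> side D s)"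
  using mesh_basic(1) side_open by (intro open_Int)

lemma piece_poly_exists:
  assumes u: "u \<in> S_h D p" and T: "T \<in> mesh D"
  shows "\<exists>q\<in>polys p. \<forall>x\<in>T \<inter> side D s. u x = q x"
proof -
  have l: "in_local_space D p T u" using u T by (simp add: S_h_def)
  show ?thesis
  proof (cases "T \<in> interface_elements D")
    case True
    obtain a b c where t: "tri T a b c" using mesh_tri[OF T] .
    have poly: "fst (ife_shape D p T A) \<in> polys p" "snd (ife_shape D p T A) \<in> polys p" if "A \<in> nodes p T" for A
      unfolding ife_shape_def by (rule ife_comb_polys[OF t p_pos that])+
    obtain c where c: "\<And>x. x\<in>T \<inter> OmP D \<Longrightarrow> u x = (\<Sum>A\<in>nodes p T. c A * fst (ife_shape D p T A) x)"
      "\<And>x. x\<in>T \<inter> OmM D \<Longrightarrow> u x = (\<Sum>A\<in>nodes p T. c A * snd (ife_shape D p T A) x)"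
      using l True unfolding in_local_space_def by auto
    show ?thesis
    proof (cases s)
      case True
      have "(\<lambda>x. \<Sum>A\<in>nodes p T. c A * fst (ife_shape D p T A) x) \<in> polys p"
        by (intro polys_sum polys_cmult poly)
      then show ?thesis using c(1) True by (intro bexI) (auto simp: side_def)
    next
      case False
      have "(\<lambda>x. \<Sum>A\<in>nodes p T. c A * snd (ife_shape D p T A) x) \<in> polys p"
        by (intro polys_sum polys_cmult poly)
      then show ?thesis using c(2) False by (intro bexI) (auto simp: side_def)
    qed
  next
    case False
    then show ?thesis using l unfolding in_local_space_def by auto
  qed
qed

lemma piece_poly_eqI:
  assumes T: "T \<in> mesh D" and ne: "T \<inter> side D s \<noteq> {}" and q: "q \<in> polys p" "\<And>x. x \<in> T \<inter> side D s \<Longrightarrow> u x = q x"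
  shows "piece_poly D p u T s = q"
proof -
  have "(THE q. q \<in> polys p \<and> (\<forall>x\<in>T \<inter> side D s. u x = q x)) = q"
  proof (rule the_equality)
    show "q \<in> polys p \<and> (\<forall>x\<in>T \<inter> side D s. u x = q x)" using q by blast
    fix q' assume q': "q' \<in> polys p \<and> (\<forall>x\<in>T \<inter> side D s. u x = q' x)"
    have "fadd q' (-1) q x = 0" for x
    proof (rule polys_zero_of_open[OF open_piece[OF T] ne])
      show "fadd q' (-1) q \<in> polys p" using q q' by (intro polys_fadd) auto
      show "fadd q' (-1) q x = 0" if x: "x \<in> T \<inter> side D s" for x
        using q(2)[OF x] bspec[OF conjunct2[OF q'] x] by (simp add: fadd_def)
    qed
    then show "q' = q" by (simp add: fadd_def fun_eq_iff)
  qed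
  then show ?thesis using ne by (simp add: piece_poly_def)
qed

lemma piece_poly:
  assumes u: "u \<in> S_h D p" and T: "T \<in> mesh D"
  shows "piece_poly D p u T s \<in> polys p" "\<And>x. x \<in> T \<inter> side D s \<Longrightarrow> u x = piece_poly D p u T s x"
proof -
  obtain q where q: "q \<in> polys p" "\<forall>x\<in>T \<inter> side D s. u x = q x"
    using piece_poly_exists[OF u T] by blast
  have eq: "piece_poly D p u T s = q" if "T \<inter> side D s \<noteq> {}"
    by (rule piece_poly_eqI[OF T that q(1)]) (use q(2) in blast)
  show "piece_poly D p u T s \<in> polys p"
  proof (cases "T \<inter> side D s = {}")
    case True
    then show ?thesis by (simp add: piece_poly_def polys_zero)
  next
    case False
    then show ?thesis using eq q(1) by simp
  qed
  show "u x = piece_poly D p u T s x" if "x \<in> T \<inter> side D s" for x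
  proof -
    have "T \<inter> side D s \<noteq> {}" using that by blast
    from eq[OF this] show ?thesis using q(2) that by simp
  qed
qed

lemma piece_poly_fadd:
  assumes u: "u \<in> S_h D p" and v: "v \<in> S_h D p" and T: "T \<in> mesh D"
  shows "piece_poly D p (fadd u c v) T s = fadd (piece_poly D p u T s) c (piece_poly D p v T s)"
proof (cases "T \<inter> side D s = {}")
  case True
  then show ?thesis by (simp add: piece_poly_def fadd_def)
next
  case False
  show ?thesis
  proof (rule piece_poly_eqI[OF T False])
    show "fadd (piece_poly D p u T s) c (piece_poly D p v T s) \<in> polys p"
      by (intro polys_fadd piece_poly u v T)
    show "fadd u c v x = fadd (piece_poly D p u T s) c (piece_poly D p v T s) x" if "x \<in> T \<inter> side D s" for x
      using piece_poly(2)[OF u T that] piece_poly(2)[OF v T that] by (simp add: fadd_def)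
  qed
qed

text \<open>One determining grid is taken in each nonempty piece, and there are finitely many
  pieces. A function that vanishes on all the grids may still be nonzero off the pieces.\<close>

lemma determining_set_exists:
  "\<exists>I. finite I \<and> (\<forall>u\<in>S_h D p. (\<forall>i\<in>I. u i = 0) \<longrightarrow>
     (\<forall>T\<in>mesh D. \<forall>s. piece_poly D p u T s = (\<lambda>_. 0)))"
proof -
  have "\<exists>J. finite J \<and> (\<forall>u\<in>S_h D p. (\<forall>i\<in>J. u i = 0) \<longrightarrow> piece_poly D p u T s = (\<lambda>_. 0))"
    if T: "T \<in> mesh D" for T s
  proof (cases "T \<inter> side D s = {}")
    case True
    then show ?thesis by (intro exI[of _ "{}"]) (simp add: piece_poly_def)
  next
    case False
    obtain J where J: "finite J" "J \<subseteq> T \<inter> side D s"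
      "\<And>f x. f \<in> polys p \<Longrightarrow> (\<And>y. y \<in> J \<Longrightarrow> f y = 0) \<Longrightarrow> f x = 0"
      using polys_determining_set[OF open_piece[OF T] False, of p] by blast
    have "piece_poly D p u T s x = 0" if u: "u \<in> S_h D p" "\<forall>i\<in>J. u i = 0" for u x
    proof (rule J(3)[OF piece_poly(1)[OF u(1) T]])
      fix y assume y: "y \<in> J"
      then have "u y = piece_poly D p u T s y" using piece_poly(2)[OF u(1) T] J(2) by blast
      then show "piece_poly D p u T s y = 0" using u(2) y by simp
    qed
    then show ?thesis using J(1) by (intro exI[of _ J]) (simp add: fun_eq_iff)
  qed
  then obtain J where J: "\<And>T s. T \<in> mesh D \<Longrightarrow> finite (J T s)"
    "\<And>T s u. T \<in> mesh D \<Longrightarrow> u \<in> S_h D p \<Longrightarrow> \<forall>i\<in>J T s. u i = 0 \<Longrightarrow> piece_poly D p u T s = (\<lambda>_. 0)"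
    by metis
  show ?thesis
  proof (intro exI[of _ "\<Union>T\<in>mesh D. \<Union>s. J T s"] conjI ballI impI allI)
    show "finite (\<Union>T\<in>mesh D. \<Union>s. J T s)" using finite_mesh J(1) by simp
    fix u T s assume "u \<in> S_h D p" "\<forall>i\<in>\<Union>T\<in>mesh D. \<Union>s. J T s. u i = 0" "T \<in> mesh D"
    then show "piece_poly D p u T s = (\<lambda>_. 0)" by (intro J(2)) auto
  qed
qed

definition dset :: "pt set" where
  "dset = (SOME I. finite I \<and> (\<forall>u\<in>S_h D p. (\<forall>i\<in>I. u i = 0) \<longrightarrow>
     (\<forall>T\<in>mesh D. \<forall>s. piece_poly D p u T s = (\<lambda>_. 0))))"

lemma dset:
  "finite dset"
  "u \<in> S_h D p \<Longrightarrow> \<forall>i\<in>dset. u i = 0 \<Longrightarrow> T \<in> mesh D \<Longrightarrow> piece_poly D p u T s = (\<lambda>_. 0)"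
  using someI_ex[OF determining_set_exists] unfolding dset_def by blast+

section \<open>Traces\<close>

text \<open>On \<open>S\<close> near \<open>x\<close> the function \<open>L u\<close> coincides with
  \<open>L\<close> applied to the piece polynomial, which is continuous. \<open>S\<close> is the
  whole element for traces on edges and one of its two parts for traces on the interface.\<close>

lemma trace_eq:
  assumes u: "u \<in> S_h D p" and T: "T \<in> mesh D" and L: "diff_op p L"
    and S: "S \<subseteq> T" "x \<in> closure S" "open S" and \<epsilon>: "\<epsilon> > 0" "S \<inter> ball x \<epsilon> \<subseteq> side D s"
  shows "trace_from S (L u) x = L (piece_poly D p u T s) x"
    "trace_from S (\<lambda>y. beta D y * L u y) x = beta_side D s * L (piece_poly D p u T s) x"
proof -
  let ?q = "piece_poly D p u T s"
  note lim = within_nontrivial[OF S(3,2)]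
  have cont: "(L ?q \<longlongrightarrow> L ?q x) (at x within S)"
    using polys_isCont[OF diff_opD(2)[OF L piece_poly(1)[OF u T]]]
    by (meson continuous_at_imp_continuous_at_within continuous_within)
  have eq: "L u y = L ?q y \<and> y \<in> side D s" if y: "y \<in> S \<inter> ball x \<epsilon>" for y
  proof -
    have "y \<in> T \<inter> side D s" using y S(1) \<epsilon>(2) by blast
    then show ?thesis
      using diff_opD(1)[OF L open_piece[OF T, of s], of u ?q y] piece_poly(2)[OF u T] by blast
  qed
  have ev: "\<forall>\<^sub>F y in at x within S. y \<in> S \<inter> ball x \<epsilon>"
    using \<epsilon>(1) unfolding eventually_at by (intro exI[of _ \<epsilon>]) (auto simp: dist_commute)
  have bs: "beta D y = beta_side D s" if "y \<in> side D s" for y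
    using that side_disjoint(1) by (cases s) (auto simp: beta_def beta_side_def side_def)
  have "(L u \<longlongrightarrow> L ?q x) (at x within S)"
    by (rule Lim_transform_eventually[OF cont]) (use ev eq in \<open>auto elim!: eventually_mono\<close>)
  then show "trace_from S (L u) x = L ?q x" unfolding trace_from_def by (rule tendsto_Lim[OF lim])
  have "((\<lambda>y. beta_side D s * L ?q y) \<longlongrightarrow> beta_side D s * L ?q x) (at x within S)"
    by (intro tendsto_intros cont)
  then have "((\<lambda>y. beta D y * L u y) \<longlongrightarrow> beta_side D s * L ?q x) (at x within S)"
    by (rule Lim_transform_eventually) (use ev eq bs in \<open>auto elim!: eventually_mono\<close>)
  then show "trace_from S (\<lambda>y. beta D y * L u y) x = beta_side D s * L ?q x"
    unfolding trace_from_def by (rule tendsto_Lim[OF lim])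
qed

lemma trace_sided:
  assumes u: "u \<in> S_h D p" and T: "T \<in> mesh D" and L: "diff_op p L"
    and x: "x \<in> closure T" "sided D T s x"
  shows "trace_from T (L u) x = L (piece_poly D p u T s) x"
    "trace_from T (\<lambda>y. beta D y * L u y) x = beta_side D s * L (piece_poly D p u T s) x"
proof -
  obtain \<epsilon> where "\<epsilon> > 0" "T \<inter> ball x \<epsilon> \<subseteq> side D s" using x(2) by (auto simp: sided_def)
  from trace_eq[OF u T L subset_refl x(1) mesh_basic(1)[OF T] this]
  show "trace_from T (L u) x = L (piece_poly D p u T s) x"
    "trace_from T (\<lambda>y. beta D y * L u y) x = beta_side D s * L (piece_poly D p u T s) x" .
qed

lemma interface_jump_eq:
  assumes u: "u \<in> S_h D p" and T: "T \<in> mesh D" and L: "diff_op p L" and x: "x \<in> T" "x \<in> Gam D"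
  shows "interface_jump D T (L u) x = L (piece_poly D p u T True) x - L (piece_poly D p u T False) x"
proof -
  have "trace_from (T \<inter> side D s) (L u) x = L (piece_poly D p u T s) x" for s
    by (rule trace_eq(1)[OF u T L _ Gam_in_closure_side[OF mesh_basic(1,6)[OF T] x] open_piece[OF T], of _ 1]) auto
  from this[of True] this[of False] show ?thesis by (simp add: interface_jump_def side_def)
qed

lemma sided_unique:
  assumes "T \<in> mesh D" "x \<in> closure T" "sided D T s x" "sided D T s' x" shows "s = s'"
proof -
  obtain \<epsilon> \<epsilon>' where e: "\<epsilon> > 0" "T \<inter> ball x \<epsilon> \<subseteq> side D s" "\<epsilon>' > 0" "T \<inter> ball x \<epsilon>' \<subseteq> side D s'"
    using assms(3,4) by (auto simp: sided_def)
  obtain y where "y \<in> T" "dist y x < min \<epsilon> \<epsilon>'"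
    using assms(2) e(1,3) unfolding closure_approachable by (meson min_less_iff_conj)
  then have "y \<in> T \<inter> ball x \<epsilon>" "y \<in> T \<inter> ball x \<epsilon>'" by (auto simp: dist_commute)
  then show ?thesis using e side_unique by blast
qed

end

section \<open>The terms of the bilinear form\<close>

lemma preimage_open_lebesgue:
  fixes \<gamma> :: "'a :: euclidean_space \<Rightarrow> 'b :: euclidean_space"
  assumes "S \<in> sets lebesgue" "continuous_on S \<gamma>" "open A"
  shows "{t \<in> S. \<gamma> t \<in> A} \<in> sets lebesgue"
proof -
  have "\<gamma> \<in> borel_measurable (lebesgue_on S)"
    using assms by (intro continuous_imp_measurable_on_sets_lebesgue)
  then have "\<gamma> -` A \<inter> space (lebesgue_on S) \<in> sets (lebesgue_on S)"
    using assms(3) by (intro measurable_sets) auto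
  moreover have "\<gamma> -` A \<inter> space (lebesgue_on S) = {t \<in> S. \<gamma> t \<in> A}" by auto
  ultimately show ?thesis using assms(1) by (simp add: sets_restrict_space_iff)
qed

lemma bddm_preimage_open:
  fixes \<gamma> :: "'a :: euclidean_space \<Rightarrow> 'b :: euclidean_space"
  assumes "S \<in> sets lebesgue" "continuous_on S \<gamma>" "open A"
  shows "bddm S (\<lambda>t. if \<gamma> t \<in> A then 1 else 0)"
  by (rule bddm_indicator[OF assms(1) preimage_open_lebesgue[OF assms]])

lemma lmeasurable_of_subset:
  assumes "S \<in> sets lebesgue" "S \<subseteq> {0..1 :: real}" shows "S \<in> lmeasurable"
  using assms by (metis bounded_closed_interval bounded_set_imp_lmeasurable bounded_subset)

text \<open>Names the parametrization chosen inside \<open>edge_integral\<close> by the same choice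
  term, so that edge integrals become integrals over parameter sets \<open>esec\<close>.\<close>

definition epath :: "pt set \<Rightarrow> real \<Rightarrow> pt" where
  "epath e = (SOME g. \<exists>a b. a \<noteq> b \<and> e = open_segment a b \<and> g = linepath a b)"

definition esec :: "pt set \<Rightarrow> pt set \<Rightarrow> real set" where
  "esec e S = {t \<in> {0..1}. epath e t \<in> S \<inter> e}"

lemma epathE:
  assumes "e = open_segment a' b'" "a' \<noteq> b'"
  obtains a b where "a \<noteq> b" "e = open_segment a b" "epath e = linepath a b"
proof -
  have "\<exists>g. \<exists>a b. a \<noteq> b \<and> e = open_segment a b \<and> g = linepath a b" using assms by blast
  then have "\<exists>a b. a \<noteq> b \<and> e = open_segment a b \<and> epath e = linepath a b"
    unfolding epath_def by (rule someI_ex)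
  then show ?thesis using that by blast
qed

lemma linepath_mem_open_segment:
  fixes a b :: pt
  assumes "a \<noteq> b" shows "linepath a b t \<in> open_segment a b \<longleftrightarrow> 0 < t \<and> t < 1"
proof
  assume "linepath a b t \<in> open_segment a b"
  then obtain u where u: "0 < u" "u < 1" "linepath a b t = (1 - u) *\<^sub>R a + u *\<^sub>R b"
    by (auto simp: in_segment)
  have "(t - u) *\<^sub>R (b - a) = linepath a b t - ((1 - u) *\<^sub>R a + u *\<^sub>R b)"
    by (simp add: linepath_def algebra_simps)
  then have "(t - u) *\<^sub>R (b - a) = 0" using u(3) by simp
  then have "t = u" using assms by simp
  then show "0 < t \<and> t < 1" using u by simp
qed (use assms in \<open>auto simp: in_segment linepath_def\<close>)

lemma linepath_cong_iff:
  fixes a b :: pt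
  assumes "a \<noteq> b" shows "linepath a b t = linepath a b t' \<longleftrightarrow> t = t'"
proof
  assume "linepath a b t = linepath a b t'"
  moreover have "(t - t') *\<^sub>R (b - a) = linepath a b t - linepath a b t'"
    by (simp add: linepath_def algebra_simps)
  ultimately have "(t - t') *\<^sub>R (b - a) = 0" by simp
  then show "t = t'" using assms by simp
qed simp

context ife_problem
begin

lemma beta_side_pos: "0 < beta_side D s"
  using beta_pos by (simp add: beta_side_def)

lemma beta_avg_pos: "0 < beta_avg D"
  using beta_pos by (simp add: beta_avg_def)

lemma beta_positive: "0 < beta D x"
  using beta_pos beta_avg_pos by (simp add: beta_def)

lemma poly_lop:
  fixes \<gamma> :: "'b :: euclidean_space \<Rightarrow> pt"
  assumes T: "T \<in> mesh D" and L: "diff_op p L"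
    and S: "S \<in> sets lebesgue" "S \<subseteq> K" "compact K" and \<gamma>: "continuous_on K \<gamma>"
  shows "lop (S_h D p) dset S (\<lambda>u t. L (piece_poly D p u T s) (\<gamma> t))"
proof (rule lopI)
  show "S \<in> lmeasurable"
    using S by (metis bounded_set_imp_lmeasurable bounded_subset compact_imp_bounded)
  show "bddm S (\<lambda>t. L (piece_poly D p u T s) (\<gamma> t))" if u: "u \<in> S_h D p" for u
  proof (rule bddm_continuous[OF S])
    show "continuous_on K (\<lambda>t. L (piece_poly D p u T s) (\<gamma> t))"
      using polys_continuous[OF diff_opD(2)[OF L piece_poly(1)[OF u T]], of UNIV]
      by (rule continuous_on_compose2[OF _ \<gamma>]) simp
  qed
  show "AE t in lebesgue_on S. L (piece_poly D p (fadd u c v) T s) (\<gamma> t)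
      = L (piece_poly D p u T s) (\<gamma> t) + c * L (piece_poly D p v T s) (\<gamma> t)"
    if "u \<in> S_h D p" "v \<in> S_h D p" for u v c
    unfolding piece_poly_fadd[OF that T] diff_opD(3)[OF L piece_poly(1)[OF that(1) T] piece_poly(1)[OF that(2) T]]
    by (intro AE_I2) (simp add: fadd_def)
  show "AE t in lebesgue_on S. L (piece_poly D p u T s) (\<gamma> t) = 0"
    if "u \<in> S_h D p" "\<forall>i\<in>dset. u i = 0" for u
    by (intro AE_I2) (simp add: dset(2)[OF that T] diff_op_zero[OF L])
qed

text \<open>Which piece a trace sees may change along the path. The sets of points that are
  one-sided for a given side are open, so their indicators are measurable weights, and almost
  everywhere exactly one of the two is 1.\<close>

lemma sided_lop:
  fixes \<gamma> :: "real \<Rightarrow> pt"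
  assumes T: "T \<in> mesh D" and L: "diff_op p L"
    and S: "S \<in> sets lebesgue" "S \<subseteq> {0..1}" and \<gamma>: "continuous_on {0..1} \<gamma>"
    and ae: "AE t in lebesgue_on S. \<gamma> t \<in> closure T \<and> (\<exists>s. sided D T s (\<gamma> t))"
  shows "lop (S_h D p) dset S (\<lambda>u t. trace_from T (L u) (\<gamma> t))"
    "lop (S_h D p) dset S (\<lambda>u t. trace_from T (\<lambda>y. beta D y * L u y) (\<gamma> t))"
proof -
  have cS: "continuous_on S \<gamma>" using \<gamma> S(2) by (rule continuous_on_subset)
  let ?i = "\<lambda>s t. if \<gamma> t \<in> {x. sided D T s x} then 1 else 0 :: real"
  have base: "lop (S_h D p) dset S (\<lambda>u t. ?i s t * L (piece_poly D p u T s) (\<gamma> t))" for s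
    by (rule lop_mult[OF bddm_preimage_open[OF S(1) cS open_sided] poly_lop[OF T L S compact_Icc \<gamma>]])
  show "lop (S_h D p) dset S (\<lambda>u t. trace_from T (L u) (\<gamma> t))"
  proof (rule lop_cong[OF lin_space_S_h])
    show "lop (S_h D p) dset S (\<lambda>u t. ?i True t * L (piece_poly D p u T True) (\<gamma> t)
        + ?i False t * L (piece_poly D p u T False) (\<gamma> t))"
      by (rule lop_add[OF base base])
    fix u assume u: "u \<in> S_h D p"
    from ae show "AE t in lebesgue_on S. ?i True t * L (piece_poly D p u T True) (\<gamma> t)
        + ?i False t * L (piece_poly D p u T False) (\<gamma> t) = trace_from T (L u) (\<gamma> t)"
    proof eventually_elim
      case (elim t)
      then obtain s where s: "\<gamma> t \<in> closure T" "sided D T s (\<gamma> t)" by blast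
      have "sided D T s' (\<gamma> t) \<longleftrightarrow> s' = s" for s'
        using sided_unique[OF T s(1)] s(2) by blast
      then show ?case using trace_sided(1)[OF u T L s] by (cases s) auto
    qed
  qed
  show "lop (S_h D p) dset S (\<lambda>u t. trace_from T (\<lambda>y. beta D y * L u y) (\<gamma> t))"
  proof (rule lop_cong[OF lin_space_S_h])
    show "lop (S_h D p) dset S (\<lambda>u t. beta_side D True * (?i True t * L (piece_poly D p u T True) (\<gamma> t))
        + beta_side D False * (?i False t * L (piece_poly D p u T False) (\<gamma> t)))"
      by (rule lop_add[OF lop_cmult[OF base] lop_cmult[OF base]])
    fix u assume u: "u \<in> S_h D p"
    from ae show "AE t in lebesgue_on S. beta_side D True * (?i True t * L (piece_poly D p u T True) (\<gamma> t))
        + beta_side D False * (?i False t * L (piece_poly D p u T False) (\<gamma> t))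
        = trace_from T (\<lambda>y. beta D y * L u y) (\<gamma> t)"
    proof eventually_elim
      case (elim t)
      then obtain s where s: "\<gamma> t \<in> closure T" "sided D T s (\<gamma> t)" by blast
      have "sided D T s' (\<gamma> t) \<longleftrightarrow> s' = s" for s'
        using sided_unique[OF T s(1)] s(2) by blast
      then show ?case using trace_sided(2)[OF u T L s] by (cases s) auto
    qed
  qed
qed

subsection \<open>Edges\<close>

lemma interior_edge_path:
  assumes "e \<in> interior_edges D"
  obtains a b where "a \<noteq> b" "e = open_segment a b" "epath e = linepath a b"
proof -
  obtain T1 T2 a b c1 c2 where "adjacent D e = (T1, T2)" "T1 \<in> mesh D" "T2 \<in> mesh D" "T1 \<noteq> T2"
    "e \<in> edges_of T1" "e \<in> edges_of T2" "tri T1 a b c1" "tri T2 a b c2" "e = open_segment a b" "a \<noteq> b"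
    using assms by (rule interior_edgeE)
  from epathE[OF this(9,10)] that show ?thesis by blast
qed

lemma epath_continuous:
  assumes "e \<in> interior_edges D" shows "continuous_on S (epath e)"
proof -
  obtain a b where "a \<noteq> b" "e = open_segment a b" "epath e = linepath a b"
    using interior_edge_path[OF assms] .
  then show ?thesis by (simp add: continuous_on_linepath)
qed

text \<open>The open segment excludes its end points, so parameters range over the open interval and
  open regions have open parameter sets.\<close>

lemma esec_eq:
  assumes "e \<in> interior_edges D" shows "esec e S = {t \<in> {0<..<1}. epath e t \<in> S}"
proof -
  obtain a b where ab: "a \<noteq> b" "e = open_segment a b" "epath e = linepath a b"
    using interior_edge_path[OF assms] .
  show ?thesis
  proof (rule set_eqI)
    fix t
    have "epath e t \<in> e \<longleftrightarrow> 0 < t \<and> t < 1"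
      using linepath_mem_open_segment[OF ab(1), of t] ab(3) ab(2)[symmetric] by simp
    then show "t \<in> esec e S \<longleftrightarrow> t \<in> {t \<in> {0<..<1}. epath e t \<in> S}"
      unfolding esec_def by auto
  qed
qed

lemma esec_measurable:
  assumes "e \<in> interior_edges D" "open S" shows "esec e S \<in> sets lebesgue" "esec e S \<subseteq> {0..1}"
proof -
  show "esec e S \<in> sets lebesgue" unfolding esec_eq[OF assms(1)]
    by (rule preimage_open_lebesgue[OF _ epath_continuous[OF assms(1)] assms(2)]) auto
qed (auto simp: esec_def)

lemma esec_mono: "S \<subseteq> S' \<Longrightarrow> esec e S \<subseteq> esec e S'"
  by (auto simp: esec_def)

lemma epath_AE_notin:
  assumes "e \<in> interior_edges D" "open S" "finite F"
  shows "AE t in lebesgue_on (esec e S). epath e t \<in> e - F"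
proof -
  obtain a b where ab: "a \<noteq> b" "e = open_segment a b" "epath e = linepath a b"
    using interior_edge_path[OF assms(1)] .
  have "inj (linepath a b)" using linepath_cong_iff[OF ab(1)] by (auto intro: injI)
  then have "finite (epath e -` F)" using assms(3) by (simp add: ab(3) finite_vimageI)
  then have "negligible (epath e -` F)" by (rule negligible_finite)
  then have "AE t in lebesgue. t \<notin> epath e -` F"
    unfolding negligible_iff_null_sets by (rule AE_not_in)
  then show ?thesis
    using esec_measurable(1)[OF assms(1,2)]
    by (auto simp: AE_restrict_space_iff esec_def elim!: AE_mp)
qed

lemma adjacent_props:
  assumes "e \<in> interior_edges D" "adjacent D e = (T1, T2)"
  shows "T1 \<in> mesh D" "T2 \<in> mesh D" "T1 \<noteq> T2" "e \<in> edges_of T1" "e \<in> edges_of T2"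
proof -
  obtain T1' T2' a b c1 c2 where i: "adjacent D e = (T1', T2')" "T1' \<in> mesh D" "T2' \<in> mesh D" "T1' \<noteq> T2'"
    "e \<in> edges_of T1'" "e \<in> edges_of T2'" "tri T1' a b c1" "tri T2' a b c2" "e = open_segment a b" "a \<noteq> b"
    using assms(1) by (rule interior_edgeE)
  then show "T1 \<in> mesh D" "T2 \<in> mesh D" "T1 \<noteq> T2" "e \<in> edges_of T1" "e \<in> edges_of T2"
    using assms(2) by simp_all
qed

lemma edge_in_closure:
  assumes "T \<in> mesh D" "e \<in> edges_of T" shows "e \<subseteq> closure T"
proof -
  obtain a0 b0 c0 where t0: "tri T a0 b0 c0" by (rule mesh_tri[OF assms(1)])
  obtain a b c where t: "tri T a b c" "e = open_segment a b" by (rule edge_tri[OF t0 assms(2)])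
  have "closed_segment a b \<subseteq> closure T"
    unfolding tri_closure_hull[OF t(1)] segment_convex_hull by (intro hull_mono) auto
  then show ?thesis using segment_open_subset_closed t(2) by blast
qed

lemma edge_AE_sided:
  assumes e: "e \<in> interior_edges D" and T: "T \<in> mesh D" "e \<in> edges_of T" and S: "open S"
  shows "AE t in lebesgue_on (esec e S). epath e t \<in> closure T \<and> (\<exists>s. sided D T s (epath e t))"
proof -
  obtain F where F: "finite F" "\<And>x. x \<in> e - F \<Longrightarrow> \<exists>s. sided D T s x"
    using edge_sided[OF T interior_edge_subset_Om[OF e]] by blast
  from epath_AE_notin[OF e S F(1)] show ?thesis
    by eventually_elim (use F(2) edge_in_closure[OF T] in blast)
qed

lemma edge_lop:
  assumes e: "e \<in> interior_edges D" and L: "diff_op p L"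
  shows "lop (S_h D p) dset (esec e UNIV) (\<lambda>u t. edge_jump D e (L u) (epath e t))"
    "lop (S_h D p) dset (esec e UNIV) (\<lambda>u t. edge_avg D e (\<lambda>y. beta D y * L u y) (epath e t))"
proof -
  obtain T1 T2 where adj: "adjacent D e = (T1, T2)" by fastforce
  note a = adjacent_props[OF e adj]
  note l1 = sided_lop[OF a(1) L esec_measurable[OF e open_UNIV] epath_continuous[OF e] edge_AE_sided[OF e a(1,4) open_UNIV]]
  note l2 = sided_lop[OF a(2) L esec_measurable[OF e open_UNIV] epath_continuous[OF e] edge_AE_sided[OF e a(2,5) open_UNIV]]
  show "lop (S_h D p) dset (esec e UNIV) (\<lambda>u t. edge_jump D e (L u) (epath e t))"
    unfolding edge_jump_def adj fst_conv snd_conv by (rule lop_diff[OF l1(1) l2(1)])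
  have "lop (S_h D p) dset (esec e UNIV) (\<lambda>u t. (1/2) * (trace_from T1 (\<lambda>y. beta D y * L u y) (epath e t)
      + trace_from T2 (\<lambda>y. beta D y * L u y) (epath e t)))"
    by (rule lop_cmult[OF lop_add[OF l1(2) l2(2)]])
  then show "lop (S_h D p) dset (esec e UNIV) (\<lambda>u t. edge_avg D e (\<lambda>y. beta D y * L u y) (epath e t))"
    unfolding edge_avg_def adj fst_conv snd_conv by simp
qed

lemma edge_integral_eq:
  assumes "e \<in> interior_edges D"
  obtains l where "l > 0" "\<And>S F. edge_integral e S F = l * integral\<^sup>L (lebesgue_on (esec e S)) (\<lambda>t. F (epath e t))"
proof -
  obtain a b where ab: "a \<noteq> b" "e = open_segment a b" "epath e = linepath a b"
    using interior_edge_path[OF assms] .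
  have "edge_integral e S F = norm (b - a) * integral\<^sup>L (lebesgue_on (esec e S)) (\<lambda>t. F (epath e t))" for S F
    unfolding edge_integral_def curve_integral_def epath_def[symmetric] esec_def[symmetric]
    by (simp add: ab(3) mult.commute)
  then show ?thesis using that[of "norm (b - a)"] ab(1) by simp
qed

context
  fixes e S c X
  assumes e: "e \<in> interior_edges D" and S: "open S"
    and c: "bddm (esec e S) (\<lambda>t. c (epath e t))"
    and X: "lop (S_h D p) dset (esec e UNIV) (\<lambda>u t. X u (epath e t))"
begin

lemma edge_lop_restrict: "lop (S_h D p) dset (esec e S) (\<lambda>u t. X u (epath e t))"
  by (rule lop_subset[OF X esec_mono[OF subset_UNIV] esec_measurable(1)[OF e S]])

lemma edge_form_psd:
  assumes nn: "\<And>x. x \<in> S \<inter> e \<Longrightarrow> 0 \<le> c x"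
  shows "psd_form (S_h D p) dset (\<lambda>u v. edge_integral e S (\<lambda>x. c x * (X u x * X v x)))"
proof -
  obtain l where l: "l > 0"
    "\<And>S F. edge_integral e S F = l * integral\<^sup>L (lebesgue_on (esec e S)) (\<lambda>t. F (epath e t))"
    using edge_integral_eq[OF e] by blast
  have "psd_form (S_h D p) dset (\<lambda>u v. integral\<^sup>L (lebesgue_on (esec e S))
      (\<lambda>t. c (epath e t) * (X u (epath e t) * X v (epath e t))))"
    by (rule psd_form_integral[OF lin_space_S_h edge_lop_restrict c]) (use nn in \<open>auto simp: esec_def\<close>)
  then show ?thesis unfolding l(2) using l(1) by (intro psd_form_cmult) auto
qed

lemma edge_form_zero:
  assumes pos: "\<And>x. x \<in> S \<inter> e \<Longrightarrow> 0 < c x" and u: "u \<in> S_h D p"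
    and z: "edge_integral e S (\<lambda>x. c x * (X u x * X u x)) = 0"
  shows "AE t in lebesgue_on (esec e S). X u (epath e t) = 0"
proof -
  obtain l where l: "l > 0"
    "\<And>S F. edge_integral e S F = l * integral\<^sup>L (lebesgue_on (esec e S)) (\<lambda>t. F (epath e t))"
    using edge_integral_eq[OF e] by blast
  have "integral\<^sup>L (lebesgue_on (esec e S)) (\<lambda>t. c (epath e t) * (X u (epath e t) * X u (epath e t))) = 0"
    using z l by simp
  then show ?thesis
    by (intro integral_square_zero[OF edge_lop_restrict c _ u]) (use pos in \<open>auto simp: esec_def\<close>)
qed

end

lemma bddm_beta_edge:
  assumes e: "e \<in> interior_edges D" and S: "open S"
  shows "bddm (esec e S) (\<lambda>t. beta D (epath e t))"
proof -
  have i: "bddm (esec e S) (\<lambda>t. if epath e t \<in> side D s then 1 else 0)" for s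
    by (rule bddm_preimage_open[OF esec_measurable(1)[OF e S] epath_continuous[OF e] side_open])
  \<comment> \<open>\<open>beta\<close> is its average plus corrections carried by the indicators of
    the two open sides.\<close>
  have "bddm (esec e S) (\<lambda>t. beta_avg D + ((if epath e t \<in> side D True then 1 else 0) * (betaP D - beta_avg D)
      + (if epath e t \<in> side D False then 1 else 0) * (betaM D - beta_avg D)))"
    by (rule bddm_add[OF bddm_const bddm_add[OF bddm_mult[OF i bddm_const] bddm_mult[OF i bddm_const]]])
  moreover have "beta_avg D + ((if x \<in> side D True then 1 else 0) * (betaP D - beta_avg D)
      + (if x \<in> side D False then 1 else 0) * (betaM D - beta_avg D)) = beta D x" for x
    using side_disjoint(1) by (auto simp: beta_def side_def)
  ultimately show ?thesis by simp
qed

subsection \<open>The interface\<close>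

definition gsec :: "pt set \<Rightarrow> real set" where
  "gsec T = {t \<in> {0..1}. curve D t \<in> T}"

lemma gsec_measurable:
  assumes "T \<in> mesh D" shows "gsec T \<in> sets lebesgue" "gsec T \<subseteq> {0..1}"
proof -
  show "gsec T \<in> sets lebesgue" unfolding gsec_def
    by (rule preimage_open_lebesgue[OF _ curve_continuous[OF C2] mesh_basic(1)[OF assms]]) simp
qed (auto simp: gsec_def)

lemma gsec_Gam: "t \<in> gsec T \<Longrightarrow> curve D t \<in> T \<and> curve D t \<in> Gam D"
  by (auto simp: gsec_def Gam_def path_image_def)

lemma interface_lop:
  assumes T: "T \<in> mesh D" and L: "diff_op p L"
  shows "lop (S_h D p) dset (gsec T) (\<lambda>u t. interface_jump D T (L u) (curve D t))"
proof (rule lop_cong[OF lin_space_S_h])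
  show "lop (S_h D p) dset (gsec T) (\<lambda>u t. L (piece_poly D p u T True) (curve D t) - L (piece_poly D p u T False) (curve D t))"
    by (intro lop_diff poly_lop[OF T L gsec_measurable[OF T] compact_Icc] curve_continuous[OF C2])
  show "AE t in lebesgue_on (gsec T). L (piece_poly D p u T True) (curve D t) - L (piece_poly D p u T False) (curve D t)
      = interface_jump D T (L u) (curve D t)" if "u \<in> S_h D p" for u
    using interface_jump_eq[OF that T L] gsec_Gam[of _ T] by (intro AE_I2) simp
qed

text \<open>The normal varies along the curve, so \<open>dn\<close> is not one fixed operator here.
  It is expanded in \<open>pd 1\<close> and \<open>pd 2\<close>, with the continuous components of
  the normal as weights.\<close>

lemma interface_lop_dn:
  assumes T: "T \<in> mesh D"
  shows "lop (S_h D p) dset (gsec T) (\<lambda>u t. interface_jump D T (dn (normal D (curve D t)) u) (curve D t))"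
proof (rule lop_cong[OF lin_space_S_h])
  note m = gsec_measurable[OF T]
  have b: "bddm (gsec T) (\<lambda>t. curve_normal D t $ i)" for i
    by (rule bddm_continuous[OF m compact_Icc]) (intro continuous_intros curve_normal_continuous[OF C2])
  show "lop (S_h D p) dset (gsec T) (\<lambda>u t. curve_normal D t $ 1 * interface_jump D T (pd 1 u) (curve D t)
      + curve_normal D t $ 2 * interface_jump D T (pd 2 u) (curve D t))"
    by (intro lop_add lop_mult b interface_lop[OF T diff_op_pd[OF diff_op_id]])
  show "AE t in lebesgue_on (gsec T). curve_normal D t $ 1 * interface_jump D T (pd 1 u) (curve D t)
      + curve_normal D t $ 2 * interface_jump D T (pd 2 u) (curve D t)
      = interface_jump D T (dn (normal D (curve D t)) u) (curve D t)" if u: "u \<in> S_h D p" for u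
  proof (rule AE_I2)
    fix t assume "t \<in> space (lebesgue_on (gsec T))"
    then have t: "t \<in> gsec T" by simp
    note j = interface_jump_eq[OF u T _ conjunct1[OF gsec_Gam[OF t]] conjunct2[OF gsec_Gam[OF t]]]
    have n: "normal D (curve D t) = curve_normal D t" using normal_curve[OF C2] t by (simp add: gsec_def)
    show "curve_normal D t $ 1 * interface_jump D T (pd 1 u) (curve D t)
      + curve_normal D t $ 2 * interface_jump D T (pd 2 u) (curve D t)
      = interface_jump D T (dn (normal D (curve D t)) u) (curve D t)"
      unfolding n j[OF diff_op_dn] j[OF diff_op_pd[OF diff_op_id]] unfolding dn_def sum_2
      by (simp add: algebra_simps)
  qed
qed

lemma bddm_curve_speed:
  assumes "T \<in> mesh D" shows "bddm (gsec T) (\<lambda>t. norm (vector_derivative (curve D) (at t)))"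
  by (rule bddm_continuous[OF gsec_measurable[OF assms] compact_Icc])
    (intro continuous_intros curve_derivative_continuous[OF C2])

lemma curve_integral_eq:
  "curve_integral (curve D) T (\<lambda>x. X u x * X v x)
   = integral\<^sup>L (lebesgue_on (gsec T)) (\<lambda>t. norm (vector_derivative (curve D) (at t)) * (X u (curve D t) * X v (curve D t)))"
  unfolding curve_integral_def gsec_def by (simp add: mult.commute)

lemma interface_form_psd:
  assumes T: "T \<in> mesh D" and X: "lop (S_h D p) dset (gsec T) (\<lambda>u t. X u (curve D t))"
  shows "psd_form (S_h D p) dset (\<lambda>u v. curve_integral (curve D) T (\<lambda>x. X u x * X v x))"
  unfolding curve_integral_eq
  by (rule psd_form_integral[OF lin_space_S_h X bddm_curve_speed[OF T]]) simp

lemma interface_form_zero: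
  assumes T: "T \<in> mesh D" and X: "lop (S_h D p) dset (gsec T) (\<lambda>u t. X u (curve D t))"
    and u: "u \<in> S_h D p" and z: "curve_integral (curve D) T (\<lambda>x. X u x * X u x) = 0"
  shows "AE t in lebesgue_on (gsec T). X u (curve D t) = 0"
  by (rule integral_square_zero[OF X bddm_curve_speed[OF T] _ u z[unfolded curve_integral_eq]])
    (simp add: curve_regular[OF C2])

subsection \<open>The elements\<close>

lemma mesh_lmeasurable: "T \<in> mesh D \<Longrightarrow> T \<in> lmeasurable"
  using mesh_basic(1,3) by (intro bounded_set_imp_lmeasurable) auto

lemma AE_in_piece:
  assumes "T \<in> mesh D" shows "AE x in lebesgue_on T. \<exists>s. x \<in> T \<inter> side D s"
proof -
  have "AE x in lebesgue. x \<notin> Gam D"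
    using Gam_negligible[OF C2] unfolding negligible_iff_null_sets by (rule AE_not_in)
  then have "AE x in lebesgue. x \<in> T \<longrightarrow> (\<exists>s. x \<in> T \<inter> side D s)"
  proof eventually_elim
    case (elim x)
    then show ?case using side_cases[of x] mesh_basic(6)[OF assms] by blast
  qed
  then show ?thesis using fmeasurableD[OF mesh_lmeasurable[OF assms]] by (simp add: AE_restrict_space_iff)
qed

text \<open>Off the interface, which is a null set, \<open>L u\<close> is \<open>L\<close> applied
  to the polynomial of one of the two pieces; the indicators of the sides glue these
  together.\<close>

lemma element_lop:
  assumes T: "T \<in> mesh D" and L: "diff_op p L"
  shows "lop (S_h D p) dset T L"
proof (rule lop_cong[OF lin_space_S_h])
  note m = fmeasurableD[OF mesh_lmeasurable[OF T]]
  have K: "T \<subseteq> closure T" "compact (closure T)"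
    using mesh_basic(3)[OF T] by (auto simp: closure_subset)
  let ?i = "\<lambda>s x. if x \<in> side D s then 1 else 0 :: real"
  have b: "bddm T (?i s)" for s
    by (rule bddm_preimage_open[OF m continuous_on_id side_open])
  have l: "lop (S_h D p) dset T (\<lambda>u x. L (piece_poly D p u T s) x)" for s
    by (rule poly_lop[OF T L m K continuous_on_id])
  show "lop (S_h D p) dset T (\<lambda>u x. ?i True x * L (piece_poly D p u T True) x + ?i False x * L (piece_poly D p u T False) x)"
    by (rule lop_add[OF lop_mult[OF b l] lop_mult[OF b l]])
  fix u assume u: "u \<in> S_h D p"
  from AE_in_piece[OF T]
  show "AE x in lebesgue_on T. ?i True x * L (piece_poly D p u T True) x + ?i False x * L (piece_poly D p u T False) x = L u x"
  proof eventually_elim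
    case (elim x)
    then obtain s where s: "x \<in> T \<inter> side D s" by blast
    have "x \<in> side D s' \<longleftrightarrow> s' = s" for s' using s side_unique by blast
    moreover have "L u x = L (piece_poly D p u T s) x"
      using diff_opD(1)[OF L open_piece[OF T], of s u "piece_poly D p u T s" x] piece_poly(2)[OF u T] s by blast
    ultimately show ?case by (cases s) auto
  qed
qed

lemma bddm_beta_element:
  assumes T: "T \<in> mesh D" shows "bddm T (beta D)"
proof -
  note m = fmeasurableD[OF mesh_lmeasurable[OF T]]
  have i: "bddm T (\<lambda>x. if x \<in> side D s then 1 else 0)" for s
    by (rule bddm_preimage_open[OF m continuous_on_id side_open])
  have "bddm T (\<lambda>x. beta_avg D + ((if x \<in> side D True then 1 else 0) * (betaP D - beta_avg D)
      + (if x \<in> side D False then 1 else 0) * (betaM D - beta_avg D)))"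
    by (rule bddm_add[OF bddm_const bddm_add[OF bddm_mult[OF i bddm_const] bddm_mult[OF i bddm_const]]])
  moreover have "beta_avg D + ((if x \<in> side D True then 1 else 0) * (betaP D - beta_avg D)
      + (if x \<in> side D False then 1 else 0) * (betaM D - beta_avg D)) = beta D x" for x
    using side_disjoint(1) by (auto simp: beta_def side_def)
  ultimately show ?thesis by simp
qed

end

section \<open>Coercivity\<close>

lemma psd_form_cong:
  assumes "lin_space V" "psd_form V I B" "\<And>u v. u \<in> V \<Longrightarrow> v \<in> V \<Longrightarrow> B u v = C u v"
  shows "psd_form V I C"
proof -
  note b = psd_formD[OF assms(2)]
  have V: "fadd u c v \<in> V" if "u \<in> V" "v \<in> V" for u v c using assms(1) that by (simp add: lin_space_def)
  have "bilin V I C"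
  proof (rule bilinI)
    show "C (fadd u c v) w = C u w + c * C v w" "C w (fadd u c v) = C w u + c * C w v"
      if "u \<in> V" "v \<in> V" "w \<in> V" for u v w c
      using bilinD[OF b(1) that] assms(3) V that by metis+
    show "C u v = 0" "C v u = 0" if "u \<in> V" "v \<in> V" "\<And>i. i \<in> I \<Longrightarrow> u i = 0" for u v
      using bilin_zero[OF b(1) that] assms(3) that by metis+
  qed
  then show ?thesis
  proof (rule psd_formI)
    show "C u v = C v u" if "u \<in> V" "v \<in> V" for u v
      using b(2)[OF that] assms(3)[OF that] assms(3)[OF that(2,1)] by simp
    show "0 \<le> C u u" if "u \<in> V" for u using b(3)[OF that] assms(3)[OF that that] by simp
  qed
qed

lemma psd_form_sum_zero:
  assumes "finite A" "\<And>a. a \<in> A \<Longrightarrow> psd_form V I (B a)" "u \<in> V" "(\<Sum>a\<in>A. B a u u) = 0" "a \<in> A"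
  shows "B a u u = 0"
  using assms sum_nonneg_eq_0_iff[of A "\<lambda>a. B a u u"] psd_formD(3) by metis

lemma diameter_pos:
  fixes S :: "'a :: metric_space set"
  assumes "bounded S" "x \<in> S" "y \<in> S" "x \<noteq> y" shows "0 < diameter S"
  using diameter_bounded_bound[OF assms(1-3)] assms(4) by (metis less_le_trans zero_less_dist_iff)

lemma edge_integral_cmult: "edge_integral e S (\<lambda>x. k * F x) = k * edge_integral e S F"
  unfolding edge_integral_def curve_integral_def by (simp add: mult.assoc)

lemma AE_lebesgue_on_of_AE:
  assumes "S \<in> sets lebesgue" "AE x in lebesgue. P x" shows "AE x in lebesgue_on S. P x"
proof -
  have "AE x in lebesgue. x \<in> S \<longrightarrow> P x" using assms(2) by eventually_elim simp
  then show ?thesis using assms(1) by (simp add: AE_restrict_space_iff)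
qed

context ife_problem
begin

section \<open>The penalty terms and the vanishing of normal derivative jumps\<close>

abbreviation IE where "IE \<equiv> interior_edges D"

abbreviation jn :: "pt set \<Rightarrow> (pt \<Rightarrow> real) \<Rightarrow> pt \<Rightarrow> real" where
  "jn e u \<equiv> edge_jump D e (dn (edge_normal D e) u)"

abbreviation an :: "pt set \<Rightarrow> (pt \<Rightarrow> real) \<Rightarrow> pt \<Rightarrow> real" where
  "an e u \<equiv> edge_avg D e (\<lambda>y. beta D y * dnn (edge_normal D e) u y)"

definition cons_form :: "(pt \<Rightarrow> real) \<Rightarrow> (pt \<Rightarrow> real) \<Rightarrow> real" where
  "cons_form u v = (\<Sum>e\<in>IE. edge_integral e UNIV (\<lambda>x. an e u x * jn e v x))"

text \<open>The penalties are stripped of \<open>\<sigma>u\<close>, so that \<open>J_hu_eq\<close>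
  exhibits it as a factor and the comparison constants do not depend on it.\<close>

definition pen1 where
  "pen1 e u v = edge_integral e UNIV (\<lambda>x. beta D x / diameter e * (jn e u x * jn e v x))"

definition pen2 where
  "pen2 e s u v = beta_side D s / len_side D e s * edge_integral e (side D s) (\<lambda>x. jn e u x * jn e v x)"

definition pen3 where
  "pen3 T u v = beta_avg D / diameter T * curve_integral (curve D) T
      (\<lambda>x. interface_jump D T (dn (normal D x) u) x * interface_jump D T (dn (normal D x) v) x)"

definition pen_form :: "(pt \<Rightarrow> real) \<Rightarrow> (pt \<Rightarrow> real) \<Rightarrow> real" where
  "pen_form u v = (\<Sum>e\<in>IE \<inter> noninterface_edges D. pen1 e u v)
     + (\<Sum>e\<in>IE \<inter> interface_edges D. \<Sum>s\<in>UNIV. pen2 e s u v)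
     + (\<Sum>T\<in>interface_elements D. pen3 T u v)"

lemma J_hu_eq: "J_hu D \<sigma> u v = - cons_form u v - cons_form v u + \<sigma> * pen_form u v"
proof -
  have 1: "edge_integral e UNIV (\<lambda>x. \<sigma> * beta D x / diameter e * (jn e u x * jn e v x)) = \<sigma> * pen1 e u v" for e
    unfolding pen1_def edge_integral_cmult[symmetric] by (simp add: mult.assoc times_divide_eq_right)
  have 2: "\<sigma> * beta_side D s / len_side D e s * edge_integral e (side D s) (\<lambda>x. jn e u x * jn e v x) = \<sigma> * pen2 e s u v" for e s
    unfolding pen2_def by simp
  have 3: "\<sigma> * beta_avg D / diameter T * curve_integral (curve D) T
      (\<lambda>x. interface_jump D T (dn (normal D x) u) x * interface_jump D T (dn (normal D x) v) x) = \<sigma> * pen3 T u v" for T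
    unfolding pen3_def by simp
  show ?thesis
    unfolding J_hu_def cons_form_def pen_form_def 1 2 3 by (simp add: sum_distrib_left algebra_simps)
qed

lemma finite_index:
  "finite IE" "finite (IE \<inter> B)" "finite (interface_elements D)"
  using finite_edges interior_edges_subset finite_mesh unfolding interface_elements_def
  by (auto intro: finite_subset)

lemma interface_element_mesh: "T \<in> interface_elements D \<Longrightarrow> T \<in> mesh D"
  by (simp add: interface_elements_def)

lemma diameter_edge: assumes "e \<in> IE" shows "0 < diameter e"
proof -
  obtain a b where ab: "a \<noteq> b" "e = open_segment a b" "epath e = linepath a b"
    using interior_edge_path[OF assms] .
  have "linepath a b (1/2) \<in> e" "linepath a b (1/4) \<in> e"
    unfolding ab(2) linepath_mem_open_segment[OF ab(1)] by simp_all
  moreover have "linepath a b (1/2) \<noteq> linepath a b (1/4)" using linepath_cong_iff[OF ab(1)] by simp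
  moreover have "bounded e" unfolding ab(2)
    by (rule bounded_subset[OF bounded_closed_segment segment_open_subset_closed])
  ultimately show ?thesis using diameter_pos by blast
qed

lemma diameter_element: assumes "T \<in> mesh D" shows "0 < diameter T"
proof -
  obtain x where x: "x \<in> T" using mesh_basic(4)[OF assms] by blast
  have "T \<noteq> {x}" using mesh_basic(1)[OF assms] not_open_singleton[of x] by auto
  then obtain y where "y \<in> T" "y \<noteq> x" using x by blast
  then show ?thesis using diameter_pos[OF mesh_basic(3)[OF assms]] x by blast
qed

lemma len_side_nonneg: assumes "e \<in> IE" shows "0 \<le> len_side D e s"
proof -
  obtain l where l: "l > 0"
    "\<And>S F. edge_integral e S F = l * integral\<^sup>L (lebesgue_on (esec e S)) (\<lambda>t. F (epath e t))"
    using edge_integral_eq[OF assms] by blast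
  then show ?thesis unfolding len_side_def by simp
qed

text \<open>A section of length zero is a null set. This covers the case in which
  \<open>pen2\<close> divides by zero and carries no information.\<close>

lemma len_side_zero:
  assumes e: "e \<in> IE" and "len_side D e s = 0" shows "AE t in lebesgue_on (esec e (side D s)). P t"
proof -
  note m = esec_measurable[OF e side_open, of s]
  have lm: "esec e (side D s) \<in> lmeasurable" by (rule lmeasurable_of_subset[OF m])
  obtain l where l: "l > 0"
    "\<And>S F. edge_integral e S F = l * integral\<^sup>L (lebesgue_on (esec e S)) (\<lambda>t. F (epath e t))"
    using edge_integral_eq[OF e] by blast
  have "integral\<^sup>L (lebesgue_on (esec e (side D s))) (\<lambda>t. 1 :: real) = 0"
    using assms(2) l unfolding len_side_def by simp
  then have "(AE t in lebesgue_on (esec e (side D s)). (1::real) = 0)"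
    using integral_nonneg_eq_0_iff_AE[of "lebesgue_on (esec e (side D s))" "\<lambda>t. 1::real"]
      bddm_integrable[OF bddm_const lm, of 1] by simp
  then show ?thesis by eventually_elim simp
qed

lemmas jn_lop = edge_lop(1)[OF _ diff_op_dn]
lemmas an_lop = edge_lop(2)[OF _ diff_op_dnn]

lemma pen1_psd: "e \<in> IE \<Longrightarrow> psd_form (S_h D p) dset (pen1 e)"
  unfolding pen1_def[abs_def]
  by (rule edge_form_psd[OF _ open_UNIV _ jn_lop])
    (auto simp: divide_inverse less_imp_le beta_positive diameter_edge intro!: bddm_mult bddm_beta_edge bddm_const)

lemma pen2_psd: "e \<in> IE \<Longrightarrow> psd_form (S_h D p) dset (pen2 e s)"
  unfolding pen2_def[abs_def]
proof (rule psd_form_cmult)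
  assume e: "e \<in> IE"
  show "0 \<le> beta_side D s / len_side D e s" using beta_side_pos len_side_nonneg[OF e] by (simp add: less_imp_le)
  show "psd_form (S_h D p) dset (\<lambda>u v. edge_integral e (side D s) (\<lambda>x. jn e u x * jn e v x))"
    using edge_form_psd[OF e side_open _ jn_lop[OF e], of s "\<lambda>x. 1"] by (simp add: bddm_const)
qed

lemma pen3_psd: "T \<in> mesh D \<Longrightarrow> psd_form (S_h D p) dset (pen3 T)"
  unfolding pen3_def[abs_def]
  by (intro psd_form_cmult interface_form_psd interface_lop_dn)
    (auto simp: less_imp_le beta_avg_pos diameter_element)

lemma pen_psd_parts:
  "psd_form (S_h D p) dset (\<lambda>u v. \<Sum>e\<in>IE \<inter> noninterface_edges D. pen1 e u v)"
  "psd_form (S_h D p) dset (\<lambda>u v. \<Sum>e\<in>IE \<inter> interface_edges D. \<Sum>s\<in>UNIV. pen2 e s u v)"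
  "psd_form (S_h D p) dset (\<lambda>u v. \<Sum>T\<in>interface_elements D. pen3 T u v)"
  by (auto intro!: psd_form_sum pen1_psd pen2_psd pen3_psd interface_element_mesh)

lemma pen_psd: "psd_form (S_h D p) dset pen_form"
  unfolding pen_form_def[abs_def] by (intro psd_form_add pen_psd_parts)

lemma pen_zero:
  assumes u: "u \<in> S_h D p" and z: "pen_form u u = 0"
  shows "e \<in> IE \<inter> noninterface_edges D \<Longrightarrow> pen1 e u u = 0"
    "e \<in> IE \<inter> interface_edges D \<Longrightarrow> pen2 e s u u = 0"
    "T \<in> interface_elements D \<Longrightarrow> pen3 T u u = 0"
proof -
  have z3: "(\<Sum>e\<in>IE \<inter> noninterface_edges D. pen1 e u u) = 0"
    "(\<Sum>e\<in>IE \<inter> interface_edges D. \<Sum>s\<in>UNIV. pen2 e s u u) = 0"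
    "(\<Sum>T\<in>interface_elements D. pen3 T u u) = 0"
    using z psd_formD(3)[OF pen_psd_parts(1) u] psd_formD(3)[OF pen_psd_parts(2) u]
      psd_formD(3)[OF pen_psd_parts(3) u] unfolding pen_form_def by linarith+
  show "pen1 e u u = 0" if "e \<in> IE \<inter> noninterface_edges D"
    by (rule psd_form_sum_zero[where I = dset and B = pen1, OF finite_index(2) _ u z3(1) that]) (auto intro: pen1_psd)
  show "pen2 e s u u = 0" if e: "e \<in> IE \<inter> interface_edges D"
  proof -
    have "(\<Sum>s\<in>UNIV. pen2 e s u u) = 0"
      by (rule psd_form_sum_zero[where I = dset and B = "\<lambda>e u v. \<Sum>s\<in>UNIV. pen2 e s u v", OF finite_index(2) _ u z3(2) e]) (auto intro!: psd_form_sum pen2_psd)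
    from psd_form_sum_zero[where I = dset and B = "pen2 e", OF finite _ u this UNIV_I] pen2_psd e
    show ?thesis by blast
  qed
  show "pen3 T u u = 0" if "T \<in> interface_elements D"
    by (rule psd_form_sum_zero[where I = dset and B = pen3, OF finite_index(3) _ u z3(3) that]) (auto intro: pen3_psd interface_element_mesh)
qed

text \<open>On a cut edge the penalty controls the jump on the two sides separately; they cover the
  edge up to the single intersection point.\<close>

lemma edge_jump_dn_zero:
  assumes u: "u \<in> S_h D p" and z: "pen_form u u = 0" and e: "e \<in> IE"
  shows "AE t in lebesgue_on (esec e UNIV). jn e u (epath e t) = 0"
proof (cases "e \<in> interface_edges D")
  case False
  then have "pen1 e u u = 0"
    using pen_zero(1)[OF u z] e interior_edges_subset by (auto simp: noninterface_edges_def)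
  then show ?thesis unfolding pen1_def
    by (intro edge_form_zero[OF e open_UNIV _ jn_lop[OF e] _ u])
      (auto simp: divide_inverse beta_positive diameter_edge[OF e] intro!: bddm_mult bddm_beta_edge[OF e] bddm_const)
next
  case True
  have s: "AE t in lebesgue_on (esec e (side D s)). jn e u (epath e t) = 0" for s
  proof (cases "len_side D e s = 0")
    case False
    have "pen2 e s u u = 0" using pen_zero(2)[OF u z] e True by blast
    then have "edge_integral e (side D s) (\<lambda>x. 1 * (jn e u x * jn e u x)) = 0"
      using False beta_side_pos[of s] unfolding pen2_def by simp
    then show ?thesis
      by (intro edge_form_zero[OF e side_open _ jn_lop[OF e] _ u, where c = "\<lambda>x. 1"]) (auto intro: bddm_const)
  qed (rule len_side_zero[OF e])
  have "\<not> e \<subseteq> Gam D" "e \<in> edges D" using True by (simp_all add: interface_edges_def)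
  then obtain x0 where x0: "Gam D \<inter> e \<subseteq> {x0}" using edge_cut by blast
  have "AE t in lebesgue_on (esec e UNIV). epath e t \<in> e - {x0}"
    by (rule epath_AE_notin[OF e open_UNIV]) simp
  moreover have "AE t in lebesgue. t \<in> esec e (side D s) \<longrightarrow> jn e u (epath e t) = 0" for s
    using s[of s] esec_measurable(1)[OF e side_open] by (simp add: AE_restrict_space_iff)
  then have "AE t in lebesgue_on (esec e UNIV). t \<in> esec e (side D s) \<longrightarrow> jn e u (epath e t) = 0" for s
    by (rule AE_lebesgue_on_of_AE[OF esec_measurable(1)[OF e open_UNIV]])
  from this[of True] this[of False]
  have "AE t in lebesgue_on (esec e UNIV). (t \<in> esec e (side D True) \<longrightarrow> jn e u (epath e t) = 0) \<and>
     (t \<in> esec e (side D False) \<longrightarrow> jn e u (epath e t) = 0)" by eventually_elim simp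
  moreover have "AE t in lebesgue_on (esec e UNIV). t \<in> esec e UNIV" by (rule AE_I2) simp
  ultimately show ?thesis
  proof eventually_elim
    case (elim t)
    have "epath e t \<in> Om D" using elim(1) interior_edge_subset_Om[OF e] by blast
    moreover have "epath e t \<notin> Gam D" using elim(1) x0 by blast
    ultimately obtain s where "epath e t \<in> side D s" using side_cases by blast
    then have "t \<in> esec e (side D s)" using elim(1,3) by (auto simp: esec_def)
    then show ?case using elim(2) by (cases s) auto
  qed
qed

subsection \<open>The element terms\<close>

text \<open>One second derivative on one element: \<open>A_h\<close> becomes a sum of weighted
  squares, the shape that \<open>psd_form_integral\<close> requires.\<close>

definition Ael where
  "Ael T i j u v = integral\<^sup>L (lebesgue_on T) (\<lambda>x. beta D x * (pd i (pd j u) x * pd i (pd j v) x))"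

lemma hess_lop: "T \<in> mesh D \<Longrightarrow> lop (S_h D p) dset T (\<lambda>u. pd i (pd j u))"
  by (rule element_lop, assumption, intro diff_op_pd diff_op_id)

lemma Ael_psd: "T \<in> mesh D \<Longrightarrow> psd_form (S_h D p) dset (Ael T i j)"
  unfolding Ael_def[abs_def]
  by (rule psd_form_integral[OF lin_space_S_h hess_lop bddm_beta_element]) (auto simp: beta_positive less_imp_le)

lemma A_h_eq:
  assumes "u \<in> S_h D p" "v \<in> S_h D p"
  shows "A_h D u v = (\<Sum>T\<in>mesh D. \<Sum>i\<in>UNIV. \<Sum>j\<in>UNIV. Ael T i j u v)"
  unfolding A_h_def
proof (rule sum.cong[OF refl])
  fix T assume T: "T \<in> mesh D"
  note int = lop_integrable[OF hess_lop[OF T] hess_lop[OF T] bddm_beta_element[OF T] assms]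
  have "integral\<^sup>L (lebesgue_on T) (\<lambda>x. beta D x * hess_prod u v x)
      = integral\<^sup>L (lebesgue_on T) (\<lambda>x. \<Sum>i\<in>UNIV. \<Sum>j\<in>UNIV. beta D x * (pd i (pd j u) x * pd i (pd j v) x))"
    by (simp add: hess_prod_def sum_distrib_left)
  also have "\<dots> = (\<Sum>i\<in>UNIV. \<Sum>j\<in>UNIV. Ael T i j u v)"
    unfolding Ael_def using int by (subst Bochner_Integration.integral_sum;
        (subst Bochner_Integration.integral_sum)?; auto intro!: Bochner_Integration.integrable_sum)
  finally show "integral\<^sup>L (lebesgue_on T) (\<lambda>x. beta D x * hess_prod u v x) = (\<Sum>i\<in>UNIV. \<Sum>j\<in>UNIV. Ael T i j u v)" .
qed

lemma A_h_psd: "psd_form (S_h D p) dset (A_h D)"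
proof (rule psd_form_cong[OF lin_space_S_h])
  show "psd_form (S_h D p) dset (\<lambda>u v. \<Sum>T\<in>mesh D. \<Sum>i\<in>UNIV. \<Sum>j\<in>UNIV. Ael T i j u v)"
    by (intro psd_form_sum Ael_psd)
qed (simp add: A_h_eq)

text \<open>The summands of \<open>A_h\<close> are nonnegative, so each vanishes. A second
  derivative is then zero almost everywhere on the piece, everywhere there by continuity, and
  identically as a polynomial.\<close>

lemma A_h_zero:
  assumes u: "u \<in> S_h D p" and z: "A_h D u u = 0" and T: "T \<in> mesh D"
  shows "pd i (pd j (piece_poly D p u T s)) x = 0"
proof (cases "T \<inter> side D s = {}")
  case True
  have L: "diff_op p (\<lambda>u. pd i (pd j u))" by (intro diff_op_pd diff_op_id)
  show ?thesis using diff_op_zero[OF L] True by (simp add: piece_poly_def)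
next
  case False
  let ?q = "piece_poly D p u T s"
  have L: "diff_op p (\<lambda>u. pd i (pd j u))" by (intro diff_op_pd diff_op_id)
  have "(\<Sum>T\<in>mesh D. \<Sum>i\<in>UNIV. \<Sum>j\<in>UNIV. Ael T i j u u) = 0" using z A_h_eq[OF u u] by simp
  from psd_form_sum_zero[where I = dset and B = "\<lambda>T u v. \<Sum>i\<in>UNIV. \<Sum>j\<in>UNIV. Ael T i j u v", OF finite_mesh _ u this T]
  have "(\<Sum>i\<in>UNIV. \<Sum>j\<in>UNIV. Ael T i j u u) = 0" by (simp add: psd_form_sum Ael_psd)
  from psd_form_sum_zero[where I = dset and B = "\<lambda>i u v. \<Sum>j\<in>UNIV. Ael T i j u v", OF finite _ u this UNIV_I]
  have "(\<Sum>j\<in>UNIV. Ael T i j u u) = 0" by (simp add: psd_form_sum Ael_psd T)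
  from psd_form_sum_zero[where I = dset and B = "Ael T i", OF finite _ u this UNIV_I]
  have "Ael T i j u u = 0" by (simp add: Ael_psd T)
  then have ae: "AE x in lebesgue_on T. pd i (pd j u) x = 0" unfolding Ael_def
    by (intro integral_square_zero[OF hess_lop[OF T] bddm_beta_element[OF T] beta_positive u])
  have eq: "pd i (pd j u) y = pd i (pd j ?q) y" if y: "y \<in> T \<inter> side D s" for y
    using diff_opD(1)[OF L open_piece[OF T], of s u ?q y] piece_poly(2)[OF u T] y by blast
  have "AE y in lebesgue_on (T \<inter> side D s). pd i (pd j u) y = 0"
    by (rule AE_lebesgue_on_subset[OF _ _ _ ae])
      (use open_piece[OF T, of s] mesh_basic(1)[OF T] in auto)
  moreover have "AE y in lebesgue_on (T \<inter> side D s). y \<in> T \<inter> side D s" by (rule AE_I2) simp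
  ultimately have ae': "AE y in lebesgue_on (T \<inter> side D s). pd i (pd j ?q) y = 0"
    by eventually_elim (simp add: eq)
  have q: "pd i (pd j ?q) \<in> polys p" by (intro polys_pd piece_poly(1)[OF u T])
  have "pd i (pd j ?q) y = 0" if "y \<in> T \<inter> side D s" for y
    by (rule zero_on_open_of_AE[OF open_piece[OF T] subset_refl _ polys_continuous[OF q] ae' that])
      (use open_piece[OF T, of s] in auto)
  then show ?thesis by (rule polys_zero_of_open[OF open_piece[OF T] False q])
qed

subsection \<open>The stabilization terms\<close>

definition stab1 where
  "stab1 e s u v = edge_integral e (side D s)
     (\<lambda>x. edge_jump D e (dnn (edge_normal D e) u) x * edge_jump D e (dnn (edge_normal D e) v) x)"

definition stab3 where
  "stab3 e u v = edge_integral e UNIV (\<lambda>x. edge_jump D e u x * edge_jump D e v x)"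

definition stab4 where
  "stab4 T u v = curve_integral (curve D) T (\<lambda>x. interface_jump D T u x * interface_jump D T v x)"

lemmas dnn_lop = edge_lop(1)[OF _ diff_op_dnn]
lemmas id_lop = edge_lop(1)[OF _ diff_op_id]

lemma stab1_psd: "e \<in> IE \<Longrightarrow> psd_form (S_h D p) dset (stab1 e s)"
  unfolding stab1_def[abs_def]
  using edge_form_psd[OF _ side_open _ dnn_lop, of e s "\<lambda>x. 1"] by (simp add: bddm_const)

lemma stab3_psd: "e \<in> IE \<Longrightarrow> psd_form (S_h D p) dset (stab3 e)"
  unfolding stab3_def[abs_def]
  using edge_form_psd[OF _ open_UNIV _ id_lop, of e "\<lambda>x. 1"] by (simp add: bddm_const)

lemma stab4_psd: "T \<in> mesh D \<Longrightarrow> psd_form (S_h D p) dset (stab4 T)"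
  unfolding stab4_def[abs_def] by (rule interface_form_psd[OF _ interface_lop[OF _ diff_op_id]])

context
  fixes \<sigma>F \<sigma>n :: real assumes \<sigma>: "0 < \<sigma>F" "0 < \<sigma>n"
begin

lemma J_hn_psd_parts:
  "psd_form (S_h D p) dset (\<lambda>u v. \<Sum>e\<in>IE \<inter> interface_edges D. \<Sum>s\<in>UNIV.
     \<sigma>F * len_side D e s * beta_side D s * stab1 e s u v)"
  "psd_form (S_h D p) dset (\<lambda>u v. \<Sum>e\<in>IE \<inter> noninterface_edges D \<inter> edges_of_interface_elements D.
     edge_integral e UNIV (\<lambda>x. \<sigma>F * diameter e * beta D x *
       (edge_jump D e (dnn (edge_normal D e) u) x * edge_jump D e (dnn (edge_normal D e) v) x)))"
  "psd_form (S_h D p) dset (\<lambda>u v. \<Sum>e\<in>IE \<inter> interface_edges D. \<sigma>n * beta_avg D / diameter e ^ 3 * stab3 e u v)"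
  "psd_form (S_h D p) dset (\<lambda>u v. \<Sum>T\<in>interface_elements D. \<sigma>n * beta_avg D / diameter T ^ 3 * stab4 T u v)"
proof -
  show "psd_form (S_h D p) dset (\<lambda>u v. \<Sum>e\<in>IE \<inter> interface_edges D. \<Sum>s\<in>UNIV.
     \<sigma>F * len_side D e s * beta_side D s * stab1 e s u v)"
    using \<sigma> beta_side_pos len_side_nonneg
    by (intro psd_form_sum psd_form_cmult stab1_psd) (auto simp: less_imp_le)
  show "psd_form (S_h D p) dset (\<lambda>u v. \<Sum>e\<in>IE \<inter> noninterface_edges D \<inter> edges_of_interface_elements D.
     edge_integral e UNIV (\<lambda>x. \<sigma>F * diameter e * beta D x *
       (edge_jump D e (dnn (edge_normal D e) u) x * edge_jump D e (dnn (edge_normal D e) v) x)))"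
  proof (rule psd_form_sum)
    fix e assume "e \<in> IE \<inter> noninterface_edges D \<inter> edges_of_interface_elements D"
    then have e: "e \<in> IE" by blast
    show "psd_form (S_h D p) dset (\<lambda>u v. edge_integral e UNIV (\<lambda>x. \<sigma>F * diameter e * beta D x *
       (edge_jump D e (dnn (edge_normal D e) u) x * edge_jump D e (dnn (edge_normal D e) v) x)))"
      by (rule edge_form_psd[OF e open_UNIV bddm_mult[OF bddm_const bddm_beta_edge[OF e open_UNIV]] dnn_lop[OF e]])
        (use \<sigma> diameter_edge[OF e] beta_positive in \<open>simp add: less_imp_le\<close>)
  qed
  show "psd_form (S_h D p) dset (\<lambda>u v. \<Sum>e\<in>IE \<inter> interface_edges D. \<sigma>n * beta_avg D / diameter e ^ 3 * stab3 e u v)"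
    using \<sigma> beta_avg_pos diameter_edge
    by (intro psd_form_sum psd_form_cmult stab3_psd) (auto simp: less_imp_le)
  show "psd_form (S_h D p) dset (\<lambda>u v. \<Sum>T\<in>interface_elements D. \<sigma>n * beta_avg D / diameter T ^ 3 * stab4 T u v)"
    using \<sigma> beta_avg_pos diameter_element interface_element_mesh
    by (intro psd_form_sum psd_form_cmult stab4_psd) (auto simp: less_imp_le)
qed

lemma J_hn_psd: "psd_form (S_h D p) dset (J_hn D \<sigma>F \<sigma>n)"
  unfolding J_hn_def[abs_def] stab1_def[symmetric] stab3_def[symmetric] stab4_def[symmetric]
  by (intro psd_form_add J_hn_psd_parts)

lemma J_hn_zero:
  assumes u: "u \<in> S_h D p" and z: "J_hn D \<sigma>F \<sigma>n u u = 0"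
  shows "e \<in> IE \<inter> interface_edges D \<Longrightarrow> AE t in lebesgue_on (esec e UNIV). edge_jump D e u (epath e t) = 0"
    "T \<in> interface_elements D \<Longrightarrow> AE t in lebesgue_on (gsec T). interface_jump D T u (curve D t) = 0"
proof -
  have z3: "(\<Sum>e\<in>IE \<inter> interface_edges D. \<sigma>n * beta_avg D / diameter e ^ 3 * stab3 e u u) = 0"
    and z4: "(\<Sum>T\<in>interface_elements D. \<sigma>n * beta_avg D / diameter T ^ 3 * stab4 T u u) = 0"
    using z psd_formD(3)[OF J_hn_psd_parts(1) u] psd_formD(3)[OF J_hn_psd_parts(2) u]
      psd_formD(3)[OF J_hn_psd_parts(3) u] psd_formD(3)[OF J_hn_psd_parts(4) u]
    unfolding J_hn_def stab1_def[symmetric] stab3_def[symmetric] stab4_def[symmetric] by linarith+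
  show "AE t in lebesgue_on (esec e UNIV). edge_jump D e u (epath e t) = 0" if e: "e \<in> IE \<inter> interface_edges D"
  proof -
    have e': "e \<in> IE" using e by blast
    have "\<sigma>n * beta_avg D / diameter e ^ 3 * stab3 e u u = 0"
      by (rule psd_form_sum_zero[where I = dset and B = "\<lambda>e u v. \<sigma>n * beta_avg D / diameter e ^ 3 * stab3 e u v",
            OF finite_index(2) _ u z3 e])
        (rule psd_form_cmult[OF stab3_psd]; use \<sigma> beta_avg_pos diameter_edge in \<open>simp add: less_imp_le\<close>)
    then have "edge_integral e UNIV (\<lambda>x. 1 * (edge_jump D e u x * edge_jump D e u x)) = 0"
      using \<sigma> beta_avg_pos diameter_edge[OF e'] by (simp add: stab3_def)
    then show ?thesis
      by (intro edge_form_zero[OF e' open_UNIV _ id_lop[OF e'] _ u, where c = "\<lambda>x. 1"]) (auto intro: bddm_const)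
  qed
  show "AE t in lebesgue_on (gsec T). interface_jump D T u (curve D t) = 0" if T: "T \<in> interface_elements D"
  proof -
    note T' = interface_element_mesh[OF T]
    have "\<sigma>n * beta_avg D / diameter T ^ 3 * stab4 T u u = 0"
      by (rule psd_form_sum_zero[where I = dset and B = "\<lambda>T u v. \<sigma>n * beta_avg D / diameter T ^ 3 * stab4 T u v",
            OF finite_index(3) _ u z4 T])
        (rule psd_form_cmult[OF stab4_psd]; use \<sigma> beta_avg_pos diameter_element interface_element_mesh in
          \<open>simp add: less_imp_le\<close>)
    then have "stab4 T u u = 0" using \<sigma> beta_avg_pos diameter_element[OF T'] by simp
    then show ?thesis unfolding stab4_def
      by (rule interface_form_zero[OF T' interface_lop[OF T' diff_op_id] u])
  qed
qed

end

lemma interface_jump_dn_zero: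
  assumes u: "u \<in> S_h D p" and z: "pen_form u u = 0" and T: "T \<in> interface_elements D"
  shows "AE t in lebesgue_on (gsec T). interface_jump D T (dn (normal D (curve D t)) u) (curve D t) = 0"
proof -
  note T' = interface_element_mesh[OF T]
  have "curve_integral (curve D) T
      (\<lambda>x. interface_jump D T (dn (normal D x) u) x * interface_jump D T (dn (normal D x) u) x) = 0"
    using pen_zero(3)[OF u z T] beta_avg_pos diameter_element[OF T'] by (simp add: pen3_def)
  then show ?thesis by (rule interface_form_zero[OF T' interface_lop_dn[OF T'] u])
qed

subsection \<open>The consistency terms\<close>

text \<open>With \<open>jump_form\<close>, the two squares that Young's inequality produces from the
  consistency term; the weight 1 fits the pattern of \<open>edge_form_psd\<close>.\<close>

definition avg_form where
  "avg_form u v = (\<Sum>e\<in>IE. edge_integral e UNIV (\<lambda>x. 1 * (an e u x * an e v x)))"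

definition jump_form where
  "jump_form u v = (\<Sum>e\<in>IE. edge_integral e UNIV (\<lambda>x. 1 * (jn e u x * jn e v x)))"

lemma avg_form_psd: "psd_form (S_h D p) dset avg_form"
  unfolding avg_form_def[abs_def]
  by (intro psd_form_sum edge_form_psd[OF _ open_UNIV bddm_const an_lop]) auto

lemma jump_form_psd: "psd_form (S_h D p) dset jump_form"
  unfolding jump_form_def[abs_def]
  by (intro psd_form_sum edge_form_psd[OF _ open_UNIV bddm_const jn_lop]) auto

lemma cons_form_bilin: "bilin (S_h D p) dset cons_form"
  unfolding cons_form_def[abs_def]
proof (rule bilin_sum)
  fix e assume e: "e \<in> IE"
  obtain l where l: "l > 0"
    "\<And>S F. edge_integral e S F = l * integral\<^sup>L (lebesgue_on (esec e S)) (\<lambda>t. F (epath e t))"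
    using edge_integral_eq[OF e] by blast
  have "bilin (S_h D p) dset (\<lambda>u v. integral\<^sup>L (lebesgue_on (esec e UNIV))
      (\<lambda>t. 1 * (an e u (epath e t) * jn e v (epath e t))))"
    by (rule bilin_integral[OF lin_space_S_h an_lop[OF e] jn_lop[OF e] bddm_const])
  then show "bilin (S_h D p) dset (\<lambda>u v. edge_integral e UNIV (\<lambda>x. an e u x * jn e v x))"
    unfolding l(2) by (intro bilin_cmult) simp
qed

lemma cons_form_young:
  assumes u: "u \<in> S_h D p" and t: "t > 0"
  shows "2 * cons_form u u \<le> t * avg_form u u + (1 / t) * jump_form u u"
proof -
  have "2 * edge_integral e UNIV (\<lambda>x. an e u x * jn e u x)
      \<le> t * edge_integral e UNIV (\<lambda>x. 1 * (an e u x * an e u x))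
        + (1 / t) * edge_integral e UNIV (\<lambda>x. 1 * (jn e u x * jn e u x))" if e: "e \<in> IE" for e
  proof -
    obtain l where l: "l > 0"
      "\<And>S F. edge_integral e S F = l * integral\<^sup>L (lebesgue_on (esec e S)) (\<lambda>t. F (epath e t))"
      using edge_integral_eq[OF e] by blast
    have "2 * integral\<^sup>L (lebesgue_on (esec e UNIV)) (\<lambda>s. 1 * (an e u (epath e s) * jn e u (epath e s)))
      \<le> t * integral\<^sup>L (lebesgue_on (esec e UNIV)) (\<lambda>s. 1 * (an e u (epath e s) * an e u (epath e s)))
        + (1 / t) * integral\<^sup>L (lebesgue_on (esec e UNIV)) (\<lambda>s. 1 * (jn e u (epath e s) * jn e u (epath e s)))"
      by (rule integral_young[OF an_lop[OF e] jn_lop[OF e] bddm_const _ u t]) simp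
    from mult_left_mono[OF this, of l] l(1) show ?thesis unfolding l(2) by (simp add: algebra_simps)
  qed
  from sum_mono[of IE, OF this] show ?thesis
    unfolding cons_form_def avg_form_def jump_form_def by (simp add: sum.distrib sum_distrib_left)
qed

text \<open>Zero energy means zero Hessians on all pieces, and at almost every edge point each
  adjacent element shows only one piece.\<close>

lemma avg_form_zero:
  assumes u: "u \<in> S_h D p" and z: "A_h D u u = 0" shows "avg_form u u = 0"
  unfolding avg_form_def
proof (rule sum.neutral, rule ballI)
  fix e assume e: "e \<in> IE"
  obtain l where l: "l > 0"
    "\<And>S F. edge_integral e S F = l * integral\<^sup>L (lebesgue_on (esec e S)) (\<lambda>t. F (epath e t))"
    using edge_integral_eq[OF e] by blast
  obtain T1 T2 where adj: "adjacent D e = (T1, T2)" by fastforce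
  note a = adjacent_props[OF e adj]
  have tr: "trace_from T (\<lambda>y. beta D y * dnn n u y) x = 0"
    if T: "T \<in> mesh D" and x: "x \<in> closure T" "sided D T s x" for T n x s
  proof -
    have "dnn n (piece_poly D p u T s) x = 0" by (simp add: dnn_def A_h_zero[OF u z T])
    then show ?thesis using trace_sided(2)[OF u T diff_op_dnn x] by simp
  qed
  have "AE t in lebesgue_on (esec e UNIV). an e u (epath e t) = 0"
    using edge_AE_sided[OF e a(1,4) open_UNIV] edge_AE_sided[OF e a(2,5) open_UNIV]
  proof eventually_elim
    case (elim t)
    then show ?case using tr[OF a(1)] tr[OF a(2)] by (auto simp: edge_avg_def adj)
  qed
  then have "integral\<^sup>L (lebesgue_on (esec e UNIV)) (\<lambda>t. 1 * (an e u (epath e t) * an e u (epath e t))) = 0"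
    by (intro integral_eq_zero_AE) (auto elim!: eventually_mono)
  then show "edge_integral e UNIV (\<lambda>x. 1 * (an e u x * an e u x)) = 0" unfolding l(2) by simp
qed

lemma jump_form_zero:
  assumes u: "u \<in> S_h D p" and z: "pen_form u u = 0" shows "jump_form u u = 0"
  unfolding jump_form_def
proof (rule sum.neutral, rule ballI)
  fix e assume e: "e \<in> IE"
  obtain l where l: "l > 0"
    "\<And>S F. edge_integral e S F = l * integral\<^sup>L (lebesgue_on (esec e S)) (\<lambda>t. F (epath e t))"
    using edge_integral_eq[OF e] by blast
  have "integral\<^sup>L (lebesgue_on (esec e UNIV)) (\<lambda>t. 1 * (jn e u (epath e t) * jn e u (epath e t))) = 0"
    using edge_jump_dn_zero[OF u z e] by (intro integral_eq_zero_AE) (auto elim!: eventually_mono)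
  then show "edge_integral e UNIV (\<lambda>x. 1 * (jn e u x * jn e u x)) = 0" unfolding l(2) by simp
qed

text \<open>The threshold for \<open>\<sigma>u\<close> may depend on the mesh, so compactness of the unit ball of the finite
  dimensional space, in the form of \<open>psd_form_comparison\<close>, replaces the inverse inequalities.\<close>

theorem coercivity:
  obtains \<sigma>0 where "\<sigma>0 > 0"
    "\<And>\<sigma>u \<sigma>F \<sigma>n. \<sigma>u \<ge> \<sigma>0 \<Longrightarrow> 0 < \<sigma>F \<Longrightarrow> 0 < \<sigma>n \<Longrightarrow> psd_form (S_h D p) dset (a_h D \<sigma>u \<sigma>F \<sigma>n)"
    "\<And>\<sigma>u \<sigma>F \<sigma>n u. \<sigma>u \<ge> \<sigma>0 \<Longrightarrow> 0 < \<sigma>F \<Longrightarrow> 0 < \<sigma>n \<Longrightarrow> u \<in> S_h D p \<Longrightarrow> a_h D \<sigma>u \<sigma>F \<sigma>n u u = 0 \<Longrightarrow>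
       A_h D u u = 0 \<and> pen_form u u = 0 \<and> J_hn D \<sigma>F \<sigma>n u u = 0"
proof -
  obtain C1 where C1: "C1 \<ge> 0" "\<And>u. u \<in> S_h D p \<Longrightarrow> avg_form u u \<le> C1 * A_h D u u"
    using psd_form_comparison[OF dset(1) lin_space_S_h A_h_psd avg_form_psd] avg_form_zero by blast
  obtain C2 where C2: "C2 \<ge> 0" "\<And>u. u \<in> S_h D p \<Longrightarrow> jump_form u u \<le> C2 * pen_form u u"
    using psd_form_comparison[OF dset(1) lin_space_S_h pen_psd jump_form_psd] jump_form_zero by blast
  \<comment> \<open>Gives \<open>t * C1 \<le> 1/2\<close>, so that Young's inequality consumes at
    most half of \<open>A_h\<close>; the 1 added to \<open>C1\<close> avoids division by
    zero.\<close>
  define t where "t = 1 / (2 * (C1 + 1))"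
  have t: "t > 0" "t * C1 \<le> 1/2" using C1(1) by (simp_all add: t_def field_simps)
  \<comment> \<open>\<open>C2 / t\<close> pays for the jump part of Young's inequality; the extra 1
    leaves one full copy of \<open>pen_form\<close>, from which its vanishing on the kernel is read
    off.\<close>
  define \<sigma>0 where "\<sigma>0 = C2 / t + 1"
  have bound: "A_h D u u / 2 + pen_form u u + J_hn D \<sigma>F \<sigma>n u u \<le> a_h D \<sigma>u \<sigma>F \<sigma>n u u"
    if "\<sigma>u \<ge> \<sigma>0" and u: "u \<in> S_h D p" for \<sigma>u \<sigma>F \<sigma>n u
  proof -
    note A = psd_formD(3)[OF A_h_psd u] and P = psd_formD(3)[OF pen_psd u]
    have "2 * cons_form u u \<le> t * avg_form u u + (1 / t) * jump_form u u" by (rule cons_form_young[OF u t(1)])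
    also have "t * avg_form u u \<le> t * (C1 * A_h D u u)" using C1(2)[OF u] t(1) by simp
    also have "t * (C1 * A_h D u u) \<le> (1/2) * A_h D u u"
      using mult_right_mono[OF t(2) A] by (simp add: mult.assoc)
    also have "(1 / t) * jump_form u u \<le> (1 / t) * (C2 * pen_form u u)"
      by (rule mult_left_mono[OF C2(2)[OF u]]) (use t(1) in simp)
    also have "(1 / t) * (C2 * pen_form u u) = (\<sigma>0 - 1) * pen_form u u" by (simp add: \<sigma>0_def)
    also have "(\<sigma>0 - 1) * pen_form u u \<le> (\<sigma>u - 1) * pen_form u u"
      using that P by (intro mult_right_mono) auto
    finally show ?thesis unfolding a_h_def J_hu_eq by (simp add: algebra_simps)
  qed
  show ?thesis
  proof (rule that[of \<sigma>0])
    show "\<sigma>0 > 0" using C2(1) t(1) by (simp add: \<sigma>0_def add_nonneg_pos)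
    fix \<sigma>u \<sigma>F \<sigma>n :: real assume s: "\<sigma>u \<ge> \<sigma>0" "0 < \<sigma>F" "0 < \<sigma>n"
    note H = J_hn_psd[OF s(2,3)]
    have eq: "a_h D \<sigma>u \<sigma>F \<sigma>n = (\<lambda>u v. A_h D u v + (((-1) * cons_form u v + (-1) * cons_form v u) + \<sigma>u * pen_form u v)
        + J_hn D \<sigma>F \<sigma>n u v)"
      unfolding a_h_def[abs_def] J_hu_eq by (simp add: fun_eq_iff)
    show "psd_form (S_h D p) dset (a_h D \<sigma>u \<sigma>F \<sigma>n)"
    proof (rule psd_formI)
      show "bilin (S_h D p) dset (a_h D \<sigma>u \<sigma>F \<sigma>n)" unfolding eq
        by (intro bilin_add bilin_cmult cons_form_bilin bilin_swap[OF cons_form_bilin]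
            psd_formD(1)[OF A_h_psd] psd_formD(1)[OF pen_psd] psd_formD(1)[OF H])
      show "a_h D \<sigma>u \<sigma>F \<sigma>n u v = a_h D \<sigma>u \<sigma>F \<sigma>n v u" if "u \<in> S_h D p" "v \<in> S_h D p" for u v
        unfolding eq using psd_formD(2)[OF A_h_psd that] psd_formD(2)[OF pen_psd that] psd_formD(2)[OF H that] by simp
      show "0 \<le> a_h D \<sigma>u \<sigma>F \<sigma>n u u" if u: "u \<in> S_h D p" for u
        using bound[OF s(1) u, of \<sigma>F \<sigma>n] psd_formD(3)[OF A_h_psd u] psd_formD(3)[OF pen_psd u] psd_formD(3)[OF H u] by linarith
    qed
    fix u assume u: "u \<in> S_h D p" and z: "a_h D \<sigma>u \<sigma>F \<sigma>n u u = 0"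
    show "A_h D u u = 0 \<and> pen_form u u = 0 \<and> J_hn D \<sigma>F \<sigma>n u u = 0"
      using bound[OF s(1) u, of \<sigma>F \<sigma>n] z psd_formD(3)[OF A_h_psd u] psd_formD(3)[OF pen_psd u] psd_formD(3)[OF H u] by linarith
  qed
qed

end

section \<open>The kernel of the bilinear form\<close>

lemma pd_affine: "pd i (\<lambda>x. k \<bullet> x + d) x = k $ i"
proof -
  have "((\<lambda>x. k \<bullet> x + d) has_derivative (\<lambda>h. k \<bullet> h)) (at x)"
    by (auto intro!: derivative_eq_intros)
  from frechet_derivative_at[OF this] show ?thesis
    unfolding pd_def by (metis inner_axis inner_real_def mult.right_neutral)
qed

lemma dn_affine: "dn n (\<lambda>x. k \<bullet> x + d) x = n \<bullet> k"
  unfolding dn_def pd_affine by (simp add: inner_vec_def)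

text \<open>\<open>n\<close> and \<open>w\<close> form an orthogonal basis of the plane; the two
  identities are the coordinates of |n|^2 |w|^2 k.\<close>

lemma orthogonal_pair_zero:
  fixes k n w :: pt
  assumes "n \<bullet> k = 0" "w \<bullet> k = 0" "n \<bullet> w = 0" "n \<noteq> 0" "w \<noteq> 0" shows "k = 0"
proof -
  have e: "n $ 1 * k $ 1 + n $ 2 * k $ 2 = 0" "w $ 1 * k $ 1 + w $ 2 * k $ 2 = 0"
    "n $ 1 * w $ 1 + n $ 2 * w $ 2 = 0"
    using assms(1-3) by (simp_all add: inner_vec_def sum_2)
  have n: "n $ 1 * n $ 1 + n $ 2 * n $ 2 > 0" and w: "w $ 1 * w $ 1 + w $ 2 * w $ 2 > 0"
    using assms(4,5) inner_gt_zero_iff[of n] inner_gt_zero_iff[of w] by (simp_all add: inner_vec_def sum_2)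
  have "(n $ 1 * n $ 1 + n $ 2 * n $ 2) * (w $ 1 * w $ 1 + w $ 2 * w $ 2) * k $ 1 = 0"
    "(n $ 1 * n $ 1 + n $ 2 * n $ 2) * (w $ 1 * w $ 1 + w $ 2 * w $ 2) * k $ 2 = 0"
    using e by algebra+
  then have "k $ 1 = 0" "k $ 2 = 0" using mult_pos_pos[OF n w] by (metis less_irrefl mult_eq_0_iff)+
  then show ?thesis by (simp add: vec_eq_iff forall_2)
qed

context ife_problem
begin

text \<open>\<open>J_hn\<close> does not penalize the jump of \<open>u\<close> on these edges; there
  the space itself enforces continuity, and both traces equal the value of \<open>u\<close>.\<close>

lemma noninterface_jump_zero:
  assumes u: "u \<in> S_h D p" and e: "e \<in> IE" "e \<in> noninterface_edges D" and x: "x \<in> e"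
  shows "edge_jump D e u x = 0"
proof -
  obtain T1 T2 where adj: "adjacent D e = (T1, T2)" by fastforce
  note a = adjacent_props[OF e(1) adj]
  have cont: "continuous (at x within closure (Om D)) u" using u e(2) x by (auto simp: S_h_def)
  have tr: "trace_from T u x = u x" if T: "T \<in> mesh D" "e \<in> edges_of T" for T
  proof -
    have "T \<subseteq> closure (Om D)" using mesh_basic(6)[OF T(1)] closure_subset by blast
    then have "(u \<longlongrightarrow> u x) (at x within T)"
      using cont unfolding continuous_within by (rule tendsto_within_subset[rotated])
    moreover have "x \<in> closure T" using edge_in_closure[OF T] x by blast
    ultimately show ?thesis unfolding trace_from_def
      by (intro tendsto_Lim within_nontrivial mesh_basic(1)[OF T(1)])
  qed
  show ?thesis using tr[OF a(1,4)] tr[OF a(2,5)] by (simp add: edge_jump_def adj)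
qed

lemma piece_ball_nonempty:
  assumes x: "x \<in> closure T" and T: "T \<in> mesh D" and \<epsilon>: "\<epsilon> > 0"
  obtains y s where "y \<in> T \<inter> side D s" "y \<in> ball x \<epsilon>"
proof -
  have op: "open (T \<inter> ball x \<epsilon>)" using mesh_basic(1)[OF T] by (intro open_Int) auto
  obtain z where "z \<in> T" "dist z x < \<epsilon>" using x \<epsilon> unfolding closure_approachable by blast
  then have "T \<inter> ball x \<epsilon> \<noteq> {}" by (auto simp: dist_commute)
  then have "\<not> negligible (T \<inter> ball x \<epsilon>)" using open_not_negligible[OF op] by blast
  then have "\<not> T \<inter> ball x \<epsilon> \<subseteq> Gam D" using negligible_subset[OF Gam_negligible[OF C2]] by blast
  then obtain y where y: "y \<in> T" "y \<in> ball x \<epsilon>" "y \<notin> Gam D" by blast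
  then obtain s where "y \<in> side D s" using side_cases mesh_basic(6)[OF T] by blast
  then show ?thesis using that y by blast
qed

context
  fixes u \<sigma>F \<sigma>n
  assumes u: "u \<in> S_h D p" and \<sigma>: "0 < \<sigma>F" "0 < \<sigma>n"
    and zA: "A_h D u u = 0" and zP: "pen_form u u = 0" and zH: "J_hn D \<sigma>F \<sigma>n u u = 0"
begin

section \<open>Matching of the affine pieces of a kernel element\<close>

abbreviation q where "q T s \<equiv> piece_poly D p u T s"

lemma q_polys: "T \<in> mesh D \<Longrightarrow> q T s \<in> polys p"
  by (rule piece_poly(1)[OF u])

lemma q_affine:
  assumes T: "T \<in> mesh D" obtains k d where "q T s = (\<lambda>x. k \<bullet> x + d)"
proof -
  obtain k d where "\<And>x. q T s x = k \<bullet> x + d"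
    using polys_affine_of_hessian_0[OF q_polys[OF T] A_h_zero[OF u zA T]] by blast
  then show ?thesis using that by blast
qed

lemma edge_jump_zero:
  assumes e: "e \<in> IE" shows "AE t in lebesgue_on (esec e UNIV). edge_jump D e u (epath e t) = 0"
proof (cases "e \<in> interface_edges D")
  case True
  then show ?thesis using J_hn_zero(1)[OF \<sigma> u zH] e by blast
next
  case False
  then have "e \<in> noninterface_edges D" using e interior_edges_subset by (auto simp: noninterface_edges_def)
  then show ?thesis using noninterface_jump_zero[OF u e] by (intro AE_I2) (simp add: esec_def)
qed

text \<open>The jumps vanish only almost everywhere along the edge. On the open parameter set
  \<open>W\<close>, where the two traces see the fixed pieces \<open>s1\<close> and
  \<open>s2\<close>, they are continuous and hence vanish at every point.\<close>

lemma edge_match: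
  assumes e: "e \<in> IE" and adj: "adjacent D e = (T1, T2)" and x: "x \<in> e" "sided D T1 s1 x" "sided D T2 s2 x"
  shows "q T1 s1 = q T2 s2"
proof -
  note a = adjacent_props[OF e adj]
  obtain a b where ab: "a \<noteq> b" "e = open_segment a b" "epath e = linepath a b"
    using interior_edge_path[OF e] .
  note n = edge_normal_props[OF e ab(2,1)]
  let ?n = "edge_normal D e"
  obtain k1 d1 where q1: "q T1 s1 = (\<lambda>x. k1 \<bullet> x + d1)" using q_affine[OF a(1)] .
  obtain k2 d2 where q2: "q T2 s2 = (\<lambda>x. k2 \<bullet> x + d2)" using q_affine[OF a(2)] .
  define W where "W = esec e ({x. sided D T1 s1 x} \<inter> {x. sided D T2 s2 x})"
  have openA: "open ({x. sided D T1 s1 x} \<inter> {x. sided D T2 s2 x})" by (intro open_Int open_sided)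
  have Wo: "open W"
  proof -
    have "open ({0<..<1} \<inter> epath e -` ({x. sided D T1 s1 x} \<inter> {x. sided D T2 s2 x}))"
      by (rule continuous_open_preimage[OF epath_continuous[OF e] open_greaterThanLessThan openA])
    moreover have "W = {0<..<1} \<inter> epath e -` ({x. sided D T1 s1 x} \<inter> {x. sided D T2 s2 x})"
      unfolding W_def esec_eq[OF e] by blast
    ultimately show ?thesis by simp
  qed
  have WU: "W \<subseteq> esec e UNIV" unfolding W_def by (rule esec_mono) simp
  have clos: "epath e t \<in> closure T1" "epath e t \<in> closure T2" if "t \<in> W" for t
    using that edge_in_closure[OF a(1,4)] edge_in_closure[OF a(2,5)] by (auto simp: W_def esec_def)
  have tr: "trace_from T1 (L u) (epath e t) - trace_from T2 (L u) (epath e t)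
      = L (q T1 s1) (epath e t) - L (q T2 s2) (epath e t)" if L: "diff_op p L" and t: "t \<in> W" for L t
    using trace_sided(1)[OF u a(1) L clos(1)[OF t], of s1] trace_sided(1)[OF u a(2) L clos(2)[OF t], of s2] t
    by (simp add: W_def esec_def)
  have ae: "AE t in lebesgue_on W. L (q T1 s1) (epath e t) - L (q T2 s2) (epath e t) = 0"
    if L: "diff_op p L" and j: "AE t in lebesgue_on (esec e UNIV). edge_jump D e (L u) (epath e t) = 0" for L
  proof -
    have "AE t in lebesgue_on W. edge_jump D e (L u) (epath e t) = 0"
      by (rule AE_lebesgue_on_subset[OF WU _ _ j]) (use Wo esec_measurable(1)[OF e open_UNIV] in auto)
    moreover have "AE t in lebesgue_on W. t \<in> W" by (rule AE_I2) simp
    ultimately show ?thesis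
      by eventually_elim (use tr[OF L] in \<open>simp add: edge_jump_def adj\<close>)
  qed
  have z: "L (q T1 s1) (epath e t) - L (q T2 s2) (epath e t) = 0"
    if L: "diff_op p L" and j: "AE t in lebesgue_on (esec e UNIV). edge_jump D e (L u) (epath e t) = 0" and t: "t \<in> W" for L t
  proof (rule zero_on_open_of_AE[OF Wo subset_refl _ _ ae[OF L j] t])
    show "W \<in> sets lebesgue" using Wo by auto
    have c: "continuous_on W (\<lambda>t. L (q T s) (epath e t))" if "T \<in> mesh D" for T s
      by (rule continuous_on_compose2[OF polys_continuous[OF diff_opD(2)[OF L q_polys[OF that]], of UNIV] epath_continuous[OF e]]) simp
    show "continuous_on W (\<lambda>t. L (q T1 s1) (epath e t) - L (q T2 s2) (epath e t))"
      by (intro continuous_on_diff c a)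
  qed
  obtain t0 where t0: "t0 \<in> W"
  proof -
    have "x \<in> open_segment a b" using x(1) ab(2) by simp
    then obtain v where v: "0 < v" "v < 1" "x = (1 - v) *\<^sub>R a + v *\<^sub>R b"
      unfolding in_segment by blast
    then have "linepath a b v = x" by (simp add: linepath_def)
    then have "v \<in> W" using v(1,2) x unfolding W_def esec_eq[OF e] ab(3) by simp
    then show ?thesis by (rule that)
  qed
  \<comment> \<open>Two distinct parameters suffice to read off the tangential derivative of an
    affine function.\<close>
  have "W \<noteq> {t0}" using Wo not_open_singleton[of t0] by auto
  then obtain t1 where t1: "t1 \<in> W" "t1 \<noteq> t0" using t0 by blast
  define k where "k = k1 - k2"
  have h: "k \<bullet> epath e t + (d1 - d2) = 0" if "t \<in> W" for t
    using z[OF diff_op_id _ that] edge_jump_zero[OF e] by (simp add: q1 q2 k_def inner_diff_left algebra_simps)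
  have "?n \<bullet> k = 0"
    using z[OF diff_op_dn edge_jump_dn_zero[OF u zP e] t0] by (simp add: q1 q2 dn_affine k_def inner_diff_right)
  moreover have "(b - a) \<bullet> k = 0"
  proof -
    have "linepath a b t1 - linepath a b t0 = (t1 - t0) *\<^sub>R (b - a)" by (simp add: linepath_def algebra_simps)
    then have "k \<bullet> epath e t1 - k \<bullet> epath e t0 = (t1 - t0) * (k \<bullet> (b - a))"
      by (simp add: ab(3) flip: inner_diff_right)
    moreover have "k \<bullet> epath e t1 - k \<bullet> epath e t0 = 0" using h[OF t1(1)] h[OF t0] by linarith
    ultimately have "(t1 - t0) * (k \<bullet> (b - a)) = 0" by metis
    then show ?thesis using t1(2) by (simp add: inner_commute)
  qed
  ultimately have "k = 0"
    using n ab(1) by (intro orthogonal_pair_zero[of ?n k "b - a"]) auto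
  then have "k1 = k2" "d1 = d2" using h[OF t0] by (simp_all add: k_def)
  then show ?thesis by (simp add: q1 q2)
qed

text \<open>Here the tangential direction is the derivative of the curve: the linear part of the
  difference is constant along the curve, and the derivative is nonzero and perpendicular to the
  normal.\<close>

lemma interface_match:
  assumes T: "T \<in> mesh D" and x: "x \<in> T" "x \<in> Gam D" shows "q T True = q T False"
proof -
  have Ti: "T \<in> interface_elements D" using T x by (auto simp: interface_elements_def)
  obtain k1 d1 where q1: "q T True = (\<lambda>x. k1 \<bullet> x + d1)" using q_affine[OF T] .
  obtain k2 d2 where q2: "q T False = (\<lambda>x. k2 \<bullet> x + d2)" using q_affine[OF T] .
  define k where "k = k1 - k2"
  define W where "W = {0<..<1} \<inter> curve D -` T"
  have Wo: "open W" unfolding W_def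
    by (rule continuous_open_preimage[OF curve_continuous[OF C2] open_greaterThanLessThan mesh_basic(1)[OF T]])
  have WG: "W \<subseteq> gsec T" by (auto simp: W_def gsec_def)
  have Wm: "W \<in> sets lebesgue" using Wo by auto
  note restr = AE_lebesgue_on_subset[OF WG Wm gsec_measurable(1)[OF T]]
  have inW: "AE t in lebesgue_on W. t \<in> W" by (rule AE_I2) simp
  note j = interface_jump_eq[OF u T _ conjunct1[OF gsec_Gam] conjunct2[OF gsec_Gam]]
  have ae1: "AE t in lebesgue_on W. k \<bullet> curve D t + (d1 - d2) = 0"
    using restr[OF J_hn_zero(2)[OF \<sigma> u zH Ti]] inW
  proof eventually_elim
    case (elim t)
    then have t: "t \<in> gsec T" using WG by blast
    show ?case using elim(1) j[OF diff_op_id t t] by (simp add: q1 q2 k_def inner_diff_left algebra_simps)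
  qed
  have ae2: "AE t in lebesgue_on W. curve_normal D t \<bullet> k = 0"
    using restr[OF interface_jump_dn_zero[OF u zP Ti]] inW
  proof eventually_elim
    case (elim t)
    then have t: "t \<in> gsec T" using WG by blast
    have "normal D (curve D t) = curve_normal D t" using normal_curve[OF C2] t by (simp add: gsec_def)
    then show ?case using elim(1) j[OF diff_op_dn t t] by (simp add: q1 q2 dn_affine k_def inner_diff_right)
  qed
  have h: "k \<bullet> curve D t + (d1 - d2) = 0" if "t \<in> W" for t
    by (rule zero_on_open_of_AE[OF Wo subset_refl Wm _ ae1 that])
      (intro continuous_intros curve_continuous[OF C2])
  have n: "curve_normal D t \<bullet> k = 0" if "t \<in> W" for t
    by (rule zero_on_open_of_AE[OF Wo subset_refl Wm _ ae2 that])
      (intro continuous_intros curve_normal_continuous[OF C2])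
  \<comment> \<open>The point \<open>x\<close> may have parameter 0, outside the open interval; a
    slightly larger parameter keeps the curve in \<open>T\<close> and stays below 1.\<close>
  obtain t1 where t1: "t1 \<in> W"
  proof -
    obtain t0 where t0: "t0 \<in> {0..<1}" "curve D t0 = x" using Gam_param[OF C2 x(2)] .
    have "open (UNIV \<inter> curve D -` T)"
      by (rule continuous_open_preimage[OF curve_continuous[OF C2] open_UNIV mesh_basic(1)[OF T]])
    moreover have "t0 \<in> UNIV \<inter> curve D -` T" using t0 x by simp
    ultimately obtain \<delta> where \<delta>: "\<delta> > 0" "ball t0 \<delta> \<subseteq> UNIV \<inter> curve D -` T" by (meson openE)
    define t1 where "t1 = t0 + min (\<delta> / 2) ((1 - t0) / 2)"
    have "t1 \<in> ball t0 \<delta>" "0 < t1" "t1 < 1" using \<delta>(1) t0(1) by (auto simp: t1_def dist_real_def min_def field_simps)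
    then show ?thesis using that[of t1] \<delta>(2) by (auto simp: W_def)
  qed
  let ?d = "vector_derivative (curve D) (at t1)"
  have "((\<lambda>t. k \<bullet> curve D t) has_vector_derivative k \<bullet> ?d) (at t1)"
    by (rule bounded_linear.has_vector_derivative[OF bounded_linear_inner_right curve_has_derivative[OF C2]])
  moreover have "((\<lambda>t. k \<bullet> curve D t) has_vector_derivative 0) (at t1)"
  proof (rule has_vector_derivative_transform_within_open[OF _ Wo t1])
    show "((\<lambda>t. - (d1 - d2)) has_vector_derivative 0) (at t1)" by simp
    show "- (d1 - d2) = k \<bullet> curve D t" if "t \<in> W" for t using h[OF that] by simp
  qed
  ultimately have "k \<bullet> ?d = 0" by (rule vector_derivative_unique_at)
  then have "k = 0"
    using n[OF t1] curve_normal_simps[OF C2, of t1] curve_regular[OF C2, of t1]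
    by (intro orthogonal_pair_zero[of "curve_normal D t1" k ?d]) (auto simp: inner_commute)
  then have "k1 = k2" "d1 = d2" using h[OF t1] by (simp_all add: k_def)
  then show ?thesis by (simp add: q1 q2)
qed

text \<open>Local constancy expressed through the pieces that meet the ball, because
  \<open>u\<close> itself may be arbitrary on null sets.\<close>

definition locq :: "(pt \<Rightarrow> real) \<Rightarrow> real \<Rightarrow> pt \<Rightarrow> bool" where
  "locq f \<epsilon> x \<longleftrightarrow> (\<forall>T\<in>mesh D. \<forall>s. \<forall>y\<in>T \<inter> side D s \<inter> ball x \<epsilon>. q T s = f)"

text \<open>The exceptional points are the mesh vertices and, on each interior edge, the finitely
  many points where one-sidedness of an adjacent element is not guaranteed.\<close>

lemma locq_off_finite_set:
  obtains B where "finite B" "\<And>x. x \<in> Om D - B \<Longrightarrow> \<exists>f. \<exists>\<epsilon>>0. locq f \<epsilon> x"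
proof -
  have "\<exists>F. finite F \<and> (\<forall>x\<in>e - F. \<exists>f. \<exists>\<epsilon>>0. locq f \<epsilon> x)" if e: "e \<in> IE" for e
  proof -
    obtain T1 T2 a b c1 c2 where i: "adjacent D e = (T1, T2)" "T1 \<in> mesh D" "T2 \<in> mesh D" "T1 \<noteq> T2"
      "e \<in> edges_of T1" "e \<in> edges_of T2" "tri T1 a b c1" "tri T2 a b c2" "e = open_segment a b" "a \<noteq> b"
      using e by (rule interior_edgeE)
    obtain F1 where F1: "finite F1" "\<And>x. x \<in> e - F1 \<Longrightarrow> \<exists>s. sided D T1 s x"
      using edge_sided[OF i(2,5) interior_edge_subset_Om[OF e]] by blast
    obtain F2 where F2: "finite F2" "\<And>x. x \<in> e - F2 \<Longrightarrow> \<exists>s. sided D T2 s x"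
      using edge_sided[OF i(3,6) interior_edge_subset_Om[OF e]] by blast
    have "\<exists>f. \<exists>\<epsilon>>0. locq f \<epsilon> x" if x: "x \<in> e - (F1 \<union> F2)" for x
    proof -
      obtain s1 s2 where s: "sided D T1 s1 x" "sided D T2 s2 x" using F1(2) F2(2) x by blast
      have eq: "q T1 s1 = q T2 s2" using edge_match[OF e i(1) _ s] x by blast
      obtain \<epsilon>1 where e1: "\<epsilon>1 > 0" "T1 \<inter> ball x \<epsilon>1 \<subseteq> side D s1" using s(1) by (auto simp: sided_def)
      obtain \<epsilon>2 where e2: "\<epsilon>2 > 0" "T2 \<inter> ball x \<epsilon>2 \<subseteq> side D s2" using s(2) by (auto simp: sided_def)
      have xs: "x \<in> open_segment a b" using x i(9) by blast
      obtain \<epsilon>0 where e0: "\<epsilon>0 > 0" "ball x \<epsilon>0 \<subseteq> T1 \<union> T2 \<union> open_segment a b"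
        using xs by (rule interior_edge_nbhd[OF i(7,8) mesh_disjoint[OF i(2-4)]])
      define \<epsilon> where "\<epsilon> = min \<epsilon>0 (min \<epsilon>1 \<epsilon>2)"
      have eps: "\<epsilon> > 0" using e0(1) e1(1) e2(1) by (simp add: \<epsilon>_def)
      have "q T s = q T1 s1" if T: "T \<in> mesh D" and y: "y \<in> T \<inter> side D s \<inter> ball x \<epsilon>" for T s y
      proof -
        have yb: "y \<in> ball x \<epsilon>0" "y \<in> ball x \<epsilon>1" "y \<in> ball x \<epsilon>2" using y by (auto simp: \<epsilon>_def)
        consider "y \<in> T1" | "y \<in> T2" | "y \<in> e" using yb(1) e0(2) i(9) by blast
        then show ?thesis
        proof cases
          case 1
          then have "T = T1" using mesh_disjoint[OF T i(2)] y by blast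
          moreover have "s = s1" using side_unique e1(2) yb(2) 1 y by blast
          ultimately show ?thesis by simp
        next
          case 2
          then have "T = T2" using mesh_disjoint[OF T i(3)] y by blast
          moreover have "s = s2" using side_unique e2(2) yb(3) 2 y by blast
          ultimately show ?thesis using eq by simp
        next
          case 3
          \<comment> \<open>An open element that meets \<open>closure T1\<close> meets
            \<open>T1\<close> and so equals it; but \<open>T1\<close> contains no point of its own
            edge.\<close>
          then have "y \<in> T \<inter> closure T1" using edge_in_closure[OF i(2,5)] y by blast
          then have "T \<inter> T1 \<noteq> {}" using open_Int_closure_eq_empty[OF mesh_basic(1)[OF T]] by blast
          then have "T = T1" using mesh_disjoint[OF T i(2)] by blast
          then show ?thesis using edge_disjoint_element[OF i(7)] 3 y i(9) by blast
        qed
      qed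
      then have "locq (q T1 s1) \<epsilon> x" unfolding locq_def by blast
      then show ?thesis using eps by blast
    qed
    then show ?thesis using F1(1) F2(1) by (intro exI[of _ "F1 \<union> F2"]) simp
  qed
  then obtain F where F: "\<And>e. e \<in> IE \<Longrightarrow> finite (F e)"
    "\<And>e x. e \<in> IE \<Longrightarrow> x \<in> e - F e \<Longrightarrow> \<exists>f. \<exists>\<epsilon>>0. locq f \<epsilon> x" by metis
  let ?B = "(\<Union>T\<in>mesh D. vertices T) \<union> (\<Union>e\<in>IE. F e)"
  show ?thesis
  proof (rule that[of ?B])
    show "finite ?B" using finite_vertices F(1) finite_index(1) by blast
    fix x assume x: "x \<in> Om D - ?B"
    then have xO: "x \<in> Om D" by blast
    show "\<exists>f. \<exists>\<epsilon>>0. locq f \<epsilon> x"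
      using xO
    proof (cases rule: Om_point_cases)
      case (elem T)
      show ?thesis
      proof (cases "x \<in> Gam D")
        case True
        obtain \<epsilon> where eps: "\<epsilon> > 0" "ball x \<epsilon> \<subseteq> T" by (rule openE[OF mesh_basic(1)[OF elem(1)] elem(2)])
        have eq: "q T s = q T True" for s using interface_match[OF elem True] by (cases s) simp_all
        have "locq (q T True) \<epsilon> x" unfolding locq_def
        proof (intro ballI allI)
          fix T' s y assume T': "T' \<in> mesh D" and y: "y \<in> T' \<inter> side D s \<inter> ball x \<epsilon>"
          have "T' = T" using mesh_disjoint[OF T' elem(1)] y eps(2) by blast
          then show "q T' s = q T True" using eq by simp
        qed
        then show ?thesis using eps(1) by blast
      next
        case False
        obtain s0 where s0: "x \<in> side D s0" using side_cases[OF xO False] by blast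
        obtain \<epsilon> where eps: "\<epsilon> > 0" "ball x \<epsilon> \<subseteq> T \<inter> side D s0"
          by (rule openE[OF open_piece[OF elem(1)], of x s0]) (use elem(2) s0 in auto)
        have "locq (q T s0) \<epsilon> x" unfolding locq_def
        proof (intro ballI allI)
          fix T' s y assume T': "T' \<in> mesh D" and y: "y \<in> T' \<inter> side D s \<inter> ball x \<epsilon>"
          have "T' = T" using mesh_disjoint[OF T' elem(1)] y eps(2) by blast
          moreover have "s = s0" using side_unique y eps(2) by blast
          ultimately show "q T' s = q T s0" by simp
        qed
        then show ?thesis using eps(1) by blast
      qed
    next
      case (vertex T)
      then show ?thesis using x by blast
    next
      case (edge e)
      then show ?thesis using F(2)[of e x] x by blast
    qed
  qed
qed

lemma locq_mono: "locq f \<epsilon> x \<Longrightarrow> ball y \<delta> \<subseteq> ball x \<epsilon> \<Longrightarrow> locq f \<delta> y"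
  unfolding locq_def by blast

text \<open>Every ball around \<open>x\<close> contains a point of some piece, and the polynomial of
  that piece is both \<open>f\<close> and \<open>g\<close>.\<close>

lemma locq_unique:
  assumes x: "x \<in> Om D" and f: "\<epsilon> > 0" "locq f \<epsilon> x" and g: "\<delta> > 0" "locq g \<delta> x" shows "f = g"
proof -
  obtain T where T: "T \<in> mesh D" "x \<in> closure T" using mesh_cover x closure_subset by blast
  obtain y s where y: "y \<in> T \<inter> side D s" "y \<in> ball x (min \<epsilon> \<delta>)"
    using piece_ball_nonempty[OF T(2,1), of "min \<epsilon> \<delta>"] f(1) g(1) by auto
  then have "y \<in> ball x \<epsilon>" "y \<in> ball x \<delta>" by auto
  then have "q T s = f" "q T s = g" using f(2) g(2) T(1) y(1) unfolding locq_def by blast+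
  then show ?thesis by simp
qed

text \<open>The polynomial that \<open>locq\<close> selects at each point is locally constant on a
  connected set; every nonempty piece, being open, still has a point outside the finite set
  removed.\<close>

lemma pieces_equal:
  obtains f where "\<And>T s. T \<in> mesh D \<Longrightarrow> T \<inter> side D s \<noteq> {} \<Longrightarrow> q T s = f"
proof -
  obtain B where B: "finite B" "\<And>x. x \<in> Om D - B \<Longrightarrow> \<exists>f. \<exists>\<epsilon>>0. locq f \<epsilon> x"
    using locq_off_finite_set by blast
  have conn: "connected (Om D - B)"
    using Om(1,2) B(1) by (intro connected_open_delete_finite) auto
  from B(2) obtain F where F: "\<And>x. x \<in> Om D - B \<Longrightarrow> \<exists>\<epsilon>>0. locq (F x) \<epsilon> x" by metis
  have const: "F x = F y" if "x \<in> Om D - B" "y \<in> Om D - B" for x y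
  proof (rule connected_local_const[OF conn that], rule ballI)
    fix a assume a: "a \<in> Om D - B"
    obtain \<epsilon> where eps: "\<epsilon> > 0" "locq (F a) \<epsilon> a" using F[OF a] by blast
    have "F a = F b" if b: "b \<in> Om D - B" "dist b a < \<epsilon> / 2" for b
    proof -
      have "ball b (\<epsilon> / 2) \<subseteq> ball a \<epsilon>"
      proof
        fix z assume "z \<in> ball b (\<epsilon> / 2)"
        then show "z \<in> ball a \<epsilon>" using b(2) dist_triangle[of a z b] by (simp add: dist_commute)
      qed
      then have "locq (F a) (\<epsilon> / 2) b" using locq_mono[OF eps(2)] by blast
      moreover obtain \<delta> where "\<delta> > 0" "locq (F b) \<delta> b" using F[OF b(1)] by blast
      ultimately show ?thesis using locq_unique[of b "\<epsilon> / 2" "F a" \<delta> "F b"] eps(1) b(1) by simp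
    qed
    then show "\<forall>\<^sub>F b in at a within Om D - B. F a = F b"
      unfolding eventually_at using eps(1) by (intro exI[of _ "\<epsilon> / 2"]) auto
  qed
  have ex: "\<exists>x. x \<in> T \<inter> side D s - B" if "T \<in> mesh D" "T \<inter> side D s \<noteq> {}" for T s
  proof -
    have "infinite (T \<inter> side D s)"
      using open_not_negligible[OF open_piece[OF that(1)] that(2)] negligible_finite by blast
    then have "T \<inter> side D s - B \<noteq> {}" using B(1) by (metis finite.emptyI finite_Diff2)
    then show ?thesis by blast
  qed
  have val: "q T s = F x" if T: "T \<in> mesh D" and x: "x \<in> T \<inter> side D s - B" for T s x
  proof -
    have "x \<in> Om D - B" using x mesh_basic(6)[OF T] by blast
    then obtain \<epsilon> where "\<epsilon> > 0" "locq (F x) \<epsilon> x" using F by blast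
    moreover have "x \<in> T \<inter> side D s \<inter> ball x \<epsilon>" using x \<open>\<epsilon> > 0\<close> by simp
    ultimately show ?thesis using T unfolding locq_def by blast
  qed
  show ?thesis
  proof (cases "Om D - B = {}")
    \<comment> \<open>A nonempty piece would have a point outside \<open>B\<close>, so here the
      claim is vacuous.\<close>
    case True
    have "q T s = (\<lambda>_. 0)" if "T \<in> mesh D" "T \<inter> side D s \<noteq> {}" for T s
      using ex[OF that] mesh_basic(6)[OF that(1)] True by blast
    then show ?thesis by (rule that)
  next
    case False
    then obtain x0 where x0: "x0 \<in> Om D - B" by blast
    have "q T s = F x0" if T: "T \<in> mesh D" "T \<inter> side D s \<noteq> {}" for T s
    proof -
      obtain x where x: "x \<in> T \<inter> side D s - B" using ex[OF T] by blast
      then have "x \<in> Om D - B" using mesh_basic(6)[OF T(1)] by blast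
      then show ?thesis using val[OF T(1) x] const[OF x0] by simp
    qed
    then show ?thesis by (rule that)
  qed
qed

text \<open>The common affine function vanishes at the extreme points of the convex hull of the domain: they
  are mesh vertices on the boundary, where \<open>u\<close> is continuous and zero.\<close>

lemma pieces_zero:
  assumes T0: "T0 \<in> mesh D" "T0 \<inter> side D s0 \<noteq> {}" shows "q T0 s0 x = 0"
proof -
  obtain f where f: "\<And>T s. T \<in> mesh D \<Longrightarrow> T \<inter> side D s \<noteq> {} \<Longrightarrow> q T s = f"
    using pieces_equal by blast
  have f0: "q T0 s0 = f" by (rule f[OF T0])
  obtain k d where kd: "f = (\<lambda>x. k \<bullet> x + d)" using q_affine[OF T0(1), of s0] f0 by metis
  define K where "K = convex hull (closure (Om D))"
  have K: "compact K" "convex K"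
    using Om(4) by (auto simp: K_def intro!: compact_convex_hull)
  have vert: "f v = 0" if v: "v extreme_point_of K" for v
  proof (rule ccontr)
    assume fv: "f v \<noteq> 0"
    have vO: "v \<in> closure (Om D)" using v extreme_point_of_convex_hull unfolding K_def by blast
    have clK: "closure (Om D) \<subseteq> K" unfolding K_def by (rule hull_subset)
    have "Om D \<subseteq> interior K" using interior_maximal[OF _ Om(1), of K] clK closure_subset by blast
    then have "v \<notin> Om D" using extreme_point_not_in_interior[OF v] by blast
    then have vF: "v \<in> frontier (Om D)" using vO Om(1) by (simp add: frontier_def interior_open)
    then have uv: "u v = 0" using u by (simp add: S_h_def)
    obtain T where T: "T \<in> mesh D" "v \<in> closure T" using mesh_cover[OF vO] by blast
    have "closure T \<subseteq> K" using mesh_basic(6)[OF T(1)] closure_mono clK by blast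
    \<comment> \<open>Extremality passes to the smaller convex set \<open>closure T\<close>, whose
      extreme points are its vertices.\<close>
    then have "v extreme_point_of closure T"
      using v T(2) unfolding extreme_point_of_def by blast
    then have "v \<in> vertices T" by (simp add: vertices_def)
    moreover obtain a b c where t: "tri T a b c" using mesh_tri[OF T(1)] .
    ultimately have "v \<in> nodes p T" using vertices_subset_nodes[OF t p_pos] by blast
    then have "continuous (at v within closure (Om D)) u" using u T(1) by (auto simp: S_h_def)
    then obtain \<delta>1 where d1: "\<delta>1 > 0" "\<And>y. y \<in> closure (Om D) \<Longrightarrow> dist y v < \<delta>1 \<Longrightarrow> dist (u y) (u v) < \<bar>f v\<bar> / 2"
      unfolding continuous_within_eps_delta using fv by (metis half_gt_zero zero_less_abs_iff)
    have "isCont f v" using polys_isCont[OF q_polys[OF T0(1), where s = s0]] f0 by simp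
    then obtain \<delta>2 where d2: "\<delta>2 > 0" "\<And>y. dist y v < \<delta>2 \<Longrightarrow> dist (f y) (f v) < \<bar>f v\<bar> / 2"
      unfolding continuous_at_eps_delta using fv by (metis half_gt_zero zero_less_abs_iff)
    \<comment> \<open>A point of a piece so close to \<open>v\<close> that \<open>u\<close> is near
      0 and \<open>f\<close> is near \<open>f v\<close>, although the two agree there.\<close>
    obtain y s where y: "y \<in> T \<inter> side D s" "y \<in> ball v (min \<delta>1 \<delta>2)"
      using piece_ball_nonempty[OF T(2,1), of "min \<delta>1 \<delta>2"] d1(1) d2(1) by auto
    have "q T s = f" by (rule f[OF T(1)]) (use y(1) in blast)
    then have uy: "u y = f y" using piece_poly(2)[OF u T(1) y(1)] by simp
    have "y \<in> closure (Om D)" using y(1) mesh_basic(6)[OF T(1)] closure_subset by blast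
    moreover have "dist y v < \<delta>1" "dist y v < \<delta>2" using y(2) by (auto simp: dist_commute)
    ultimately have "\<bar>f y\<bar> < \<bar>f v\<bar> / 2" "\<bar>f y - f v\<bar> < \<bar>f v\<bar> / 2"
      using d1(2)[of y] d2(2)[of y] uy uv by (auto simp: dist_real_def)
    then show False by linarith
  qed
  \<comment> \<open>Krein-Milman: the extreme points generate the hull, and the zero set of an
    affine function is convex, so it contains the hull.\<close>
  have "K = convex hull {x. x extreme_point_of K}" by (rule Krein_Milman_Minkowski[OF K])
  also have "\<dots> \<subseteq> {x. k \<bullet> x = - d}"
  proof (rule hull_minimal)
    show "{x. x extreme_point_of K} \<subseteq> {x. k \<bullet> x = - d}"
      using vert kd by (auto simp: eq_neg_iff_add_eq_0)
  qed (rule convex_hyperplane)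
  finally have Kz: "f x = 0" if "x \<in> K" for x using that kd by auto
  have "Om D \<subseteq> K" unfolding K_def using closure_subset hull_subset by (metis subset_trans)
  then have "f x = 0"
    using polys_zero_of_open[OF Om(1,3) q_polys[OF T0(1), where s = s0]] f0 Kz by auto
  then show ?thesis using f0 by simp
qed

text \<open>The boundaries of the elements and the interface are null sets; every other point of the
  domain lies in a piece.\<close>

lemma kernel_AE_zero: "AE x in lebesgue_on (Om D). u x = 0"
proof -
  have "negligible (\<Union>T\<in>mesh D. frontier T)"
    using finite_mesh mesh_basic(2) negligible_convex_frontier by (intro negligible_Union) auto
  then have N: "negligible ((\<Union>T\<in>mesh D. frontier T) \<union> Gam D)"
    using Gam_negligible[OF C2] by (rule negligible_Un)
  then have "AE x in lebesgue. x \<notin> (\<Union>T\<in>mesh D. frontier T) \<union> Gam D"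
    unfolding negligible_iff_null_sets by (rule AE_not_in)
  then have "AE x in lebesgue. x \<in> Om D \<longrightarrow> u x = 0"
  proof eventually_elim
    case (elim x)
    show ?case
    proof
      assume x: "x \<in> Om D"
      obtain T where T: "T \<in> mesh D" "x \<in> closure T" using mesh_cover x closure_subset by blast
      have "x \<notin> frontier T" using elim T(1) by blast
      then have xT: "x \<in> T" using T(2) mesh_basic(1)[OF T(1)] by (simp add: frontier_def interior_open)
      obtain s where s: "x \<in> side D s" using side_cases[OF x] elim by blast
      have "u x = q T s x" using piece_poly(2)[OF u T(1)] xT s by blast
      also have "\<dots> = 0" by (rule pieces_zero[OF T(1)]) (use xT s in blast)
      finally show "u x = 0" .
    qed
  qed
  then show ?thesis using Om(1) by (simp add: AE_restrict_space_iff)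
qed

end

section \<open>Well-posedness\<close>

text \<open>\<open>kernel_AE_zero\<close> serves twice: it makes the load vanish on the kernel,
  which gives existence, and it identifies two solutions up to a null set.\<close>

theorem discrete_problem_well_posed:
  "\<exists>\<sigma>0 > 0. \<forall>\<sigma>u \<ge> \<sigma>0. \<forall>\<sigma>F > 0. \<forall>\<sigma>n > 0. \<forall>f \<in> L2 (Om D).
     \<exists>u. discrete_solution D p \<sigma>u \<sigma>F \<sigma>n f u \<and>
       (\<forall>w. discrete_solution D p \<sigma>u \<sigma>F \<sigma>n f w \<longrightarrow> (AE x in lebesgue_on (Om D). w x = u x))"
proof -
  obtain \<sigma>0 where \<sigma>0: "\<sigma>0 > 0"
    "\<And>\<sigma>u \<sigma>F \<sigma>n. \<sigma>u \<ge> \<sigma>0 \<Longrightarrow> 0 < \<sigma>F \<Longrightarrow> 0 < \<sigma>n \<Longrightarrow> psd_form (S_h D p) dset (a_h D \<sigma>u \<sigma>F \<sigma>n)"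
    "\<And>\<sigma>u \<sigma>F \<sigma>n u. \<sigma>u \<ge> \<sigma>0 \<Longrightarrow> 0 < \<sigma>F \<Longrightarrow> 0 < \<sigma>n \<Longrightarrow> u \<in> S_h D p \<Longrightarrow> a_h D \<sigma>u \<sigma>F \<sigma>n u u = 0 \<Longrightarrow>
       A_h D u u = 0 \<and> pen_form u u = 0 \<and> J_hn D \<sigma>F \<sigma>n u u = 0"
    using coercivity by blast
  show ?thesis
  proof (intro exI[of _ \<sigma>0] conjI allI impI ballI \<sigma>0(1))
    fix \<sigma>u \<sigma>F \<sigma>n :: real and f
    assume s: "\<sigma>0 \<le> \<sigma>u" "0 < \<sigma>F" "0 < \<sigma>n" and f: "f \<in> L2 (Om D)"
    let ?a = "a_h D \<sigma>u \<sigma>F \<sigma>n" and ?L = "\<lambda>v. integral\<^sup>L (lebesgue_on (Om D)) (\<lambda>x. f x * v x)"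
    note a = \<sigma>0(2)[OF s]
    have zero: "AE x in lebesgue_on (Om D). v x = 0" if v: "v \<in> S_h D p" "?a v v = 0" for v
      using \<sigma>0(3)[OF s v] kernel_AE_zero[OF v(1) s(2,3)] by blast
    have L2: "v \<in> L2 (Om D)" if "v \<in> S_h D p" for v using that by (simp add: S_h_def)
    have "\<exists>u\<in>S_h D p. \<forall>v\<in>S_h D p. ?a u v = ?L v"
    proof (rule galerkin_semidefinite[OF dset(1) lin_space_S_h a])
      show "?L (fadd u c v) = ?L u + c * ?L v" if "u \<in> S_h D p" "v \<in> S_h D p" for u v c
      proof -
        note i = L2_mult_integrable[OF f L2[OF that(1)]] L2_mult_integrable[OF f L2[OF that(2)]]
        have "?L (fadd u c v) = integral\<^sup>L (lebesgue_on (Om D)) (\<lambda>x. f x * u x + c * (f x * v x))"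
          by (simp add: fadd_def algebra_simps)
        also have "\<dots> = ?L u + c * ?L v" using i by (subst Bochner_Integration.integral_add) auto
        finally show ?thesis .
      qed
      show "?L v = 0" if v: "v \<in> S_h D p" "?a v v = 0" for v
        using zero[OF v] by (intro integral_eq_zero_AE) (auto elim!: eventually_mono)
    qed
    then obtain u where u: "u \<in> S_h D p" "\<And>v. v \<in> S_h D p \<Longrightarrow> ?a u v = ?L v" by blast
    show "\<exists>u. discrete_solution D p \<sigma>u \<sigma>F \<sigma>n f u \<and>
       (\<forall>w. discrete_solution D p \<sigma>u \<sigma>F \<sigma>n f w \<longrightarrow> (AE x in lebesgue_on (Om D). w x = u x))"
    proof (intro exI[of _ u] conjI allI impI)
      show "discrete_solution D p \<sigma>u \<sigma>F \<sigma>n f u" using u by (simp add: discrete_solution_def)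
      fix w assume "discrete_solution D p \<sigma>u \<sigma>F \<sigma>n f w"
      then have w: "w \<in> S_h D p" "\<And>v. v \<in> S_h D p \<Longrightarrow> ?a w v = ?L v" by (auto simp: discrete_solution_def)
      define d where "d = fadd w (- 1) u"
      have d: "d \<in> S_h D p" using lin_space_S_h[of D p] w u by (simp add: d_def lin_space_def)
      have "?a d d = ?a w d + (- 1) * ?a u d"
        using bilinD(1)[OF psd_formD(1)[OF a] w(1) u(1) d, of "- 1"] by (simp add: d_def)
      then have "?a d d = 0" using w(2)[OF d] u(2)[OF d] by simp
      from zero[OF d this] show "AE x in lebesgue_on (Om D). w x = u x"
        by eventually_elim (simp add: d_def fadd_def)
    qed
  qed
qed

end

theorem mainTheorem5:
  fixes D :: ife_data and r \<kappa> :: real and p :: nat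
  assumes "ife_setting D r \<kappa>"
    and "p \<in> {2, 3}"
  shows "\<exists>\<sigma>0 > 0. \<forall>\<sigma>u \<ge> \<sigma>0. \<forall>\<sigma>F > 0. \<forall>\<sigma>n > 0. \<forall>f \<in> L2 (Om D).
           \<exists>u. discrete_solution D p \<sigma>u \<sigma>F \<sigma>n f u \<and>
               (\<forall>w. discrete_solution D p \<sigma>u \<sigma>F \<sigma>n f w \<longrightarrow>
                    (AE x in lebesgue_on (Om D). w x = u x))"
proof -
  interpret ife_problem D r \<kappa> p
    using assms by unfold_locales
  show ?thesis by (rule discrete_problem_well_posed)
qed

end
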